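(* If $G$ is a branch group, then $\mathbb{C}[G]$ is not $^*$-just-infinite, whence the full group $C^*$-algebra $C^*(G)$ is not just-infinite.
   Context: Let $\bar{m} = \{m_n\}_{n=0}^\infty$ be a sequence of integers $m_n \ge 2$, and let $T_{\bar{m}}$ be the spherically homogeneous rooted tree with branching index $\bar m$, i.e., each vertex at level $n$ has exactly $m_n$ children at level $n+1$ (the root being at level $0$). For a vertex $v$, $T_v$ is the subtree with root $v$ consisting of all vertices below $v$. If a group $G$ acts on $T = T_{\bar{m}}$ by automorphisms of the rooted tree, the rigid stabilizer $\mathrm{rist}_G(v)$ of a vertex $v$ is the subgroup of all $g \in G$ which fix $v$ and act trivially outside $T_v$, and $\mathrm{rist}_G(n)$ is the subgroup of $G$ generated by all $\mathrm{rist}_G(v)$ with $v$ at level $n$. A group $G$ is a branch group if it admits a faithful action on some such tree $T = T_{\bar{m}}$ such that the index $|G : \mathrm{rist}_G(n)|$ is finite for all $n \in \mathbb{N}$ and $G$ acts transitively on each level of $T$. $\mathbb{C}[G]$ is $^*$-just-infinite if each (unital) $^*$-representation of the $^*$-algebra $\mathbb{C}[G]$ on a Hilbert space either is injective or has finite dimensional image. $C^*(G)$ is the completion of $\mathbb{C}[G]$ in the maximal $C^*$-norm. A $C^*$-algebra $A$ is just-infinite if it is infinite dimensional and $A/I$ is finite dimensional for each non-zero closed two-sided ideal $I$. *)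

theory Defs
  imports
    Complex_Main
    "HOL-Library.Sublist"
    "HOL-Algebra.Generated_Groups"
    "HOL-Algebra.Group_Action"
    "HOL-Algebra.QuotRing"
    "Jordan_Normal_Form.VS_Connect"
begin

section \<open>Branch groups\<close>

text \<open>
  The vertices of the spherically homogeneous rooted tree with branching index \<open>m\<close> are the
  finite words \<open>v\<close> whose \<open>i\<close>-th letter is smaller than \<open>m i\<close>. The root is the
  empty word, the level of a vertex is its length, and the children of \<open>v\<close> are the
  one-letter extensions of \<open>v\<close>.
\<close>

definition tree_level :: "(nat \<Rightarrow> nat) \<Rightarrow> nat \<Rightarrow> nat list set" where
  "tree_level m n = {v. length v = n \<and> (\<forall>i<n. v ! i < m i)}"

definition tree_verts :: "(nat \<Rightarrow> nat) \<Rightarrow> nat list set" where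
  "tree_verts m = (\<Union>n. tree_level m n)"

definition tree_adjacent :: "nat list \<Rightarrow> nat list \<Rightarrow> bool" where
  "tree_adjacent v w \<longleftrightarrow> (\<exists>i. w = v @ [i]) \<or> (\<exists>i. v = w @ [i])"

definition tree_automorphisms :: "(nat \<Rightarrow> nat) \<Rightarrow> (nat list \<Rightarrow> nat list) set" where
  "tree_automorphisms m =
    {f \<in> Bij (tree_verts m). f [] = [] \<and>
       (\<forall>v\<in>tree_verts m. \<forall>w\<in>tree_verts m. tree_adjacent (f v) (f w) \<longleftrightarrow> tree_adjacent v w)}"

definition subtree :: "(nat \<Rightarrow> nat) \<Rightarrow> nat list \<Rightarrow> nat list set" where
  "subtree m v = {w \<in> tree_verts m. prefix v w}"

definition rist_vertex ::
  "('g, 'm) monoid_scheme \<Rightarrow> (nat \<Rightarrow> nat) \<Rightarrow> ('g \<Rightarrow> nat list \<Rightarrow> nat list) \<Rightarrow> nat list \<Rightarrow> 'g set"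
  where
  "rist_vertex G m \<phi> v =
    {g \<in> carrier G. \<phi> g v = v \<and> (\<forall>w \<in> tree_verts m - subtree m v. \<phi> g w = w)}"

definition rist_level ::
  "('g, 'm) monoid_scheme \<Rightarrow> (nat \<Rightarrow> nat) \<Rightarrow> ('g \<Rightarrow> nat list \<Rightarrow> nat list) \<Rightarrow> nat \<Rightarrow> 'g set"
  where
  "rist_level G m \<phi> n = generate G (\<Union>v \<in> tree_level m n. rist_vertex G m \<phi> v)"

definition branch_group :: "('g, 'm) monoid_scheme \<Rightarrow> bool" where
  "branch_group G \<longleftrightarrow> group G \<and>
    (\<exists>m \<phi>. (\<forall>n. m n \<ge> 2) \<and>
       faithful_action G (tree_verts m) \<phi> \<and>
       (\<forall>g \<in> carrier G. \<phi> g \<in> tree_automorphisms m) \<and>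
       (\<forall>n. finite (rcosets\<^bsub>G\<^esub> (rist_level G m \<phi> n))) \<and>
       (\<forall>n. \<forall>v \<in> tree_level m n. \<forall>w \<in> tree_level m n. \<exists>g \<in> carrier G. \<phi> g v = w))"


section \<open>Complex unital *-algebras\<close>

text \<open>
  A complex vector space is a \<open>module\<close> record over the field \<open>class_ring :: complex ring\<close>.
  All algebras below are unital, as the algebras of a discrete group are.
\<close>

record 'a star_algebra = "(complex, 'a) module" +
  star :: "'a \<Rightarrow> 'a"

record 'a normed_star_algebra = "'a star_algebra" +
  algebra_norm :: "'a \<Rightarrow> real"

abbreviation finite_dimensional :: "(complex, 'a, 'm) module_scheme \<Rightarrow> bool" where
  "finite_dimensional V \<equiv> vectorspace.fin_dim (class_ring :: complex ring) V"

definition star_hom ::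
  "('a, 'm) star_algebra_scheme \<Rightarrow> ('b, 'n) star_algebra_scheme \<Rightarrow> ('a \<Rightarrow> 'b) set" where
  "star_hom A B =
    {\<pi> \<in> Ring.ring_hom A B \<inter> LinearCombinations.module_hom (class_ring :: complex ring) A B.
       \<forall>x \<in> carrier A. \<pi> (star A x) = star B (\<pi> x)}"

text \<open>
  The quotient by an ideal that is invariant under scalars and the involution, extending the
  ring quotient \<open>A Quot I\<close> of the library.
\<close>

definition quotient_star_algebra ::
  "('a, 'm) star_algebra_scheme \<Rightarrow> 'a set \<Rightarrow> 'a set star_algebra" where
  "quotient_star_algebra A I =
    \<lparr>carrier = carrier (A Quot I), mult = mult (A Quot I), one = one (A Quot I),
     zero = zero (A Quot I), add = add (A Quot I),
     smult = (\<lambda>c X. \<Union>x\<in>X. I +>\<^bsub>A\<^esub> (c \<odot>\<^bsub>A\<^esub> x)),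
     star = (\<lambda>X. \<Union>x\<in>X. I +>\<^bsub>A\<^esub> star A x)\<rparr>"


section \<open>Hilbert spaces and *-representations\<close>

text \<open>
  The ring multiplication and unit that a \<open>module\<close> record carries play no role in a
  Hilbert space. The inner product is linear in the first argument.
\<close>

record 'h hilbert = "(complex, 'h) module" +
  inner_prod :: "'h \<Rightarrow> 'h \<Rightarrow> complex"

definition hilbert_norm :: "('h, 'm) hilbert_scheme \<Rightarrow> 'h \<Rightarrow> real" where
  "hilbert_norm H x = sqrt (Re (inner_prod H x x))"

definition hilbert_space :: "('h, 'm) hilbert_scheme \<Rightarrow> bool" where
  "hilbert_space H \<longleftrightarrow> vectorspace (class_ring :: complex ring) H \<and>
    (\<forall>x\<in>carrier H. \<forall>y\<in>carrier H. \<forall>z\<in>carrier H.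
       inner_prod H (x \<oplus>\<^bsub>H\<^esub> y) z = inner_prod H x z + inner_prod H y z) \<and>
    (\<forall>c. \<forall>x\<in>carrier H. \<forall>y\<in>carrier H.
       inner_prod H (c \<odot>\<^bsub>H\<^esub> x) y = c * inner_prod H x y) \<and>
    (\<forall>x\<in>carrier H. \<forall>y\<in>carrier H. inner_prod H y x = cnj (inner_prod H x y)) \<and>
    (\<forall>x\<in>carrier H. Re (inner_prod H x x) \<ge> 0) \<and>
    (\<forall>x\<in>carrier H. inner_prod H x x = 0 \<longrightarrow> x = \<zero>\<^bsub>H\<^esub>) \<and>
    (\<forall>s. (\<forall>n. s n \<in> carrier H) \<and>
         (\<forall>e>0. \<exists>N::nat. \<forall>i\<ge>N. \<forall>j\<ge>N. hilbert_norm H (s i \<ominus>\<^bsub>H\<^esub> s j) < e) \<longrightarrow>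
         (\<exists>x\<in>carrier H. (\<lambda>n. hilbert_norm H (s n \<ominus>\<^bsub>H\<^esub> x)) \<longlonglongrightarrow> 0))"

text \<open>
  Operators are extensional functions, so that equality of operators is equality on \<open>H\<close>. On a
  Hilbert space, the description of the adjoint in \<open>star\<close> determines it uniquely.
\<close>

definition bounded_operators :: "('h, 'm) hilbert_scheme \<Rightarrow> ('h \<Rightarrow> 'h) set" where
  "bounded_operators H =
    {T \<in> LinearCombinations.module_hom (class_ring :: complex ring) H H \<inter> extensional (carrier H).
       \<exists>K. \<forall>x\<in>carrier H. hilbert_norm H (T x) \<le> K * hilbert_norm H x}"

definition operator_algebra :: "('h, 'm) hilbert_scheme \<Rightarrow> ('h \<Rightarrow> 'h) star_algebra" where
  "operator_algebra H =
    \<lparr>carrier = bounded_operators H,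
     mult = compose (carrier H),
     one = (\<lambda>x\<in>carrier H. x),
     zero = (\<lambda>x\<in>carrier H. \<zero>\<^bsub>H\<^esub>),
     add = (\<lambda>S T. \<lambda>x\<in>carrier H. S x \<oplus>\<^bsub>H\<^esub> T x),
     smult = (\<lambda>c T. \<lambda>x\<in>carrier H. c \<odot>\<^bsub>H\<^esub> T x),
     star = (\<lambda>T. THE S. S \<in> bounded_operators H \<and>
       (\<forall>x\<in>carrier H. \<forall>y\<in>carrier H. inner_prod H (T x) y = inner_prod H x (S y)))\<rparr>"

definition star_representation ::
  "('a, 'm) star_algebra_scheme \<Rightarrow> ('h, 'n) hilbert_scheme \<Rightarrow> ('a \<Rightarrow> 'h \<Rightarrow> 'h) \<Rightarrow> bool" where
  "star_representation A H \<pi> \<longleftrightarrow> hilbert_space H \<and> \<pi> \<in> star_hom A (operator_algebra H)"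

text \<open>
  HOL cannot quantify over all types inside a definition, so the Hilbert spaces range over those
  whose underlying set lies in \<open>nat \<Rightarrow> 'a\<close>, where \<open>'a\<close> is the type of the algebra. This loses
  no generality. Whether a representation is injective and whether its image is finite
  dimensional depend on its kernel only. Choose for each \<open>a\<close> outside the kernel a vector not
  annihilated by \<open>a\<close>; the closed invariant subspace generated by these vectors carries a
  representation with the same kernel, and it has a dense subset that is the image of a subset of
  the finite sequences in \<open>A \<times> A\<close>, hence its cardinality is at most that of \<open>nat \<Rightarrow> 'a\<close>.
\<close>

definition star_just_infinite :: "('a, 'm) star_algebra_scheme \<Rightarrow> bool" where
  "star_just_infinite A \<longleftrightarrow>
    (\<forall>(H :: (nat \<Rightarrow> 'a) hilbert) \<pi>. star_representation A H \<pi> \<longrightarrow>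
       inj_on \<pi> (carrier A) \<or>
       finite_dimensional ((operator_algebra H)\<lparr>carrier := \<pi> ` carrier A\<rparr>))"


section \<open>Group algebras and full group C*-algebras\<close>

text \<open>Finitely supported functions on \<open>G\<close>, extended by zero outside of the carrier.\<close>

definition group_algebra :: "('g, 'm) monoid_scheme \<Rightarrow> ('g \<Rightarrow> complex) star_algebra" where
  "group_algebra G =
    \<lparr>carrier = {f. finite {x. f x \<noteq> 0} \<and> {x. f x \<noteq> 0} \<subseteq> carrier G},
     mult = (\<lambda>f h x. if x \<in> carrier G
               then \<Sum>y\<in>{y. f y \<noteq> 0}. f y * h (inv\<^bsub>G\<^esub> y \<otimes>\<^bsub>G\<^esub> x) else 0),
     one = (\<lambda>x. if x = \<one>\<^bsub>G\<^esub> then 1 else 0),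
     zero = (\<lambda>x. 0),
     add = (\<lambda>f h x. f x + h x),
     smult = (\<lambda>c f x. c * f x),
     star = (\<lambda>f x. if x \<in> carrier G then cnj (f (inv\<^bsub>G\<^esub> x)) else 0)\<rparr>"

definition cstar_norm :: "('a, 'm) star_algebra_scheme \<Rightarrow> ('a \<Rightarrow> real) \<Rightarrow> bool" where
  "cstar_norm A N \<longleftrightarrow>
    (\<forall>x\<in>carrier A. N x \<ge> 0 \<and> (N x = 0 \<longleftrightarrow> x = \<zero>\<^bsub>A\<^esub>)) \<and>
    (\<forall>x\<in>carrier A. \<forall>y\<in>carrier A. N (x \<oplus>\<^bsub>A\<^esub> y) \<le> N x + N y) \<and>
    (\<forall>c. \<forall>x\<in>carrier A. N (c \<odot>\<^bsub>A\<^esub> x) = cmod c * N x) \<and>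
    (\<forall>x\<in>carrier A. \<forall>y\<in>carrier A. N (x \<otimes>\<^bsub>A\<^esub> y) \<le> N x * N y) \<and>
    (\<forall>x\<in>carrier A. N (star A x \<otimes>\<^bsub>A\<^esub> x) = (N x)\<^sup>2)"

text \<open>
  For a group algebra this set of norms is nonempty (it contains the reduced norm) and pointwise
  bounded by the l1-norm, so its pointwise supremum is the largest C*-norm.
\<close>

definition max_cstar_norm :: "('a, 'm) star_algebra_scheme \<Rightarrow> 'a \<Rightarrow> real" where
  "max_cstar_norm A x = (SUP N \<in> {N. cstar_norm A N}. N x)"

text \<open>
  The completion of a normed *-algebra as Cauchy sequences modulo null sequences.
\<close>

definition cauchy_sequences ::
  "('a, 'm) normed_star_algebra_scheme \<Rightarrow> (nat \<Rightarrow> 'a) star_algebra" where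
  "cauchy_sequences A =
    \<lparr>carrier = {s. (\<forall>n. s n \<in> carrier A) \<and>
       (\<forall>e>0. \<exists>N. \<forall>i\<ge>N. \<forall>j\<ge>N. algebra_norm A (s i \<ominus>\<^bsub>A\<^esub> s j) < e)},
     mult = (\<lambda>s t n. s n \<otimes>\<^bsub>A\<^esub> t n),
     one = (\<lambda>n. \<one>\<^bsub>A\<^esub>),
     zero = (\<lambda>n. \<zero>\<^bsub>A\<^esub>),
     add = (\<lambda>s t n. s n \<oplus>\<^bsub>A\<^esub> t n),
     smult = (\<lambda>c s n. c \<odot>\<^bsub>A\<^esub> s n),
     star = (\<lambda>s n. star A (s n))\<rparr>"

definition null_sequences :: "('a, 'm) normed_star_algebra_scheme \<Rightarrow> (nat \<Rightarrow> 'a) set" where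
  "null_sequences A =
    {s \<in> carrier (cauchy_sequences A). (\<lambda>n. algebra_norm A (s n)) \<longlonglongrightarrow> 0}"

definition completion ::
  "('a, 'm) normed_star_algebra_scheme \<Rightarrow> (nat \<Rightarrow> 'a) set normed_star_algebra" where
  "completion A =
    star_algebra.extend (quotient_star_algebra (cauchy_sequences A) (null_sequences A))
      (normed_star_algebra.fields
        (\<lambda>X. lim (\<lambda>n. algebra_norm A ((SOME s. s \<in> X) n))))"

definition full_group_cstar_algebra ::
  "('g, 'm) monoid_scheme \<Rightarrow> (nat \<Rightarrow> 'g \<Rightarrow> complex) set normed_star_algebra" where
  "full_group_cstar_algebra G =
    completion (star_algebra.extend (group_algebra G)
      (normed_star_algebra.fields (max_cstar_norm (group_algebra G))))"


section \<open>Just-infinite C*-algebras\<close>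

definition closed_ideal :: "('a, 'm) normed_star_algebra_scheme \<Rightarrow> 'a set \<Rightarrow> bool" where
  "closed_ideal A I \<longleftrightarrow> ideal I A \<and> (\<forall>c. \<forall>x\<in>I. c \<odot>\<^bsub>A\<^esub> x \<in> I) \<and>
    (\<forall>s. \<forall>x\<in>carrier A. (\<forall>n. s n \<in> I) \<and>
       (\<lambda>n. algebra_norm A (s n \<ominus>\<^bsub>A\<^esub> x)) \<longlonglongrightarrow> 0 \<longrightarrow> x \<in> I)"

text \<open>
  Applied to unital C*-algebras only. Scalar invariance in \<open>closed_ideal\<close> is automatic
  there; it makes the quotient visibly an algebra.
\<close>

definition just_infinite :: "('a, 'm) normed_star_algebra_scheme \<Rightarrow> bool" where
  "just_infinite A \<longleftrightarrow> \<not> finite_dimensional A \<and>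
    (\<forall>I. closed_ideal A I \<and> I \<noteq> {\<zero>\<^bsub>A\<^esub>} \<longrightarrow> finite_dimensional (quotient_star_algebra A I))"

end

theory Submission
  imports Defs
    "HOL-Analysis.Infinite_Sum" "HOL-Analysis.Operator_Norm" "HOL-Analysis.Topology_Euclidean_Space"
    "HOL-Library.Countable"
begin

text \<open>
  A branch group \<open>G\<close> permutes the vertices of its tree, hence acts by unitaries on the Hilbert
  space of square summable functions on the vertices. Some rigid stabilizer of a vertex on level 1
  contains an element \<open>g \<noteq> 1\<close>, because the subgroup generated by these stabilizers has finite index
  in the infinite group \<open>G\<close>; by transitivity, \<open>g\<close> has a conjugate \<open>h\<close> supported in another subtree.
  As every vertex is fixed by \<open>g\<close> or by \<open>h\<close>, the representation kills \<open>(1 - g)(1 - h)\<close>, which is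
  non-zero in the group algebra. Its image is infinite dimensional because the orbits of vertices
  are arbitrarily large. So the representation is neither injective nor of finite dimensional
  image. Its operator norm is dominated by the maximal C*-norm, so it extends to the completion,
  where its kernel is a closed non-zero ideal with infinite dimensional quotient.
\<close>

text \<open>\<open>max_cstar_norm\<close> is a supremum over norms, whereas the operator norm of the
  vertex representation vanishes at (1 - g)(1 - h) and so is only a seminorm. Its maximum with the
  reduced norm, the operator norm of the left regular representation, is definite and keeps the
  C*-identity; hence the domination. The reduced norm also keeps (1 - g)(1 - h) non-zero in the
  completion.

  The extension of the representation to the completion is never constructed. Its kernel is
  described directly, as the classes of Cauchy sequences along which the operator norm tends to 0.

  Dimension is tested by matrix coefficients. If the elements of a finite set S move a vertex x to
  distinct vertices, then the functionals that read off the coordinate at g x of the image of the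
  basis vector at x, for g in S, are dual to the elements of S. They are bounded by the operator
  norm, so they pass to the completion and to its quotient by the kernel. Levels of the tree are
  finite, so one vertex gives only a finite dual system, and the vertex varies with the size
  required.\<close>

hide_const (open) Multiset.mult Polynomial.smult

section \<open>Quotients of algebras and finite dimension\<close>

lemma complex_cring: "cring (class_ring :: complex ring)"
  by (rule class_cring.cring_axioms)

text \<open>The axioms are equations, or ask for inverses that are found as images, so they pass
  along a surjection; nothing is assumed about \<open>V\<close> beforehand. The hypothesis
  \<open>zero\<close> ties down the zero field of the record \<open>V\<close>, about which
  \<open>module_hom\<close> says nothing.\<close>

lemma module_surj_image:
  assumes A: "Module.module (class_ring :: complex ring) A"
    and h: "h \<in> LinearCombinations.module_hom (class_ring :: complex ring) A V"
    and surj: "h ` carrier A = carrier V" and zero: "h \<zero>\<^bsub>A\<^esub> = \<zero>\<^bsub>V\<^esub>"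
  shows "Module.module (class_ring :: complex ring) V"
proof -
  interpret A: Module.module "class_ring :: complex ring" A by (rule A)
  have add: "h (x \<oplus>\<^bsub>A\<^esub> y) = h x \<oplus>\<^bsub>V\<^esub> h y" if "x \<in> carrier A" "y \<in> carrier A" for x y
    using h that by (auto simp: LinearCombinations.module_hom_def)
  have smult: "h (c \<odot>\<^bsub>A\<^esub> x) = c \<odot>\<^bsub>V\<^esub> h x" if "x \<in> carrier A" for c x
    using h that by (auto simp: LinearCombinations.module_hom_def)
  have ex: "\<exists>a\<in>carrier A. x = h a" if "x \<in> carrier V" for x
    using that surj by blast
  have cl: "h a \<in> carrier V" if "a \<in> carrier A" for a
    using that surj by blast
  have "abelian_group V"
  proof (rule abelian_groupI)
    fix x y assume "x \<in> carrier V" "y \<in> carrier V"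
    then obtain a b where ab: "a \<in> carrier A" "b \<in> carrier A" "x = h a" "y = h b" using ex by metis
    show "x \<oplus>\<^bsub>V\<^esub> y \<in> carrier V" using ab by (simp add: add[symmetric] cl)
    show "x \<oplus>\<^bsub>V\<^esub> y = y \<oplus>\<^bsub>V\<^esub> x" using ab by (simp add: add[symmetric] A.M.add.m_comm)
    fix z assume "z \<in> carrier V"
    then obtain c where c: "c \<in> carrier A" "z = h c" using ex by metis
    show "x \<oplus>\<^bsub>V\<^esub> y \<oplus>\<^bsub>V\<^esub> z = x \<oplus>\<^bsub>V\<^esub> (y \<oplus>\<^bsub>V\<^esub> z)"
      using ab c by (simp add: add[symmetric] A.M.add.m_assoc)
  next
    show "\<zero>\<^bsub>V\<^esub> \<in> carrier V" using cl[of "\<zero>\<^bsub>A\<^esub>"] zero by simp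
  next
    fix x assume "x \<in> carrier V"
    then obtain a where a: "a \<in> carrier A" "x = h a" using ex by metis
    show "\<zero>\<^bsub>V\<^esub> \<oplus>\<^bsub>V\<^esub> x = x" using a by (simp add: zero[symmetric] add[symmetric])
    have "h (\<ominus>\<^bsub>A\<^esub> a) \<oplus>\<^bsub>V\<^esub> x = \<zero>\<^bsub>V\<^esub>"
      using a by (simp add: zero[symmetric] add[symmetric] A.M.l_neg)
    then show "\<exists>y\<in>carrier V. y \<oplus>\<^bsub>V\<^esub> x = \<zero>\<^bsub>V\<^esub>" using cl a A.M.a_inv_closed by blast
  qed
  show ?thesis
  proof (rule moduleI[OF complex_cring \<open>abelian_group V\<close>])
    fix c :: complex and x assume "x \<in> carrier V"
    then obtain a where a: "a \<in> carrier A" "x = h a" using ex by metis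
    show "c \<odot>\<^bsub>V\<^esub> x \<in> carrier V" using a by (simp add: smult[symmetric] cl)
    fix d :: complex
    show "(c \<oplus>\<^bsub>class_ring\<^esub> d) \<odot>\<^bsub>V\<^esub> x = c \<odot>\<^bsub>V\<^esub> x \<oplus>\<^bsub>V\<^esub> d \<odot>\<^bsub>V\<^esub> x"
      using a A.smult_l_distr[of c d a] by (simp add: smult[symmetric] add[symmetric])
    show "(c \<otimes>\<^bsub>class_ring\<^esub> d) \<odot>\<^bsub>V\<^esub> x = c \<odot>\<^bsub>V\<^esub> (d \<odot>\<^bsub>V\<^esub> x)"
      using a A.smult_assoc1[of c d a] by (simp add: smult[symmetric])
  next
    fix c :: complex and x y assume "x \<in> carrier V" "y \<in> carrier V"
    then obtain a b where ab: "a \<in> carrier A" "b \<in> carrier A" "x = h a" "y = h b" using ex by metis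
    show "c \<odot>\<^bsub>V\<^esub> (x \<oplus>\<^bsub>V\<^esub> y) = c \<odot>\<^bsub>V\<^esub> x \<oplus>\<^bsub>V\<^esub> c \<odot>\<^bsub>V\<^esub> y"
      using ab A.smult_r_distr[of c a b] by (simp add: smult[symmetric] add[symmetric])
  next
    fix x assume "x \<in> carrier V"
    then obtain a where a: "a \<in> carrier A" "x = h a" using ex by metis
    show "\<one>\<^bsub>class_ring\<^esub> \<odot>\<^bsub>V\<^esub> x = x" using a A.smult_one[of a] by (simp add: smult[symmetric])
  qed
qed

text \<open>Serves for the completion, and for a record that adds a norm field to a known
  ring.\<close>

lemma ring_surj_image:
  assumes A: "ring A" and h: "h \<in> Ring.ring_hom A V"
    and surj: "h ` carrier A = carrier V" and zero: "h \<zero>\<^bsub>A\<^esub> = \<zero>\<^bsub>V\<^esub>"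
  shows "ring V"
proof -
  interpret A: ring A by (rule A)
  note hom [simp] = ring_hom_add[OF h, symmetric] ring_hom_mult[OF h, symmetric]
    ring_hom_one[OF h, symmetric] zero[symmetric]
  have ex: "\<exists>a\<in>carrier A. x = h a" if "x \<in> carrier V" for x
    using that surj by blast
  have cl: "h a \<in> carrier V" if "a \<in> carrier A" for a
    using that surj by blast
  have "abelian_group V"
  proof (rule abelian_groupI)
    fix x y assume "x \<in> carrier V" "y \<in> carrier V"
    then obtain a b where ab: "a \<in> carrier A" "b \<in> carrier A" "x = h a" "y = h b" using ex by metis
    show "x \<oplus>\<^bsub>V\<^esub> y \<in> carrier V" using ab by (simp add: cl)
    show "x \<oplus>\<^bsub>V\<^esub> y = y \<oplus>\<^bsub>V\<^esub> x" using ab by (simp add: A.add.m_comm)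
    fix z assume "z \<in> carrier V"
    then obtain c where c: "c \<in> carrier A" "z = h c" using ex by metis
    show "x \<oplus>\<^bsub>V\<^esub> y \<oplus>\<^bsub>V\<^esub> z = x \<oplus>\<^bsub>V\<^esub> (y \<oplus>\<^bsub>V\<^esub> z)"
      using ab c by (simp add: A.add.m_assoc)
  next
    show "\<zero>\<^bsub>V\<^esub> \<in> carrier V" using cl[of "\<zero>\<^bsub>A\<^esub>"] by simp
  next
    fix x assume "x \<in> carrier V"
    then obtain a where a: "a \<in> carrier A" "x = h a" using ex by metis
    show "\<zero>\<^bsub>V\<^esub> \<oplus>\<^bsub>V\<^esub> x = x" using a by simp
    have "h (\<ominus>\<^bsub>A\<^esub> a) \<oplus>\<^bsub>V\<^esub> x = \<zero>\<^bsub>V\<^esub>"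
      using a by (simp add: A.l_neg)
    then show "\<exists>y\<in>carrier V. y \<oplus>\<^bsub>V\<^esub> x = \<zero>\<^bsub>V\<^esub>" using cl a A.a_inv_closed by blast
  qed
  moreover have "monoid V"
  proof (rule monoidI)
    fix x y assume "x \<in> carrier V" "y \<in> carrier V"
    then obtain a b where ab: "a \<in> carrier A" "b \<in> carrier A" "x = h a" "y = h b" using ex by metis
    show "x \<otimes>\<^bsub>V\<^esub> y \<in> carrier V" using ab by (simp add: cl)
    fix z assume "z \<in> carrier V"
    then obtain c where c: "c \<in> carrier A" "z = h c" using ex by metis
    show "x \<otimes>\<^bsub>V\<^esub> y \<otimes>\<^bsub>V\<^esub> z = x \<otimes>\<^bsub>V\<^esub> (y \<otimes>\<^bsub>V\<^esub> z)"
      using ab c by (simp add: A.m_assoc)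
  next
    show "\<one>\<^bsub>V\<^esub> \<in> carrier V" using cl[of "\<one>\<^bsub>A\<^esub>"] by simp
  next
    fix x assume "x \<in> carrier V"
    then obtain a where a: "a \<in> carrier A" "x = h a" using ex by metis
    show "\<one>\<^bsub>V\<^esub> \<otimes>\<^bsub>V\<^esub> x = x" "x \<otimes>\<^bsub>V\<^esub> \<one>\<^bsub>V\<^esub> = x" using a by simp_all
  qed
  ultimately show ?thesis
  proof (rule ringI)
    fix x y z assume "x \<in> carrier V" "y \<in> carrier V" "z \<in> carrier V"
    then obtain a b c where ab: "a \<in> carrier A" "b \<in> carrier A" "c \<in> carrier A"
      "x = h a" "y = h b" "z = h c" using ex by metis
    show "(x \<oplus>\<^bsub>V\<^esub> y) \<otimes>\<^bsub>V\<^esub> z = x \<otimes>\<^bsub>V\<^esub> z \<oplus>\<^bsub>V\<^esub> y \<otimes>\<^bsub>V\<^esub> z"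
      "z \<otimes>\<^bsub>V\<^esub> (x \<oplus>\<^bsub>V\<^esub> y) = z \<otimes>\<^bsub>V\<^esub> x \<oplus>\<^bsub>V\<^esub> z \<otimes>\<^bsub>V\<^esub> y"
      using ab by (simp_all add: A.l_distr A.r_distr)
  qed
qed

section \<open>Dual systems and infinite dimension\<close>

definition linear_functional :: "(complex, 'a, 'm) module_scheme \<Rightarrow> ('a \<Rightarrow> complex) \<Rightarrow> bool" where
  "linear_functional V l \<longleftrightarrow>
    (\<forall>x\<in>carrier V. \<forall>y\<in>carrier V. l (x \<oplus>\<^bsub>V\<^esub> y) = l x + l y) \<and>
    (\<forall>c. \<forall>x\<in>carrier V. l (c \<odot>\<^bsub>V\<^esub> x) = c * l x)"

text \<open>Applied to a vanishing combination of the \<open>b j\<close>, the functional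
  \<open>l i\<close> isolates the coefficient at \<open>i\<close>. A dual pair of families therefore
  forces independence, and dual pairs of every finite size exceed any dimension.\<close>

lemma not_finite_dimensional:
  fixes V :: "(complex, 'a, 'm) module_scheme"
  assumes V: "Module.module (class_ring :: complex ring) V"
    and sys: "\<And>n. \<exists>(I :: 'i set) b l. finite I \<and> card I \<ge> n \<and> (\<forall>i\<in>I. b i \<in> carrier V) \<and>
       (\<forall>i\<in>I. linear_functional V (l i) \<and> (\<forall>j\<in>I. l i (b j) = (if i = j then 1 else 0)))"
  shows "\<not> finite_dimensional V"
proof
  assume fd: "finite_dimensional V"
  interpret V: Module.module "class_ring :: complex ring" V by (rule V)
  interpret V: vectorspace "class_ring :: complex ring" V
    using V class_field by (simp add: vectorspace_def)
  from sys[of "Suc V.dim"] obtain I :: "'i set" and b l where I: "finite I" "card I \<ge> Suc V.dim"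
    and b: "\<And>i. i \<in> I \<Longrightarrow> b i \<in> carrier V" and l: "\<And>i. i \<in> I \<Longrightarrow> linear_functional V (l i)"
    and lb: "\<And>i j. i \<in> I \<Longrightarrow> j \<in> I \<Longrightarrow> l i (b j) = (if i = j then 1 else 0)" by metis
  have inj: "inj_on b I"
    by (rule inj_onI) (metis lb zero_neq_one)
  have zero: "l i \<zero>\<^bsub>V\<^esub> = 0" if "i \<in> I" for i
  proof -
    have "l i (0 \<odot>\<^bsub>V\<^esub> \<zero>\<^bsub>V\<^esub>) = 0 * l i \<zero>\<^bsub>V\<^esub>"
      using l[OF that] V.M.zero_closed unfolding linear_functional_def by blast
    then show ?thesis using V.smult_l_null[of "\<zero>\<^bsub>V\<^esub>"] by simp
  qed
  have sum: "l i (finsum V f S) = (\<Sum>s\<in>S. l i (f s))"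
    if "i \<in> I" "finite S" "f \<in> S \<rightarrow> carrier V" for i f and S :: "'a set"
    using that(2,3)
  proof (induction S rule: finite_induct)
    case empty
    then show ?case using zero that by simp
  next
    case (insert s S)
    then show ?case using l[OF that(1)]
      by (simp add: linear_functional_def V.M.finsum_insert Pi_iff V.M.finsum_closed)
  qed
  have "V.lin_indpt (b ` I)"
  proof
    assume "V.lin_dep (b ` I)"
    then obtain S a v where S: "finite S" "S \<subseteq> b ` I" "V.lincomb a S = \<zero>\<^bsub>V\<^esub>" "v \<in> S" "a v \<noteq> 0"
      unfolding V.lin_dep_def by auto
    then obtain i where i: "i \<in> I" "v = b i" by auto
    have Sc: "S \<subseteq> carrier V" using S b by auto
    have "0 = l i (V.lincomb a S)" using S zero i by simp
    also have "\<dots> = (\<Sum>s\<in>S. l i (a s \<odot>\<^bsub>V\<^esub> s))"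
      unfolding V.lincomb_def using i S Sc by (intro sum) auto
    also have "\<dots> = (\<Sum>s\<in>S. a s * l i s)"
      using l[OF i(1)] Sc by (intro sum.cong) (auto simp: linear_functional_def)
    \<comment> \<open>A member of \<open>S\<close> other than \<open>v\<close> has an index other
      than \<open>i\<close>, so \<open>l i\<close> annihilates it. Injectivity of \<open>b\<close>
      on \<open>I\<close> makes the two cases match.\<close>
    also have "\<dots> = (\<Sum>s\<in>S. if s = v then a v else 0)"
    proof (rule sum.cong)
      fix s assume "s \<in> S"
      then obtain j where "j \<in> I" "s = b j" using S by auto
      then show "a s * l i s = (if s = v then a v else 0)" using lb[of i j] i inj
        by (auto simp: inj_on_eq_iff)
    qed simp
    finally show False using S by simp
  qed
  then have "card (b ` I) \<le> V.dim"
    using V.li_le_dim(2)[OF fd, of "b ` I"] b by auto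
  then show False using I inj by (simp add: card_image)
qed

section \<open>Quotients by ideals that are closed under scalars\<close>

lemma quotient_map:
  fixes A :: "('a, 'm) star_algebra_scheme"
  assumes I: "ideal I A"
  shows "ring A" and "(\<lambda>x. I +>\<^bsub>A\<^esub> x) \<in> Ring.ring_hom A (quotient_star_algebra A I)"
    and "(\<lambda>x. I +>\<^bsub>A\<^esub> x) ` carrier A = carrier (quotient_star_algebra A I)"
    and "I +>\<^bsub>A\<^esub> \<zero>\<^bsub>A\<^esub> = \<zero>\<^bsub>quotient_star_algebra A I\<^esub>"
proof -
  interpret ideal I A by (rule I)
  show "ring A" by (rule ring_axioms)
  have "(\<lambda>x. I +>\<^bsub>A\<^esub> x) \<in> Ring.ring_hom A (A Quot I)" by (rule rcos_ring_hom)
  then show "(\<lambda>x. I +>\<^bsub>A\<^esub> x) \<in> Ring.ring_hom A (quotient_star_algebra A I)"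
    by (simp add: Ring.ring_hom_def quotient_star_algebra_def)
  show "(\<lambda>x. I +>\<^bsub>A\<^esub> x) ` carrier A = carrier (quotient_star_algebra A I)"
    by (auto simp: quotient_star_algebra_def FactRing_def A_RCOSETS_def' a_r_coset_def[symmetric])
  show "I +>\<^bsub>A\<^esub> \<zero>\<^bsub>A\<^esub> = \<zero>\<^bsub>quotient_star_algebra A I\<^esub>"
    by (simp add: quotient_star_algebra_def FactRing_def a_coset_join2 is_additive_subgroup
      additive_subgroup.zero_closed additive_subgroup.a_subgroup)
qed

text \<open>\<open>quotient_star_algebra\<close> defines scalar multiplication as a union of cosets
  over all representatives. Invariance of \<open>I\<close> under scalars makes these cosets equal,
  so the union collapses to one of them.\<close>

lemma quotient_smult:
  fixes A :: "('a, 'm) star_algebra_scheme"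
  assumes A: "Module.module (class_ring :: complex ring) A" and I: "ideal I A"
    and sI: "\<And>c x. x \<in> I \<Longrightarrow> c \<odot>\<^bsub>A\<^esub> x \<in> I" and x: "x \<in> carrier A"
  shows "c \<odot>\<^bsub>quotient_star_algebra A I\<^esub> (I +>\<^bsub>A\<^esub> x) = I +>\<^bsub>A\<^esub> (c \<odot>\<^bsub>A\<^esub> x)"
proof -
  interpret A: Module.module "class_ring :: complex ring" A by (rule A)
  interpret ideal I A by (rule I)
  have "I +>\<^bsub>A\<^esub> (c \<odot>\<^bsub>A\<^esub> y) = I +>\<^bsub>A\<^esub> (c \<odot>\<^bsub>A\<^esub> x)" if y: "y \<in> I +>\<^bsub>A\<^esub> x" for y
  proof -
    from y obtain i where i: "i \<in> I" "y = i \<oplus>\<^bsub>A\<^esub> x" by (auto simp: a_r_coset_def' )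
    have "c \<odot>\<^bsub>A\<^esub> y = c \<odot>\<^bsub>A\<^esub> i \<oplus>\<^bsub>A\<^esub> c \<odot>\<^bsub>A\<^esub> x"
      using i x A.smult_r_distr[of c i x] a_subset by auto
    then have "c \<odot>\<^bsub>A\<^esub> y \<in> I +>\<^bsub>A\<^esub> (c \<odot>\<^bsub>A\<^esub> x)"
      using sI[OF i(1)] by (auto simp: a_r_coset_def')
    then show ?thesis by (rule A.M.a_repr_independence[OF _ _ a_subgroup, symmetric]) (use x in simp)
  qed
  moreover have "x \<in> I +>\<^bsub>A\<^esub> x" using x by (rule a_rcos_self)
  ultimately have "(\<Union>y\<in>I +>\<^bsub>A\<^esub> x. I +>\<^bsub>A\<^esub> (c \<odot>\<^bsub>A\<^esub> y)) = I +>\<^bsub>A\<^esub> (c \<odot>\<^bsub>A\<^esub> x)"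
    by blast
  then show ?thesis by (simp add: quotient_star_algebra_def)
qed

lemma module_quotient:
  fixes A :: "('a, 'm) star_algebra_scheme"
  assumes A: "Module.module (class_ring :: complex ring) A" and I: "ideal I A"
    and sI: "\<And>c x. x \<in> I \<Longrightarrow> c \<odot>\<^bsub>A\<^esub> x \<in> I"
  shows "Module.module (class_ring :: complex ring) (quotient_star_algebra A I)"
proof (rule module_surj_image[OF A _ quotient_map(3,4)[OF I]])
  show "(\<lambda>x. I +>\<^bsub>A\<^esub> x) \<in> LinearCombinations.module_hom class_ring A (quotient_star_algebra A I)"
    using quotient_map(2)[OF I] quotient_smult[OF A I sI]
    by (auto simp: LinearCombinations.module_hom_def Ring.ring_hom_def)
qed

lemma coset_eq_iff:
  assumes "ideal I A" "x \<in> carrier A" "y \<in> carrier A"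
  shows "I +>\<^bsub>A\<^esub> x = I +>\<^bsub>A\<^esub> y \<longleftrightarrow> x \<ominus>\<^bsub>A\<^esub> y \<in> I"
proof -
  interpret ideal I A by fact
  show ?thesis using assms quotient_eq_iff_same_a_r_cos[OF assms] by blast
qed

lemma linear_functional_minus:
  assumes A: "Module.module (class_ring :: complex ring) A" and l: "linear_functional A l"
    and x: "x \<in> carrier A" "y \<in> carrier A"
  shows "l (x \<ominus>\<^bsub>A\<^esub> y) = l x - l y"
proof -
  interpret A: Module.module "class_ring :: complex ring" A by (rule A)
  have "x = (x \<ominus>\<^bsub>A\<^esub> y) \<oplus>\<^bsub>A\<^esub> y" using x
    by (simp add: a_minus_def A.M.add.m_assoc A.M.l_neg)
  moreover have "l ((x \<ominus>\<^bsub>A\<^esub> y) \<oplus>\<^bsub>A\<^esub> y) = l (x \<ominus>\<^bsub>A\<^esub> y) + l y"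
    using l x unfolding linear_functional_def by (blast intro: A.M.minus_closed)
  ultimately show ?thesis by simp
qed

text \<open>The value at a coset is read off at a chosen representative. Two representatives differ
  by an element of \<open>I\<close>, where \<open>l\<close> vanishes, so the choice does not
  matter.\<close>

lemma quotient_functional:
  fixes A :: "('a, 'm) star_algebra_scheme"
  assumes A: "Module.module (class_ring :: complex ring) A" and I: "ideal I A"
    and sI: "\<And>c x. x \<in> I \<Longrightarrow> c \<odot>\<^bsub>A\<^esub> x \<in> I"
    and l: "linear_functional A l" and l0: "\<And>x. x \<in> I \<Longrightarrow> l x = 0"
  shows "\<exists>l'. linear_functional (quotient_star_algebra A I) l' \<and>
    (\<forall>x\<in>carrier A. l' (I +>\<^bsub>A\<^esub> x) = l x)"
proof -
  define l' where "l' X = l (SOME x. x \<in> carrier A \<and> X = I +>\<^bsub>A\<^esub> x)" for X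
  have l': "l' (I +>\<^bsub>A\<^esub> x) = l x" if x: "x \<in> carrier A" for x
  proof -
    define y where "y = (SOME y. y \<in> carrier A \<and> I +>\<^bsub>A\<^esub> x = I +>\<^bsub>A\<^esub> y)"
    have "y \<in> carrier A \<and> I +>\<^bsub>A\<^esub> x = I +>\<^bsub>A\<^esub> y"
      unfolding y_def by (rule someI[of _ x]) (simp add: x)
    then have "y \<in> carrier A" "x \<ominus>\<^bsub>A\<^esub> y \<in> I" using coset_eq_iff[OF I x] by auto
    then have "l x = l y" using linear_functional_minus[OF A l x] l0 by force
    then show ?thesis by (simp add: l'_def y_def)
  qed
  interpret A: Module.module "class_ring :: complex ring" A by (rule A)
  have "linear_functional (quotient_star_algebra A I) l'"
    unfolding linear_functional_def quotient_map(3)[OF I, symmetric] ball_simps(9)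
  proof (intro conjI ballI allI)
    fix x y assume x: "x \<in> carrier A" "y \<in> carrier A"
    show "l' ((I +>\<^bsub>A\<^esub> x) \<oplus>\<^bsub>quotient_star_algebra A I\<^esub> (I +>\<^bsub>A\<^esub> y)) = l' (I +>\<^bsub>A\<^esub> x) + l' (I +>\<^bsub>A\<^esub> y)"
      using l x by (simp add: ring_hom_add[OF quotient_map(2)[OF I] x, symmetric] l' linear_functional_def)
  next
    fix c x assume x: "x \<in> carrier A"
    show "l' (c \<odot>\<^bsub>quotient_star_algebra A I\<^esub> (I +>\<^bsub>A\<^esub> x)) = c * l' (I +>\<^bsub>A\<^esub> x)"
      using l x by (simp add: quotient_smult[OF A I sI x] l' linear_functional_def)
  qed
  with l' show ?thesis by blast
qed

section \<open>Square summable functions\<close>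

definition square_summable :: "('x \<Rightarrow> complex) \<Rightarrow> bool" where
  "square_summable f \<longleftrightarrow> (\<lambda>x. (cmod (f x))\<^sup>2) summable_on UNIV"

lemma square_summable_zero: "square_summable (\<lambda>_. 0)"
  by (simp add: square_summable_def)

lemma square_summable_cmult: "square_summable f \<Longrightarrow> square_summable (\<lambda>x. c * f x)"
  unfolding square_summable_def norm_mult power_mult_distrib
  by (rule summable_on_cmult_right)

lemma square_summable_add:
  assumes "square_summable f" "square_summable g"
  shows "square_summable (\<lambda>x. f x + g x)"
proof -
  have "(\<lambda>x. 2 * (cmod (f x))\<^sup>2 + 2 * (cmod (g x))\<^sup>2) summable_on UNIV"
    using assms unfolding square_summable_def by (intro summable_on_add summable_on_cmult_right)
  moreover have "(cmod (a + b))\<^sup>2 \<le> 2 * (cmod a)\<^sup>2 + 2 * (cmod b)\<^sup>2" for a b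
  proof -
    have "(cmod (a + b))\<^sup>2 \<le> (cmod a + cmod b)\<^sup>2"
      by (intro power_mono norm_triangle_ineq) simp
    also have "\<dots> \<le> 2 * (cmod a)\<^sup>2 + 2 * (cmod b)\<^sup>2"
      using sum_squares_bound[of "cmod a" "cmod b"] by (simp add: power2_sum)
    finally show ?thesis .
  qed
  ultimately show ?thesis unfolding square_summable_def
    by (rule summable_on_comparison_test) auto
qed

lemma summable_on_square_product:
  assumes "square_summable f" "square_summable g"
  shows "(\<lambda>x. f x * cnj (g x)) summable_on UNIV"
proof -
  have "(\<lambda>x. norm (f x * f x)) summable_on UNIV" "(\<lambda>x. norm (cnj (g x) * cnj (g x))) summable_on UNIV"
    using assms by (simp_all add: square_summable_def norm_mult power2_eq_square)
  then have "(\<lambda>x. norm (f x * cnj (g x))) summable_on UNIV"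
    by (rule abs_summable_product)
  then show ?thesis by (rule abs_summable_summable)
qed

text \<open>A type rather than a carrier set: its real inner product structure gives access to
  \<open>bounded_linear\<close>, \<open>onorm\<close> and the Cauchy-Schwarz inequality. The complex
  structure is kept in the separate constants \<open>scaleC\<close> and
  \<open>cinner\<close>.\<close>

typedef 'x ell2 = "{f :: 'x \<Rightarrow> complex. square_summable f}"
  morphisms coord Abs_ell2
  using square_summable_zero by blast

setup_lifting type_definition_ell2

lemma square_summable_coord [simp]: "square_summable (coord v)"
  using coord by auto

lemma ell2_eqI: "(\<And>x. coord v x = coord w x) \<Longrightarrow> v = w"
  by (simp add: coord_inject[symmetric] ext)

lift_definition scaleC :: "complex \<Rightarrow> 'x ell2 \<Rightarrow> 'x ell2" is "\<lambda>c f x. c * f x"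
  by (rule square_summable_cmult)

lift_definition cinner :: "'x ell2 \<Rightarrow> 'x ell2 \<Rightarrow> complex" is "\<lambda>f g. \<Sum>\<^sub>\<infinity>x. f x * cnj (g x)" .

instantiation ell2 :: (type) real_vector
begin

lift_definition zero_ell2 :: "'a ell2" is "\<lambda>_. 0" by (rule square_summable_zero)
lift_definition plus_ell2 :: "'a ell2 \<Rightarrow> 'a ell2 \<Rightarrow> 'a ell2" is "\<lambda>f g x. f x + g x"
  by (rule square_summable_add)
lift_definition uminus_ell2 :: "'a ell2 \<Rightarrow> 'a ell2" is "\<lambda>f x. - f x"
  by (simp add: square_summable_def)
lift_definition minus_ell2 :: "'a ell2 \<Rightarrow> 'a ell2 \<Rightarrow> 'a ell2" is "\<lambda>f g x. f x - g x"
  using square_summable_add[OF _ square_summable_cmult[of _ "-1"]] by simp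
lift_definition scaleR_ell2 :: "real \<Rightarrow> 'a ell2 \<Rightarrow> 'a ell2" is "\<lambda>r f x. of_real r * f x"
  by (rule square_summable_cmult)

instance
  by standard (transfer; simp add: algebra_simps)+

end

lemma cinner_add: "cinner (u + v) w = cinner u w + cinner v w"
  by transfer (simp add: ring_distribs infsum_add summable_on_square_product)

lemma cinner_scaleC: "cinner (scaleC c v) w = c * cinner v w"
  by transfer (simp add: mult.assoc infsum_cmult_right summable_on_square_product)

lemma cinner_commute: "cinner w v = cnj (cinner v w)"
  by transfer (simp add: infsum_cnj[symmetric] mult.commute)

lemma scaleR_eq_scaleC: "r *\<^sub>R v = scaleC (of_real r) (v :: 'x ell2)"
  by transfer simp

lemma cinner_self: "cinner v v = of_real (\<Sum>\<^sub>\<infinity>x. (cmod (coord v x))\<^sup>2)"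
proof -
  have "cinner v v = (\<Sum>\<^sub>\<infinity>x. of_real ((cmod (coord v x))\<^sup>2))"
    by transfer (simp add: complex_norm_square[symmetric])
  also have "\<dots> = of_real (\<Sum>\<^sub>\<infinity>x. (cmod (coord v x))\<^sup>2)"
    using square_summable_coord[of v] unfolding square_summable_def
    by (intro infsumI has_sum_of_real has_sum_infsum)
  finally show ?thesis .
qed

instantiation ell2 :: (type) real_inner
begin

definition inner_ell2 :: "'a ell2 \<Rightarrow> 'a ell2 \<Rightarrow> real" where
  "inner_ell2 v w = Re (cinner v w)"
definition norm_ell2 :: "'a ell2 \<Rightarrow> real" where
  "norm_ell2 v = sqrt (inner v v)"
definition dist_ell2 :: "'a ell2 \<Rightarrow> 'a ell2 \<Rightarrow> real" where
  "dist_ell2 v w = norm (v - w)"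
definition sgn_ell2 :: "'a ell2 \<Rightarrow> 'a ell2" where
  "sgn_ell2 v = v /\<^sub>R norm v"
definition uniformity_ell2 :: "('a ell2 \<times> 'a ell2) filter" where
  "uniformity_ell2 = (INF e\<in>{0<..}. principal {(v, w). dist v w < e})"
definition open_ell2 :: "'a ell2 set \<Rightarrow> bool" where
  "open_ell2 U \<longleftrightarrow> (\<forall>v\<in>U. eventually (\<lambda>(v', w). v' = v \<longrightarrow> w \<in> U) uniformity)"

instance
proof
  fix u v w :: "'a ell2" and a b :: real
  show "dist u v = norm (u - v)" "sgn u = u /\<^sub>R norm u"
    "uniformity = (INF e\<in>{0<..}. principal {(v :: 'a ell2, w). dist v w < e})"
    "\<And>U :: 'a ell2 set. open U = (\<forall>v\<in>U. \<forall>\<^sub>F (v', w) in uniformity. v' = v \<longrightarrow> w \<in> U)"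
    "norm u = sqrt (inner u u)"
    by (simp_all add: dist_ell2_def sgn_ell2_def uniformity_ell2_def open_ell2_def norm_ell2_def)
  show "inner u v = inner v u"
    by (simp add: inner_ell2_def cinner_commute[of u])
  show "inner (u + v) w = inner u w + inner v w" "inner (a *\<^sub>R u) v = a * inner u v"
    by (simp_all add: inner_ell2_def cinner_add cinner_scaleC scaleR_eq_scaleC)
  have self: "inner u u = (\<Sum>\<^sub>\<infinity>x. (cmod (coord u x))\<^sup>2)"
    by (simp add: inner_ell2_def cinner_self)
  show "0 \<le> inner u u" unfolding self by (rule infsum_nonneg) simp
  show "inner u u = 0 \<longleftrightarrow> u = 0"
  proof
    assume "inner u u = 0"
    then have "(cmod (coord u x))\<^sup>2 = 0" for x
      using square_summable_coord[of u] unfolding self square_summable_def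
      by (intro nonneg_infsum_le_0D[of _ UNIV]) auto
    then show "u = 0" by (intro ell2_eqI) (simp add: zero_ell2.rep_eq)
  qed (use self in \<open>simp add: zero_ell2.rep_eq\<close>)
qed

end

lemma norm_ell2_square: "(norm v)\<^sup>2 = (\<Sum>\<^sub>\<infinity>x. (cmod (coord v x))\<^sup>2)"
  by (simp add: power2_norm_eq_inner inner_ell2_def cinner_self)

lemma cinner_self_norm: "cinner v v = of_real ((norm v)\<^sup>2)"
  by (simp add: cinner_self norm_ell2_square)

lemma coord_simps [simp]:
  "coord 0 x = 0" "coord (v + w) x = coord v x + coord w x" "coord (v - w) x = coord v x - coord w x"
  "coord (- v) x = - coord v x" "coord (scaleC c v) x = c * coord v x"
  "coord (r *\<^sub>R v) x = of_real r * coord v x"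
  by (transfer; simp)+

lemma coord_sum [simp]: "coord (\<Sum>i\<in>S. f i) x = (\<Sum>i\<in>S. coord (f i) x)"
  by (induction S rule: infinite_finite_induct) auto

lemma norm_scaleC: "norm (scaleC c v) = cmod c * norm v"
proof -
  have "(norm (scaleC c v))\<^sup>2 = (cmod c * norm v)\<^sup>2"
    by (simp add: norm_ell2_square norm_mult power_mult_distrib infsum_cmult_right')
  then show ?thesis by (simp add: power2_eq_iff_nonneg)
qed

lemma scaleC_simps [simp]:
  "scaleC c (v + w) = scaleC c v + scaleC c w" "scaleC (a + b) v = scaleC a v + scaleC b v"
  "scaleC a (scaleC b v) = scaleC (a * b) v" "scaleC 1 v = v" "scaleC 0 v = 0" "scaleC c 0 = 0"
  by (rule ell2_eqI; simp add: algebra_simps)+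

lemma sum_square_le_norm: "finite F \<Longrightarrow> (\<Sum>x\<in>F. (cmod (coord v x))\<^sup>2) \<le> (norm v)\<^sup>2"
  using square_summable_coord[of v] unfolding norm_ell2_square square_summable_def
  by (intro finite_sum_le_infsum) auto

lemma norm_coord_le: "cmod (coord v x) \<le> norm v"
  using sum_square_le_norm[of "{x}" v] by (simp add: power2_le_iff_abs_le)

text \<open>The limit is taken in each coordinate. The Cauchy estimate is carried to it on finite
  partial sums, where limits may be taken term by term, and only then extended to the full
  sum.\<close>

instance ell2 :: (type) banach
proof
  fix X :: "nat \<Rightarrow> 'a ell2" assume "Cauchy X"
  have cauchy: "Cauchy (\<lambda>n. coord (X n) x)" for x
  proof (rule metric_CauchyI)
    fix e :: real assume "e > 0"
    then obtain M where "\<And>m n. m \<ge> M \<Longrightarrow> n \<ge> M \<Longrightarrow> dist (X m) (X n) < e"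
      using metric_CauchyD[OF \<open>Cauchy X\<close>] by blast
    moreover have "dist (coord (X m) x) (coord (X n) x) \<le> dist (X m) (X n)" for m n
      using norm_coord_le[of "X m - X n" x] by (simp add: dist_norm)
    ultimately show "\<exists>M. \<forall>m\<ge>M. \<forall>n\<ge>M. dist (coord (X m) x) (coord (X n) x) < e"
      by (meson le_less_trans)
  qed
  define f where "f x = lim (\<lambda>n. coord (X n) x)" for x
  have f: "(\<lambda>n. coord (X n) x) \<longlonglongrightarrow> f x" for x
    using cauchy[of x] by (simp add: f_def Cauchy_convergent convergent_LIMSEQ_iff[symmetric])
  have bound: "\<exists>M. \<forall>n\<ge>M. \<forall>F. finite F \<longrightarrow> (\<Sum>x\<in>F. (cmod (coord (X n) x - f x))\<^sup>2) \<le> e\<^sup>2"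
    if "e > 0" for e :: real
  proof -
    obtain M where M: "\<And>m n. m \<ge> M \<Longrightarrow> n \<ge> M \<Longrightarrow> dist (X m) (X n) < e"
      using metric_CauchyD[OF \<open>Cauchy X\<close> \<open>e > 0\<close>] by blast
    have "(\<Sum>x\<in>F. (cmod (coord (X n) x - f x))\<^sup>2) \<le> e\<^sup>2" if "n \<ge> M" "finite F" for n F
    proof (rule tendsto_upperbound)
      show "(\<lambda>m. \<Sum>x\<in>F. (cmod (coord (X n) x - coord (X m) x))\<^sup>2)
          \<longlonglongrightarrow> (\<Sum>x\<in>F. (cmod (coord (X n) x - f x))\<^sup>2)"
        by (intro tendsto_intros f)
      have "(\<Sum>x\<in>F. (cmod (coord (X n) x - coord (X m) x))\<^sup>2) \<le> e\<^sup>2" if "m \<ge> M" for m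
      proof -
        have "(\<Sum>x\<in>F. (cmod (coord (X n) x - coord (X m) x))\<^sup>2) \<le> (norm (X n - X m))\<^sup>2"
          using sum_square_le_norm[OF \<open>finite F\<close>, of "X n - X m"] by simp
        also have "\<dots> \<le> e\<^sup>2"
          using M[OF \<open>n \<ge> M\<close> that] by (intro power_mono) (auto simp: dist_norm)
        finally show ?thesis .
      qed
      then show "\<forall>\<^sub>F m in sequentially. (\<Sum>x\<in>F. (cmod (coord (X n) x - coord (X m) x))\<^sup>2) \<le> e\<^sup>2"
        by (auto simp: eventually_sequentially)
    qed simp
    then show ?thesis by blast
  qed
  have diff: "square_summable (\<lambda>x. coord (X n) x - f x)"
    if "\<And>F. finite F \<Longrightarrow> (\<Sum>x\<in>F. (cmod (coord (X n) x - f x))\<^sup>2) \<le> e\<^sup>2" for n e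
    unfolding square_summable_def
    by (rule nonneg_bdd_above_summable_on) (auto intro!: bdd_aboveI2[where M = "e\<^sup>2"] that)
  \<comment> \<open>One index is enough: \<open>f\<close> differs from the square summable
    \<open>coord (X n)\<close> by a square summable function.\<close>
  obtain n where "\<And>F. finite F \<Longrightarrow> (\<Sum>x\<in>F. (cmod (coord (X n) x - f x))\<^sup>2) \<le> 1\<^sup>2"
    using bound[of 1] less_numeral_extra(1)[where 'a = real] by blast
  then have n: "square_summable (\<lambda>x. coord (X n) x - f x)"
    by (rule diff)
  have "square_summable f"
    using square_summable_add[OF square_summable_cmult[OF n, of "-1"] square_summable_coord[of "X n"]]
    by simp
  then have f': "coord (Abs_ell2 f) = f" by (simp add: Abs_ell2_inverse)
  have "X \<longlonglongrightarrow> Abs_ell2 f"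
  proof (rule LIMSEQ_I)
    fix r :: real assume "r > 0"
    \<comment> \<open>The estimate reaches the limit as a weak inequality; half of \<open>r\<close>
      makes it strict again.\<close>
    then obtain M where M: "\<And>n F. n \<ge> M \<Longrightarrow> finite F \<Longrightarrow>
        (\<Sum>x\<in>F. (cmod (coord (X n) x - f x))\<^sup>2) \<le> (r/2)\<^sup>2"
      using bound[of "r/2"] by auto
    have "norm (X n - Abs_ell2 f) < r" if "n \<ge> M" for n
    proof -
      have "(norm (X n - Abs_ell2 f))\<^sup>2 \<le> (r/2)\<^sup>2"
        unfolding norm_ell2_square coord_simps f'
        using M[OF that] diff[OF M[OF that]] unfolding square_summable_def
        by (intro infsum_le_finite_sums) auto
      then have "norm (X n - Abs_ell2 f) \<le> r/2"
        using \<open>r > 0\<close> by (auto intro: power2_le_imp_le)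
      then show ?thesis using \<open>r > 0\<close> by simp
    qed
    then show "\<exists>M. \<forall>n\<ge>M. norm (X n - Abs_ell2 f) < r" by blast
  qed
  then show "convergent X" by (rule convergentI)
qed

lift_definition basis_vector :: "'x \<Rightarrow> 'x ell2" is "\<lambda>a x. if x = a then 1 else 0"
proof -
  fix a :: 'x
  have "(\<lambda>x. (cmod (if x = a then 1 else 0))\<^sup>2) summable_on {a}" by simp
  then show "square_summable (\<lambda>x. if x = a then 1 else 0)"
    unfolding square_summable_def by (rule summable_on_cong_neutral[THEN iffD1, rotated -1]) auto
qed

lemma coord_basis_vector [simp]: "coord (basis_vector a) x = (if x = a then 1 else 0)"
  by transfer simp

section \<open>Permutation representations of the group algebra\<close>

text \<open>Composition with a map that is not bijective can destroy square summability, so the zero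
  vector is returned there. For a bijection this is a unitary; a group element \<open>g\<close> will
  act through \<open>s = act (inv g)\<close>.\<close>

lift_definition reindex :: "('x \<Rightarrow> 'x) \<Rightarrow> 'x ell2 \<Rightarrow> 'x ell2" is
  "\<lambda>s f x. if bij s then f (s x) else 0"
proof -
  fix s :: "'x \<Rightarrow> 'x" and f :: "'x \<Rightarrow> complex" assume "square_summable f"
  then show "square_summable (\<lambda>x. if bij s then f (s x) else 0)"
    using summable_on_reindex_bij_betw[of s UNIV UNIV "\<lambda>x. (cmod (f x))\<^sup>2"]
    by (cases "bij s") (simp_all add: square_summable_def)
qed

lemma coord_reindex [simp]: "bij s \<Longrightarrow> coord (reindex s v) x = coord v (s x)"
  by transfer simp

lemma norm_reindex [simp]: "bij s \<Longrightarrow> norm (reindex s v) = norm v"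
  using infsum_reindex_bij_betw[of s UNIV UNIV "\<lambda>x. (cmod (coord v x))\<^sup>2"]
  by (simp add: norm_eq_sqrt_inner inner_ell2_def cinner_self)

lemma cinner_reindex: "bij s \<Longrightarrow> cinner (reindex s v) (reindex s w) = cinner v w"
  using infsum_reindex_bij_betw[of s UNIV UNIV "\<lambda>x. coord v x * cnj (coord w x)"]
  by (simp add: cinner.rep_eq)

lemma reindex_linear [simp]:
  assumes "bij s"
  shows "reindex s (v + w) = reindex s v + reindex s w" "reindex s (scaleC c v) = scaleC c (reindex s v)"
    "reindex s (r *\<^sub>R v) = r *\<^sub>R reindex s v"
  by (rule ell2_eqI; simp add: assms)+

lemma cinner_sum_left: "cinner (\<Sum>i\<in>S. f i) w = (\<Sum>i\<in>S. cinner (f i) w)"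
  by (induction S rule: infinite_finite_induct)
    (auto simp: cinner_add cinner_scaleC[of 0 0 w, simplified])

lemma cinner_sum_right: "cinner w (\<Sum>i\<in>S. f i) = (\<Sum>i\<in>S. cinner w (f i))"
  by (subst (1 2) cinner_commute) (simp add: cinner_sum_left)

lemma cinner_scaleC_right: "cinner v (scaleC c w) = cnj c * cinner v w"
  by (subst (1 2) cinner_commute) (simp add: cinner_scaleC)

text \<open>\<open>onorm\<close> sees only the norms of values, and these change in the same way
  under \<open>c\<close> as under the real factor \<open>cmod c\<close>.\<close>

lemma onorm_scaleC:
  assumes "bounded_linear T"
  shows "onorm (\<lambda>v. scaleC c (T v)) = cmod c * onorm T"
  using onorm_scaleR[OF assms, of "cmod c"] by (simp add: onorm_def norm_scaleC)

section \<open>Carrier, product and involution of the group algebra\<close>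

lemma group_algebra_simps [simp]:
  "\<zero>\<^bsub>group_algebra G\<^esub> = (\<lambda>x. 0)"
  "f \<oplus>\<^bsub>group_algebra G\<^esub> h = (\<lambda>x. f x + h x)"
  "c \<odot>\<^bsub>group_algebra G\<^esub> f = (\<lambda>x. c * f x)"
  "\<one>\<^bsub>group_algebra G\<^esub> = (\<lambda>x. if x = \<one>\<^bsub>G\<^esub> then 1 else 0)"
  by (simp_all add: group_algebra_def)

lemma group_algebra_mult:
  "f \<otimes>\<^bsub>group_algebra G\<^esub> h = (\<lambda>x. if x \<in> carrier G
     then \<Sum>y | f y \<noteq> 0. f y * h (inv\<^bsub>G\<^esub> y \<otimes>\<^bsub>G\<^esub> x) else 0)"
  by (simp add: group_algebra_def)

lemma group_algebra_star:
  "star (group_algebra G) f = (\<lambda>x. if x \<in> carrier G then cnj (f (inv\<^bsub>G\<^esub> x)) else 0)"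
  by (simp add: group_algebra_def)

lemma group_algebra_carrier:
  "f \<in> carrier (group_algebra G) \<longleftrightarrow> finite {x. f x \<noteq> 0} \<and> {x. f x \<noteq> 0} \<subseteq> carrier G"
  by (simp add: group_algebra_def)

lemma group_algebra_eq_0: "f \<in> carrier (group_algebra G) \<Longrightarrow> x \<notin> carrier G \<Longrightarrow> f x = 0"
  by (auto simp: group_algebra_carrier)

lemma group_algebra_closed [simp]:
  "(\<lambda>x. 0) \<in> carrier (group_algebra G)"
  "f \<in> carrier (group_algebra G) \<Longrightarrow> h \<in> carrier (group_algebra G) \<Longrightarrow> (\<lambda>x. f x + h x) \<in> carrier (group_algebra G)"
  "f \<in> carrier (group_algebra G) \<Longrightarrow> (\<lambda>x. c * f x) \<in> carrier (group_algebra G)"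
  "g \<in> carrier G \<Longrightarrow> (\<lambda>x. if x = g then c else 0) \<in> carrier (group_algebra G)"
proof -
  assume f: "f \<in> carrier (group_algebra G)"
  show "(\<lambda>x. c * f x) \<in> carrier (group_algebra G)"
    using f by (auto simp: group_algebra_carrier)
  assume h: "h \<in> carrier (group_algebra G)"
  have "{x. f x + h x \<noteq> 0} \<subseteq> {x. f x \<noteq> 0} \<union> {x. h x \<noteq> 0}" by auto
  then show "(\<lambda>x. f x + h x) \<in> carrier (group_algebra G)"
    using f h unfolding group_algebra_carrier by (meson finite_Un finite_subset le_sup_iff subset_trans)
qed (auto simp: group_algebra_carrier)

context group
begin

text \<open>The inclusion of supports gives finiteness here, and supplies the index set for the
  rearrangement of sums in \<open>conv_mult\<close>.\<close>

lemma group_algebra_mult_closed: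
  assumes "f \<in> carrier (group_algebra G)" "h \<in> carrier (group_algebra G)"
  shows "f \<otimes>\<^bsub>group_algebra G\<^esub> h \<in> carrier (group_algebra G)"
    and "{x. (f \<otimes>\<^bsub>group_algebra G\<^esub> h) x \<noteq> 0} \<subseteq> (\<lambda>(y, z). y \<otimes> z) ` ({y. f y \<noteq> 0} \<times> {z. h z \<noteq> 0})"
proof -
  show sub: "{x. (f \<otimes>\<^bsub>group_algebra G\<^esub> h) x \<noteq> 0} \<subseteq> (\<lambda>(y, z). y \<otimes> z) ` ({y. f y \<noteq> 0} \<times> {z. h z \<noteq> 0})"
  proof
    fix x assume "x \<in> {x. (f \<otimes>\<^bsub>group_algebra G\<^esub> h) x \<noteq> 0}"
    then have x: "x \<in> carrier G" and "(\<Sum>y | f y \<noteq> 0. f y * h (inv y \<otimes> x)) \<noteq> 0"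
      by (auto simp: group_algebra_mult split: if_splits)
    then obtain y where y: "f y \<noteq> 0" "h (inv y \<otimes> x) \<noteq> 0"
      by (auto elim: sum.not_neutral_contains_not_neutral)
    have "y \<in> carrier G" using y assms(1) by (auto simp: group_algebra_carrier)
    then have "x = y \<otimes> (inv y \<otimes> x)" using x by (simp add: m_assoc[symmetric])
    then show "x \<in> (\<lambda>(y, z). y \<otimes> z) ` ({y. f y \<noteq> 0} \<times> {z. h z \<noteq> 0})" using y by force
  qed
  show "f \<otimes>\<^bsub>group_algebra G\<^esub> h \<in> carrier (group_algebra G)"
    using finite_subset[OF sub] assms by (auto simp: group_algebra_carrier group_algebra_mult)
qed

lemma group_algebra_star_closed:
  assumes "f \<in> carrier (group_algebra G)"
  shows "star (group_algebra G) f \<in> carrier (group_algebra G)"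
    and "{x. star (group_algebra G) f x \<noteq> 0} = m_inv G ` {x. f x \<noteq> 0}"
    and "star (group_algebra G) (star (group_algebra G) f) = f"
proof -
  show eq: "{x. star (group_algebra G) f x \<noteq> 0} = m_inv G ` {x. f x \<noteq> 0}"
  proof (intro equalityI subsetI)
    fix x assume x: "x \<in> {x. star (group_algebra G) f x \<noteq> 0}"
    then have "x = inv (inv x)" "f (inv x) \<noteq> 0" by (auto simp: group_algebra_star split: if_splits)
    then show "x \<in> m_inv G ` {x. f x \<noteq> 0}" by blast
  qed (use assms in \<open>auto simp: group_algebra_star group_algebra_carrier\<close>)
  show "star (group_algebra G) f \<in> carrier (group_algebra G)"
    unfolding group_algebra_carrier eq using assms by (auto simp: group_algebra_carrier)
  show "star (group_algebra G) (star (group_algebra G) f) = f"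
    using group_algebra_eq_0[OF assms] by (auto simp: group_algebra_star)
qed

end

text \<open>The action is on a whole type, so that it permutes the coordinates of
  \<open>'x ell2\<close>. An action on a subset enters by letting the group fix all other
  points.\<close>

locale permutation_action = group G for G (structure) +
  fixes act :: "'g \<Rightarrow> 'x \<Rightarrow> 'x"
  assumes act_one: "act \<one> x = x"
    and act_mult: "g \<in> carrier G \<Longrightarrow> h \<in> carrier G \<Longrightarrow> act (g \<otimes> h) x = act g (act h x)"
begin

lemma act_inv [simp]:
  assumes "g \<in> carrier G"
  shows "act (inv g) (act g x) = x" "act g (act (inv g) x) = x"
  using assms act_mult[of "inv g" g x] act_mult[of g "inv g" x] by (simp_all add: act_one)

lemma bij_act [simp]: "g \<in> carrier G \<Longrightarrow> bij (act g)"
  by (rule o_bij[of "act (inv g)"]) auto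

text \<open>The permutation action of the group algebra on arbitrary functions, free of summability.
  For left multiplication it becomes the product of the group algebra, so that
  \<open>conv_mult\<close> yields both associativity of that product and multiplicativity of
  \<open>rep\<close>.\<close>

definition conv :: "('g \<Rightarrow> complex) \<Rightarrow> ('x \<Rightarrow> complex) \<Rightarrow> 'x \<Rightarrow> complex" where
  "conv f u x = (\<Sum>y | f y \<noteq> 0. f y * u (act (inv y) x))"

definition rep :: "('g \<Rightarrow> complex) \<Rightarrow> 'x ell2 \<Rightarrow> 'x ell2" where
  "rep f v = (\<Sum>y | f y \<noteq> 0. scaleC (f y) (reindex (act (inv y)) v))"

lemma conv_superset:
  assumes "finite S" "{y. f y \<noteq> 0} \<subseteq> S"
  shows "conv f u x = (\<Sum>y\<in>S. f y * u (act (inv y) x))"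
  unfolding conv_def using assms by (intro sum.mono_neutral_left) auto

lemma conv_add_left:
  assumes "f \<in> carrier (group_algebra G)" "h \<in> carrier (group_algebra G)"
  shows "conv (\<lambda>x. f x + h x) u x = conv f u x + conv h u x"
proof -
  let ?S = "{x. f x \<noteq> 0} \<union> {x. h x \<noteq> 0}"
  have "finite ?S" using assms by (simp add: group_algebra_carrier)
  then show ?thesis
    by (subst (1 2 3) conv_superset[of ?S]) (auto simp: ring_distribs sum.distrib)
qed

lemma conv_cmult_left: "conv (\<lambda>x. c * f x) u x = c * conv f u x"
  by (cases "c = 0") (simp_all add: conv_def sum_distrib_left mult.assoc)

lemma conv_add_right: "conv f (\<lambda>x. u x + w x) x = conv f u x + conv f w x"
  by (simp add: conv_def ring_distribs sum.distrib)

lemma conv_cmult_right: "conv f (\<lambda>x. c * u x) x = c * conv f u x"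
  by (simp add: conv_def sum_distrib_left mult.left_commute)

lemma conv_single:
  assumes "g \<in> carrier G"
  shows "conv (\<lambda>x. if x = g then c else 0) u x = c * u (act (inv g) x)"
  by (subst conv_superset[of "{g}"]) auto

text \<open>The sum for the product runs over the finite set \<open>?P\<close> of products of
  support elements. Exchanging it with the sum that defines the product and substituting
  \<open>w = y \<otimes> z\<close> for fixed \<open>y\<close> gives the iterated sum.\<close>

lemma conv_mult:
  assumes f: "f \<in> carrier (group_algebra G)" and h: "h \<in> carrier (group_algebra G)"
  shows "conv (f \<otimes>\<^bsub>group_algebra G\<^esub> h) u x = conv f (conv h u) x"
proof -
  let ?F = "{y. f y \<noteq> 0}" and ?K = "{z. h z \<noteq> 0}"
  let ?P = "(\<lambda>(y, z). y \<otimes> z) ` (?F \<times> ?K)"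
  have fin: "finite ?F" "finite ?K" "?F \<subseteq> carrier G" "?K \<subseteq> carrier G"
    using f h by (auto simp: group_algebra_carrier)
  have P: "finite ?P" "?P \<subseteq> carrier G" using fin by auto
  have "conv (f \<otimes>\<^bsub>group_algebra G\<^esub> h) u x
      = (\<Sum>w\<in>?P. (f \<otimes>\<^bsub>group_algebra G\<^esub> h) w * u (act (inv w) x))"
    by (rule conv_superset[OF P(1) group_algebra_mult_closed(2)[OF f h]])
  also have "\<dots> = (\<Sum>w\<in>?P. \<Sum>y\<in>?F. f y * h (inv y \<otimes> w) * u (act (inv w) x))"
    using P by (intro sum.cong) (auto simp: group_algebra_mult sum_distrib_right)
  also have "\<dots> = (\<Sum>y\<in>?F. \<Sum>w\<in>?P. f y * h (inv y \<otimes> w) * u (act (inv w) x))"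
    by (rule sum.swap)
  also have "\<dots> = (\<Sum>y\<in>?F. \<Sum>z\<in>?K. f y * h z * u (act (inv (y \<otimes> z)) x))"
  proof (rule sum.cong[OF refl])
    fix y assume y: "y \<in> ?F"
    then have yG: "y \<in> carrier G" using fin by auto
    \<comment> \<open>For fixed \<open>y\<close> only the translate of \<open>?K\<close> by
      \<open>y\<close> contributes, since \<open>h (inv y \<otimes> w)\<close> vanishes at all other
      \<open>w\<close>.\<close>
    have "(\<Sum>w\<in>?P. f y * h (inv y \<otimes> w) * u (act (inv w) x))
        = (\<Sum>w\<in>(\<lambda>z. y \<otimes> z) ` ?K. f y * h (inv y \<otimes> w) * u (act (inv w) x))"
    proof (rule sum.mono_neutral_right[OF P(1)])
      show "(\<lambda>z. y \<otimes> z) ` ?K \<subseteq> ?P" using y by auto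
      have "h (inv y \<otimes> w) = 0" if "w \<in> ?P - (\<lambda>z. y \<otimes> z) ` ?K" for w
      proof (rule ccontr)
        assume "h (inv y \<otimes> w) \<noteq> 0"
        moreover have "w = y \<otimes> (inv y \<otimes> w)" using yG that P by (auto simp: m_assoc[symmetric])
        ultimately show False using that by blast
      qed
      then show "\<forall>w\<in>?P - (\<lambda>z. y \<otimes> z) ` ?K. f y * h (inv y \<otimes> w) * u (act (inv w) x) = 0" by simp
    qed
    also have "\<dots> = (\<Sum>z\<in>?K. f y * h (inv y \<otimes> (y \<otimes> z)) * u (act (inv (y \<otimes> z)) x))"
      using yG fin by (subst sum.reindex) (auto intro!: inj_onI simp: subset_iff)
    also have "\<dots> = (\<Sum>z\<in>?K. f y * h z * u (act (inv (y \<otimes> z)) x))"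
      using yG fin by (intro sum.cong) (auto simp: m_assoc[symmetric])
    finally show "(\<Sum>w\<in>?P. f y * h (inv y \<otimes> w) * u (act (inv w) x))
        = (\<Sum>z\<in>?K. f y * h z * u (act (inv (y \<otimes> z)) x))" .
  qed
  also have "\<dots> = conv f (conv h u) x"
    unfolding conv_def sum_distrib_left using fin
    by (intro sum.cong refl) (auto simp: inv_mult_group act_mult mult.assoc subset_iff)
  finally show ?thesis .
qed

lemma coord_rep:
  assumes "f \<in> carrier (group_algebra G)"
  shows "coord (rep f v) x = conv f (coord v) x"
  using assms unfolding rep_def conv_def coord_sum
  by (intro sum.cong) (auto simp: group_algebra_carrier subset_iff)

lemma rep_add:
  assumes "f \<in> carrier (group_algebra G)" "h \<in> carrier (group_algebra G)"
  shows "rep (\<lambda>x. f x + h x) v = rep f v + rep h v"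
  using assms by (intro ell2_eqI) (simp add: coord_rep conv_add_left)

lemma rep_cmult:
  assumes "f \<in> carrier (group_algebra G)"
  shows "rep (\<lambda>x. c * f x) v = scaleC c (rep f v)"
  using assms by (intro ell2_eqI) (simp add: coord_rep conv_cmult_left)

lemma rep_one: "rep (\<lambda>x. if x = \<one> then 1 else 0) v = v"
  by (intro ell2_eqI) (simp add: coord_rep conv_single act_one)

lemma rep_mult:
  assumes "f \<in> carrier (group_algebra G)" "h \<in> carrier (group_algebra G)"
  shows "rep (f \<otimes>\<^bsub>group_algebra G\<^esub> h) v = rep f (rep h v)"
proof (rule ell2_eqI)
  have "coord (rep h v) = conv h (coord v)" using coord_rep[OF assms(2)] by blast
  then show "coord (rep (f \<otimes>\<^bsub>group_algebra G\<^esub> h) v) x = coord (rep f (rep h v)) x" for x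
    using assms by (simp add: coord_rep group_algebra_mult_closed conv_mult)
qed

lemma rep_linear:
  assumes "f \<in> carrier (group_algebra G)"
  shows "rep f (v + w) = rep f v + rep f w" "rep f (scaleC c v) = scaleC c (rep f v)"
proof -
  have "coord (v + w) = (\<lambda>x. coord v x + coord w x)" "coord (scaleC c v) = (\<lambda>x. c * coord v x)" by auto
  then show "rep f (v + w) = rep f v + rep f w" "rep f (scaleC c v) = scaleC c (rep f v)"
    using assms by (auto intro!: ell2_eqI simp: coord_rep conv_add_right conv_cmult_right)
qed

lemma norm_rep_le:
  assumes "f \<in> carrier (group_algebra G)"
  shows "norm (rep f v) \<le> (\<Sum>y | f y \<noteq> 0. cmod (f y)) * norm v"
proof -
  have "norm (rep f v) \<le> (\<Sum>y | f y \<noteq> 0. norm (scaleC (f y) (reindex (act (inv y)) v)))"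
    unfolding rep_def by (rule norm_sum)
  also have "\<dots> = (\<Sum>y | f y \<noteq> 0. cmod (f y) * norm v)"
    using assms by (intro sum.cong) (auto simp: norm_scaleC group_algebra_carrier subset_iff)
  finally show ?thesis by (simp add: sum_distrib_right)
qed

lemma bounded_linear_rep:
  assumes "f \<in> carrier (group_algebra G)"
  shows "bounded_linear (rep f)"
  using norm_rep_le[OF assms]
  by (intro bounded_linear_intro[where K = "\<Sum>y | f y \<noteq> 0. cmod (f y)"])
    (auto simp: rep_linear[OF assms] scaleR_eq_scaleC mult.commute)

text \<open>Reindexing by inversion writes \<open>rep (star (group_algebra G) f)\<close> as a sum of
  \<open>cnj (f y)\<close> times the inverse of the unitary of \<open>y\<close>, and the adjoint of
  a unitary is its inverse.\<close>

lemma rep_adjoint: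
  assumes f: "f \<in> carrier (group_algebra G)"
  shows "cinner (rep f v) w = cinner v (rep (star (group_algebra G) f) w)"
proof -
  have fG: "y \<in> carrier G" if "f y \<noteq> 0" for y using that f by (auto simp: group_algebra_carrier)
  have "rep (star (group_algebra G) f) w
      = (\<Sum>y\<in>m_inv G ` {x. f x \<noteq> 0}. scaleC (star (group_algebra G) f y) (reindex (act (inv y)) w))"
    by (simp add: rep_def group_algebra_star_closed(2)[OF f])
  also have "\<dots> = (\<Sum>y | f y \<noteq> 0. scaleC (cnj (f y)) (reindex (act y) w))"
    using fG by (subst sum.reindex) (auto intro!: inj_onI sum.cong simp: group_algebra_star)
  finally have "cinner v (rep (star (group_algebra G) f) w)
      = (\<Sum>y | f y \<noteq> 0. f y * cinner v (reindex (act y) w))"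
    by (simp add: cinner_sum_right cinner_scaleC_right)
  also have "\<dots> = (\<Sum>y | f y \<noteq> 0. f y * cinner (reindex (act (inv y)) v) w)"
  proof (rule sum.cong[OF refl])
    fix y assume "y \<in> {y. f y \<noteq> 0}"
    then have y: "y \<in> carrier G" using fG by simp
    have "reindex (act y) (reindex (act (inv y)) v) = v"
      using y by (intro ell2_eqI) simp
    then show "f y * cinner v (reindex (act y) w) = f y * cinner (reindex (act (inv y)) v) w"
      using cinner_reindex[OF bij_act[OF y], of "reindex (act (inv y)) v" w] by simp
  qed
  also have "\<dots> = cinner (rep f v) w"
    by (simp add: rep_def cinner_sum_left cinner_scaleC)
  finally show ?thesis by simp
qed

end

text \<open>The conditions of \<open>cstar_norm\<close> without definiteness, as they hold for the
  operator norm of a representation that may have a kernel.\<close>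

definition cstar_seminorm :: "('a, 'm) star_algebra_scheme \<Rightarrow> ('a \<Rightarrow> real) \<Rightarrow> bool" where
  "cstar_seminorm A N \<longleftrightarrow>
    (\<forall>x\<in>carrier A. N x \<ge> 0) \<and>
    (\<forall>x\<in>carrier A. \<forall>y\<in>carrier A. N (x \<oplus>\<^bsub>A\<^esub> y) \<le> N x + N y) \<and>
    (\<forall>c. \<forall>x\<in>carrier A. N (c \<odot>\<^bsub>A\<^esub> x) = cmod c * N x) \<and>
    (\<forall>x\<in>carrier A. \<forall>y\<in>carrier A. N (x \<otimes>\<^bsub>A\<^esub> y) \<le> N x * N y) \<and>
    (\<forall>x\<in>carrier A. N (star A x \<otimes>\<^bsub>A\<^esub> x) = (N x)\<^sup>2)"

text \<open>For operator norms this is the norm of the direct sum of two representations. The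
  C*-identity survives because squaring is monotone on non-negative numbers and hence commutes with
  \<open>max\<close>.\<close>

lemma cstar_seminorm_max:
  assumes N: "cstar_seminorm A N" and M: "cstar_seminorm A M"
  shows "cstar_seminorm A (\<lambda>x. max (N x) (M x))"
  unfolding cstar_seminorm_def
proof (intro conjI ballI allI)
  fix x assume x: "x \<in> carrier A"
  have pos: "N x \<ge> 0" "M x \<ge> 0" if "x \<in> carrier A" for x
    using that N M by (auto simp: cstar_seminorm_def)
  show "0 \<le> max (N x) (M x)" using pos[OF x] by simp
  show "max (N (c \<odot>\<^bsub>A\<^esub> x)) (M (c \<odot>\<^bsub>A\<^esub> x)) = cmod c * max (N x) (M x)" for c
    using N M x by (simp add: cstar_seminorm_def max_mult_distrib_left)
  have "max ((N x)\<^sup>2) ((M x)\<^sup>2) = (max (N x) (M x))\<^sup>2"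
    using pos[OF x] by (auto simp: max_def power_mono intro: antisym power2_le_imp_le)
  then show "max (N (star A x \<otimes>\<^bsub>A\<^esub> x)) (M (star A x \<otimes>\<^bsub>A\<^esub> x)) = (max (N x) (M x))\<^sup>2"
    using N M x by (simp add: cstar_seminorm_def)
  fix y assume y: "y \<in> carrier A"
  have "N (x \<oplus>\<^bsub>A\<^esub> y) \<le> N x + N y" "M (x \<oplus>\<^bsub>A\<^esub> y) \<le> M x + M y"
    "N (x \<otimes>\<^bsub>A\<^esub> y) \<le> N x * N y" "M (x \<otimes>\<^bsub>A\<^esub> y) \<le> M x * M y"
    using N M x y by (auto simp: cstar_seminorm_def)
  moreover have "N x * N y \<le> max (N x) (M x) * max (N y) (M y)"
    "M x * M y \<le> max (N x) (M x) * max (N y) (M y)"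
    using pos[OF x] pos[OF y] by (auto intro!: mult_mono)
  ultimately show "max (N (x \<oplus>\<^bsub>A\<^esub> y)) (M (x \<oplus>\<^bsub>A\<^esub> y)) \<le> max (N x) (M x) + max (N y) (M y)"
    "max (N (x \<otimes>\<^bsub>A\<^esub> y)) (M (x \<otimes>\<^bsub>A\<^esub> y)) \<le> max (N x) (M x) * max (N y) (M y)"
    by linarith+
qed

section \<open>Operator norms of permutation representations\<close>

context permutation_action
begin

abbreviation opnorm :: "('g \<Rightarrow> complex) \<Rightarrow> real" where
  "opnorm f \<equiv> onorm (rep f)"

text \<open>The square of the norm of \<open>rep f v\<close> is the inner product of
  \<open>v\<close> with the image of \<open>v\<close> under \<open>rep\<close> of
  \<open>star f\<close> times \<open>f\<close>; Cauchy-Schwarz bounds it by the operator norm of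
  that product.\<close>

lemma opnorm_square_le:
  assumes f: "f \<in> carrier (group_algebra G)"
  shows "(opnorm f)\<^sup>2 \<le> opnorm (star (group_algebra G) f \<otimes>\<^bsub>group_algebra G\<^esub> f)"
proof -
  let ?g = "star (group_algebra G) f \<otimes>\<^bsub>group_algebra G\<^esub> f"
  have star: "star (group_algebra G) f \<in> carrier (group_algebra G)"
    by (rule group_algebra_star_closed[OF f])
  have g: "?g \<in> carrier (group_algebra G)"
    by (rule group_algebra_mult_closed[OF star f])
  have pos: "0 \<le> opnorm ?g" by (rule onorm_pos_le[OF bounded_linear_rep[OF g]])
  have "norm (rep f v) \<le> sqrt (opnorm ?g) * norm v" for v
  proof (rule power2_le_imp_le)
    have "(norm (rep f v))\<^sup>2 = Re (cinner (rep f v) (rep f v))"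
      by (simp add: cinner_self_norm)
    also have "\<dots> = inner v (rep ?g v)"
      by (simp add: rep_adjoint[OF f] rep_mult[OF star f] inner_ell2_def)
    also have "\<dots> \<le> norm v * norm (rep ?g v)" by (rule norm_cauchy_schwarz)
    also have "\<dots> \<le> norm v * (opnorm ?g * norm v)"
      by (intro mult_left_mono onorm bounded_linear_rep g) simp
    also have "\<dots> = (sqrt (opnorm ?g) * norm v)\<^sup>2"
      using pos by (simp add: power_mult_distrib power2_eq_square)
    finally show "(norm (rep f v))\<^sup>2 \<le> (sqrt (opnorm ?g) * norm v)\<^sup>2" .
  qed (simp add: pos)
  then have "opnorm f \<le> sqrt (opnorm ?g)" using pos by (intro onorm_bound) simp_all
  then have "(opnorm f)\<^sup>2 \<le> (sqrt (opnorm ?g))\<^sup>2"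
    by (intro power_mono onorm_pos_le bounded_linear_rep f)
  then show ?thesis using pos by simp
qed

lemma opnorm_mult:
  assumes "f \<in> carrier (group_algebra G)" "h \<in> carrier (group_algebra G)"
  shows "opnorm (f \<otimes>\<^bsub>group_algebra G\<^esub> h) \<le> opnorm f * opnorm h"
proof -
  have "rep (f \<otimes>\<^bsub>group_algebra G\<^esub> h) = rep f \<circ> rep h" using rep_mult[OF assms] by auto
  then show ?thesis using onorm_compose[OF assms[THEN bounded_linear_rep]] by simp
qed

text \<open>Combine \<open>opnorm_square_le\<close> with submultiplicativity and cancel one factor
  \<open>opnorm f\<close>, unless it is 0. Applied to \<open>f\<close> and to its star this gives
  equality of the two norms.\<close>

lemma opnorm_le_star:
  assumes f: "f \<in> carrier (group_algebra G)"
  shows "opnorm f \<le> opnorm (star (group_algebra G) f)"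
proof -
  have star: "star (group_algebra G) f \<in> carrier (group_algebra G)"
    by (rule group_algebra_star_closed[OF f])
  have "opnorm f * opnorm f \<le> opnorm (star (group_algebra G) f) * opnorm f"
    using opnorm_square_le[OF f] opnorm_mult[OF star f] by (simp add: power2_eq_square)
  then show ?thesis
    using onorm_pos_le[OF bounded_linear_rep[OF f]] onorm_pos_le[OF bounded_linear_rep[OF star]]
    by (cases "opnorm f = 0") auto
qed

lemma cstar_seminorm_opnorm: "cstar_seminorm (group_algebra G) opnorm"
  unfolding cstar_seminorm_def
proof (intro conjI ballI allI)
  fix f assume f: "f \<in> carrier (group_algebra G)"
  show pos: "0 \<le> opnorm f" by (rule onorm_pos_le[OF bounded_linear_rep[OF f]])
  show "opnorm (c \<odot>\<^bsub>group_algebra G\<^esub> f) = cmod c * opnorm f" for c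
  proof -
    have "rep (c \<odot>\<^bsub>group_algebra G\<^esub> f) = (\<lambda>v. scaleC c (rep f v))" using rep_cmult[OF f] by auto
    then show ?thesis using onorm_scaleC[OF bounded_linear_rep[OF f]] by simp
  qed
  have star: "star (group_algebra G) f \<in> carrier (group_algebra G)"
    by (rule group_algebra_star_closed[OF f])
  have "opnorm (star (group_algebra G) f) = opnorm f"
    using opnorm_le_star[OF f] opnorm_le_star[OF star] group_algebra_star_closed(3)[OF f] by simp
  then show "opnorm (star (group_algebra G) f \<otimes>\<^bsub>group_algebra G\<^esub> f) = (opnorm f)\<^sup>2"
    using opnorm_square_le[OF f] opnorm_mult[OF star f] by (simp add: power2_eq_square)
  fix h assume h: "h \<in> carrier (group_algebra G)"
  show "opnorm (f \<otimes>\<^bsub>group_algebra G\<^esub> h) \<le> opnorm f * opnorm h" by (rule opnorm_mult[OF f h])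
  have "rep (f \<oplus>\<^bsub>group_algebra G\<^esub> h) = (\<lambda>v. rep f v + rep h v)"
    using rep_add[OF f h] by auto
  then show "opnorm (f \<oplus>\<^bsub>group_algebra G\<^esub> h) \<le> opnorm f + opnorm h"
    using onorm_triangle[OF bounded_linear_rep[OF f] bounded_linear_rep[OF h]] by simp
qed

end

section \<open>The left regular representation and the ring axioms\<close>

context group
begin

text \<open>Elements outside the carrier are fixed, which makes left multiplication an action on the
  whole type.\<close>

definition left_mult :: "'a \<Rightarrow> 'a \<Rightarrow> 'a" where
  "left_mult g x = (if x \<in> carrier G then g \<otimes> x else x)"

lemma permutation_action_left_mult: "permutation_action G left_mult"
  by unfold_locales (auto simp: left_mult_def m_assoc)

interpretation L: permutation_action G left_mult
  by (rule permutation_action_left_mult)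

text \<open>Outside the carrier the product is 0 by definition, and \<open>conv\<close> agrees
  because \<open>left_mult\<close> fixes such a point and \<open>h\<close> vanishes there.\<close>

lemma group_algebra_mult_eq_conv:
  assumes "f \<in> carrier (group_algebra G)" "h \<in> carrier (group_algebra G)"
  shows "f \<otimes>\<^bsub>group_algebra G\<^esub> h = L.conv f h"
  using assms group_algebra_eq_0[OF assms(2)]
  by (auto simp: group_algebra_mult L.conv_def left_mult_def fun_eq_iff)

text \<open>With the product read as \<open>conv\<close>, associativity is \<open>conv_mult\<close>,
  and the distributive laws are additivity of \<open>conv\<close> in each argument.\<close>

lemma ring_group_algebra: "ring (group_algebra G)"
proof (rule ringI)
  show "abelian_group (group_algebra G)"
  proof (rule abelian_groupI)
    fix f assume "f \<in> carrier (group_algebra G)"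
    then show "\<exists>h\<in>carrier (group_algebra G). h \<oplus>\<^bsub>group_algebra G\<^esub> f = \<zero>\<^bsub>group_algebra G\<^esub>"
      by (intro bexI[of _ "\<lambda>x. - 1 * f x"]) (simp, rule group_algebra_closed)
  qed (simp_all add: add_ac)
  have one: "(\<lambda>x. if x = \<one> then 1 else 0) \<in> carrier (group_algebra G)" by simp
  show "monoid (group_algebra G)"
  proof (rule monoidI)
    fix f h k
    assume f: "f \<in> carrier (group_algebra G)"
    have "(\<Sum>y | f y \<noteq> 0. f y * (if left_mult (inv y) x = \<one> then 1 else 0)) = f x" for x
    proof -
      have "(\<Sum>y | f y \<noteq> 0. f y * (if left_mult (inv y) x = \<one> then 1 else 0))
          = (\<Sum>y | f y \<noteq> 0. if y = x then f y else 0)"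
      proof (rule sum.cong[OF refl])
        fix y assume "y \<in> {y. f y \<noteq> 0}"
        then have "y \<in> carrier G" using f by (auto simp: group_algebra_carrier)
        then have "left_mult (inv y) x = \<one> \<longleftrightarrow> y = x"
          using inv_equality[of "inv y" x] by (auto simp: left_mult_def)
        then show "f y * (if left_mult (inv y) x = \<one> then 1 else 0) = (if y = x then f y else 0)" by simp
      qed
      also have "\<dots> = f x" using f by (simp add: group_algebra_carrier)
      finally show ?thesis .
    qed
    then show "f \<otimes>\<^bsub>group_algebra G\<^esub> \<one>\<^bsub>group_algebra G\<^esub> = f"
      by (simp add: group_algebra_mult_eq_conv[OF f one] L.conv_def fun_eq_iff)
    show "\<one>\<^bsub>group_algebra G\<^esub> \<otimes>\<^bsub>group_algebra G\<^esub> f = f"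
      by (simp add: group_algebra_mult_eq_conv[OF one f] L.conv_single fun_eq_iff L.act_one)
    assume h: "h \<in> carrier (group_algebra G)"
    show "f \<otimes>\<^bsub>group_algebra G\<^esub> h \<in> carrier (group_algebra G)"
      by (rule group_algebra_mult_closed[OF f h])
    assume k: "k \<in> carrier (group_algebra G)"
    show "f \<otimes>\<^bsub>group_algebra G\<^esub> h \<otimes>\<^bsub>group_algebra G\<^esub> k = f \<otimes>\<^bsub>group_algebra G\<^esub> (h \<otimes>\<^bsub>group_algebra G\<^esub> k)"
    proof
      fix x
      note fh = group_algebra_mult_closed(1)[OF f h] and hk = group_algebra_mult_closed(1)[OF h k]
      have "(f \<otimes>\<^bsub>group_algebra G\<^esub> h \<otimes>\<^bsub>group_algebra G\<^esub> k) x = L.conv f (L.conv h k) x"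
        unfolding group_algebra_mult_eq_conv[OF fh k] by (rule L.conv_mult[OF f h])
      also have "\<dots> = (f \<otimes>\<^bsub>group_algebra G\<^esub> (h \<otimes>\<^bsub>group_algebra G\<^esub> k)) x"
        unfolding group_algebra_mult_eq_conv[OF f hk] unfolding group_algebra_mult_eq_conv[OF h k] ..
      finally show "(f \<otimes>\<^bsub>group_algebra G\<^esub> h \<otimes>\<^bsub>group_algebra G\<^esub> k) x
        = (f \<otimes>\<^bsub>group_algebra G\<^esub> (h \<otimes>\<^bsub>group_algebra G\<^esub> k)) x" .
    qed
  qed (use one in simp)
  fix f h k
  assume fhk: "f \<in> carrier (group_algebra G)" "h \<in> carrier (group_algebra G)" "k \<in> carrier (group_algebra G)"
  show "(f \<oplus>\<^bsub>group_algebra G\<^esub> h) \<otimes>\<^bsub>group_algebra G\<^esub> k = f \<otimes>\<^bsub>group_algebra G\<^esub> k \<oplus>\<^bsub>group_algebra G\<^esub> h \<otimes>\<^bsub>group_algebra G\<^esub> k"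
    "k \<otimes>\<^bsub>group_algebra G\<^esub> (f \<oplus>\<^bsub>group_algebra G\<^esub> h) = k \<otimes>\<^bsub>group_algebra G\<^esub> f \<oplus>\<^bsub>group_algebra G\<^esub> k \<otimes>\<^bsub>group_algebra G\<^esub> h"
    using fhk by (simp_all add: group_algebra_mult_eq_conv L.conv_add_left L.conv_add_right fun_eq_iff)
qed

lemma module_group_algebra: "Module.module (class_ring :: complex ring) (group_algebra G)"
  by (rule moduleI[OF complex_cring ring.is_abelian_group[OF ring_group_algebra]])
    (auto simp: algebra_simps)

text \<open>The left regular representation is faithful: the basis vector at \<open>\<one>\<close>
  is the unit of the group algebra, so \<open>f\<close> sends it to \<open>f\<close> itself.\<close>

lemma left_mult_opnorm_eq_0:
  assumes f: "f \<in> carrier (group_algebra G)" and 0: "L.opnorm f = 0"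
  shows "f = (\<lambda>x. 0)"
proof
  fix x
  have one: "(\<lambda>x. if x = \<one> then 1 else 0) \<in> carrier (group_algebra G)" by simp
  have "L.rep f (basis_vector \<one>) = 0"
    using 0 onorm_eq_0[OF L.bounded_linear_rep[OF f]] by simp
  then have "0 = L.conv f (coord (basis_vector \<one>)) x"
    using L.coord_rep[OF f, of "basis_vector \<one>" x] by simp
  also have "coord (basis_vector \<one>) = \<one>\<^bsub>group_algebra G\<^esub>" by auto
  also have "L.conv f \<one>\<^bsub>group_algebra G\<^esub> x = f x"
    using group_algebra_mult_eq_conv[OF f, of "\<one>\<^bsub>group_algebra G\<^esub>"] one
      monoid.r_one[OF ring.is_monoid[OF ring_group_algebra] f] by simp
  finally show "f x = 0" by simp
qed

end

section \<open>Completions and closed ideals\<close>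

text \<open>Lets closure under scalars, and bounds for scalar multiples, cover additive
  inverses.\<close>

lemma module_minus_eq_smult:
  assumes "Module.module (class_ring :: complex ring) A" "x \<in> carrier A"
  shows "\<ominus>\<^bsub>A\<^esub> x = (- 1) \<odot>\<^bsub>A\<^esub> x"
proof -
  interpret A: Module.module "class_ring :: complex ring" A by (rule assms)
  have "(- 1) \<odot>\<^bsub>A\<^esub> x \<oplus>\<^bsub>A\<^esub> x = \<zero>\<^bsub>A\<^esub>"
    using assms(2) A.smult_l_distr[of "- 1" 1 x] A.smult_one[of x] A.smult_l_null[of x] by simp
  then show ?thesis using assms(2) A.smult_closed[of "- 1" x] by (intro A.M.minus_equality) auto
qed

lemma ideal_of_subspace:
  assumes ring: "ring A" and module: "Module.module (class_ring :: complex ring) A"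
    and I: "I \<subseteq> carrier A" "\<zero>\<^bsub>A\<^esub> \<in> I" "\<And>x y. x \<in> I \<Longrightarrow> y \<in> I \<Longrightarrow> x \<oplus>\<^bsub>A\<^esub> y \<in> I"
      "\<And>c x. x \<in> I \<Longrightarrow> c \<odot>\<^bsub>A\<^esub> x \<in> I"
      "\<And>x y. x \<in> carrier A \<Longrightarrow> y \<in> I \<Longrightarrow> x \<otimes>\<^bsub>A\<^esub> y \<in> I \<and> y \<otimes>\<^bsub>A\<^esub> x \<in> I"
  shows "ideal I A"
proof (rule idealI[OF ring])
  interpret ring A by (rule ring)
  show "subgroup I (add_monoid A)"
  proof (rule add.subgroupI)
    show "\<ominus>\<^bsub>A\<^esub> x \<in> I" if "x \<in> I" for x
      using module_minus_eq_smult[OF module, of x] that I(1,4) by auto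
  qed (use I in auto)
qed (use I in auto)

text \<open>Common ground of the operator norm of a representation and of
  \<open>max_cstar_norm\<close>. For scalars it asks for \<open>\<le>\<close>, which a supremum of
  norms inherits term by term.\<close>

definition algebra_seminorm :: "('a, 'm) star_algebra_scheme \<Rightarrow> ('a \<Rightarrow> real) \<Rightarrow> bool" where
  "algebra_seminorm A p \<longleftrightarrow>
    (\<forall>x\<in>carrier A. p x \<ge> 0) \<and>
    (\<forall>x\<in>carrier A. \<forall>y\<in>carrier A. p (x \<oplus>\<^bsub>A\<^esub> y) \<le> p x + p y) \<and>
    (\<forall>c. \<forall>x\<in>carrier A. p (c \<odot>\<^bsub>A\<^esub> x) \<le> cmod c * p x) \<and>
    (\<forall>x\<in>carrier A. \<forall>y\<in>carrier A. p (x \<otimes>\<^bsub>A\<^esub> y) \<le> p x * p y)"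

lemma cstar_imp_algebra_seminorm: "cstar_seminorm A p \<Longrightarrow> algebra_seminorm A p"
  by (simp add: cstar_seminorm_def algebra_seminorm_def)

section \<open>Cauchy sequences and the completion\<close>

locale normed_algebra =
  fixes A :: "('a, 'm) normed_star_algebra_scheme"
  assumes ring: "ring A" and module: "Module.module (class_ring :: complex ring) A"
    and seminorm: "algebra_seminorm A (algebra_norm A)"
begin

sublocale A: ring A by (rule ring)
sublocale A: Module.module "class_ring :: complex ring" A by (rule module)

lemma smult_closed' [simp]: "x \<in> carrier A \<Longrightarrow> c \<odot>\<^bsub>A\<^esub> x \<in> carrier A"
  using A.smult_closed[of c x] by simp

lemma
  assumes p: "algebra_seminorm A p" and x: "x \<in> carrier A"
  shows seminorm_nonneg: "0 \<le> p x"
    and seminorm_smult: "p (c \<odot>\<^bsub>A\<^esub> x) \<le> cmod c * p x"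
    and seminorm_neg: "p (\<ominus>\<^bsub>A\<^esub> x) \<le> p x"
proof -
  show "0 \<le> p x" using p x by (simp add: algebra_seminorm_def)
  have smult: "p (c \<odot>\<^bsub>A\<^esub> x) \<le> cmod c * p x" for c using p x by (simp add: algebra_seminorm_def)
  then show "p (c \<odot>\<^bsub>A\<^esub> x) \<le> cmod c * p x" .
  show "p (\<ominus>\<^bsub>A\<^esub> x) \<le> p x" using smult[of "- 1"] module_minus_eq_smult[OF module x] by simp
qed

lemma seminorm_zero:
  assumes p: "algebra_seminorm A p"
  shows "p \<zero>\<^bsub>A\<^esub> = 0"
  using seminorm_nonneg[OF p A.zero_closed] seminorm_smult[OF p A.zero_closed, of 0]
    A.smult_l_null[OF A.zero_closed] by simp

lemma
  assumes p: "algebra_seminorm A p" and xy: "x \<in> carrier A" "y \<in> carrier A"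
  shows seminorm_add: "p (x \<oplus>\<^bsub>A\<^esub> y) \<le> p x + p y"
    and seminorm_mult: "p (x \<otimes>\<^bsub>A\<^esub> y) \<le> p x * p y"
    and seminorm_diff: "\<bar>p x - p y\<bar> \<le> p (x \<ominus>\<^bsub>A\<^esub> y)"
proof -
  have add: "p (x \<oplus>\<^bsub>A\<^esub> y) \<le> p x + p y" if "x \<in> carrier A" "y \<in> carrier A" for x y
    using p that by (simp add: algebra_seminorm_def)
  then show "p (x \<oplus>\<^bsub>A\<^esub> y) \<le> p x + p y" using xy .
  show "p (x \<otimes>\<^bsub>A\<^esub> y) \<le> p x * p y" using p xy by (simp add: algebra_seminorm_def)
  have "p (x \<ominus>\<^bsub>A\<^esub> y) \<le> p (y \<ominus>\<^bsub>A\<^esub> x)" if "x \<in> carrier A" "y \<in> carrier A" for x y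
  proof -
    have "x \<ominus>\<^bsub>A\<^esub> y = \<ominus>\<^bsub>A\<^esub> (y \<ominus>\<^bsub>A\<^esub> x)"
      using that by (simp add: a_minus_def A.minus_add A.a_comm)
    then show ?thesis using seminorm_neg[OF p, of "y \<ominus>\<^bsub>A\<^esub> x"] that by simp
  qed
  then have comm: "p (x \<ominus>\<^bsub>A\<^esub> y) = p (y \<ominus>\<^bsub>A\<^esub> x)" using xy by (meson antisym)
  have "p x \<le> p (x \<ominus>\<^bsub>A\<^esub> y) + p y" if "x \<in> carrier A" "y \<in> carrier A" for x y
    using add[of "x \<ominus>\<^bsub>A\<^esub> y" y] that by (simp add: a_minus_def A.a_assoc A.l_neg)
  from this[of x y] this[of y x] show "\<bar>p x - p y\<bar> \<le> p (x \<ominus>\<^bsub>A\<^esub> y)"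
    using xy comm by simp
qed

abbreviation "N \<equiv> algebra_norm A"
abbreviation "C \<equiv> cauchy_sequences A"
abbreviation "B \<equiv> completion A"

lemma C_simps [simp]:
  "\<zero>\<^bsub>C\<^esub> = (\<lambda>n. \<zero>\<^bsub>A\<^esub>)" "\<one>\<^bsub>C\<^esub> = (\<lambda>n. \<one>\<^bsub>A\<^esub>)"
  "s \<oplus>\<^bsub>C\<^esub> t = (\<lambda>n. s n \<oplus>\<^bsub>A\<^esub> t n)" "s \<otimes>\<^bsub>C\<^esub> t = (\<lambda>n. s n \<otimes>\<^bsub>A\<^esub> t n)"
  "c \<odot>\<^bsub>C\<^esub> s = (\<lambda>n. c \<odot>\<^bsub>A\<^esub> s n)"
  by (simp_all add: cauchy_sequences_def)

lemma C_closed: "s \<in> carrier C \<Longrightarrow> s n \<in> carrier A"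
  by (simp add: cauchy_sequences_def)

lemma C_iff:
  "s \<in> carrier C \<longleftrightarrow> (\<forall>n. s n \<in> carrier A) \<and>
     (\<forall>e>0. \<exists>M. \<forall>i\<ge>M. \<forall>j\<ge>M. N (s i \<ominus>\<^bsub>A\<^esub> s j) < e)"
  by (simp add: cauchy_sequences_def)

lemma C_cauchy:
  assumes "s \<in> carrier C" "e > 0"
  obtains M where "\<And>i j. i \<ge> M \<Longrightarrow> j \<ge> M \<Longrightarrow> N (s i \<ominus>\<^bsub>A\<^esub> s j) < e"
  using assms unfolding C_iff by metis

lemma C_const: "x \<in> carrier A \<Longrightarrow> (\<lambda>n. x) \<in> carrier C"
  using seminorm_zero[OF seminorm] by (simp add: C_iff a_minus_def A.r_neg)

lemma C_norm_convergent:
  assumes s: "s \<in> carrier C"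
  shows "convergent (\<lambda>n. N (s n))"
proof -
  have "Cauchy (\<lambda>n. N (s n))"
  proof (rule metric_CauchyI)
    fix e :: real assume "e > 0"
    from s this obtain M where M: "\<And>i j. i \<ge> M \<Longrightarrow> j \<ge> M \<Longrightarrow> N (s i \<ominus>\<^bsub>A\<^esub> s j) < e" by (rule C_cauchy) blast
    have "dist (N (s i)) (N (s j)) < e" if "i \<ge> M" "j \<ge> M" for i j
      using seminorm_diff[OF seminorm C_closed[OF s] C_closed[OF s], of i j] M[OF that]
      by (simp add: dist_real_def)
    then show "\<exists>M. \<forall>i\<ge>M. \<forall>j\<ge>M. dist (N (s i)) (N (s j)) < e" by blast
  qed
  then show ?thesis by (simp add: Cauchy_convergent)
qed

lemma C_bounded:
  assumes s: "s \<in> carrier C"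
  obtains K where "K > 0" "\<And>n. N (s n) \<le> K"
  using convergent_imp_Bseq[OF C_norm_convergent[OF s]] unfolding Bseq_def
  by (metis abs_le_D1 real_norm_def)

lemma C_add:
  assumes s: "s \<in> carrier C" and t: "t \<in> carrier C"
  shows "(\<lambda>n. s n \<oplus>\<^bsub>A\<^esub> t n) \<in> carrier C"
  unfolding C_iff
proof (intro conjI allI impI)
  note cl = C_closed[OF s] C_closed[OF t]
  show "s n \<oplus>\<^bsub>A\<^esub> t n \<in> carrier A" for n using cl by simp
  fix e :: real assume "e > 0"
  then have e: "e / 2 > 0" by simp
  from s e obtain M1 where M1: "\<And>i j. i \<ge> M1 \<Longrightarrow> j \<ge> M1 \<Longrightarrow> N (s i \<ominus>\<^bsub>A\<^esub> s j) < e / 2" by (rule C_cauchy) blast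
  from t e obtain M2 where M2: "\<And>i j. i \<ge> M2 \<Longrightarrow> j \<ge> M2 \<Longrightarrow> N (t i \<ominus>\<^bsub>A\<^esub> t j) < e / 2" by (rule C_cauchy) blast
  have "N ((s i \<oplus>\<^bsub>A\<^esub> t i) \<ominus>\<^bsub>A\<^esub> (s j \<oplus>\<^bsub>A\<^esub> t j)) < e" if "i \<ge> max M1 M2" "j \<ge> max M1 M2" for i j
  proof -
    have "(s i \<oplus>\<^bsub>A\<^esub> t i) \<ominus>\<^bsub>A\<^esub> (s j \<oplus>\<^bsub>A\<^esub> t j) = (s i \<ominus>\<^bsub>A\<^esub> s j) \<oplus>\<^bsub>A\<^esub> (t i \<ominus>\<^bsub>A\<^esub> t j)"
      using cl by (simp add: a_minus_def A.minus_add A.a_ac)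
    then show ?thesis
      using seminorm_add[OF seminorm, of "s i \<ominus>\<^bsub>A\<^esub> s j" "t i \<ominus>\<^bsub>A\<^esub> t j"] cl M1[of i j] M2[of i j] that by simp
  qed
  then show "\<exists>M. \<forall>i\<ge>M. \<forall>j\<ge>M. N ((s i \<oplus>\<^bsub>A\<^esub> t i) \<ominus>\<^bsub>A\<^esub> (s j \<oplus>\<^bsub>A\<^esub> t j)) < e" by blast
qed

lemma C_mult:
  assumes s: "s \<in> carrier C" and t: "t \<in> carrier C"
  shows "(\<lambda>n. s n \<otimes>\<^bsub>A\<^esub> t n) \<in> carrier C"
  unfolding C_iff
proof (intro conjI allI impI)
  note cl [simp] = C_closed[OF s] C_closed[OF t]
  show "s n \<otimes>\<^bsub>A\<^esub> t n \<in> carrier A" for n by simp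
  obtain K where K: "K > 0" "\<And>n. N (s n) \<le> K" using C_bounded[OF s] by blast
  obtain L where L: "L > 0" "\<And>n. N (t n) \<le> L" using C_bounded[OF t] by blast
  fix e :: real assume "e > 0"
  \<comment> \<open>These make each of the two terms in s_i (t_i - t_j) + (s_i - s_j) t_j smaller
    than e / 2, as \<open>K\<close> bounds the norms of \<open>s\<close> and \<open>L\<close> those
    of \<open>t\<close>.\<close>
  then have e: "e / (2 * K) > 0" "e / (2 * L) > 0" using K L by simp_all
  from s e(2) obtain M1 where M1: "\<And>i j. i \<ge> M1 \<Longrightarrow> j \<ge> M1 \<Longrightarrow> N (s i \<ominus>\<^bsub>A\<^esub> s j) < e / (2 * L)" by (rule C_cauchy) blast
  from t e(1) obtain M2 where M2: "\<And>i j. i \<ge> M2 \<Longrightarrow> j \<ge> M2 \<Longrightarrow> N (t i \<ominus>\<^bsub>A\<^esub> t j) < e / (2 * K)" by (rule C_cauchy) blast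
  have "N (s i \<otimes>\<^bsub>A\<^esub> t i \<ominus>\<^bsub>A\<^esub> s j \<otimes>\<^bsub>A\<^esub> t j) < e" if "i \<ge> max M1 M2" "j \<ge> max M1 M2" for i j
  proof -
    have pos: "0 \<le> N (s i)" "0 \<le> N (t i \<ominus>\<^bsub>A\<^esub> t j)" "0 \<le> N (s i \<ominus>\<^bsub>A\<^esub> s j)" "0 \<le> N (t j)"
      by (simp_all add: seminorm_nonneg[OF seminorm])
    have "s i \<otimes>\<^bsub>A\<^esub> t i \<ominus>\<^bsub>A\<^esub> s j \<otimes>\<^bsub>A\<^esub> t j
        = s i \<otimes>\<^bsub>A\<^esub> (t i \<ominus>\<^bsub>A\<^esub> t j) \<oplus>\<^bsub>A\<^esub> (s i \<ominus>\<^bsub>A\<^esub> s j) \<otimes>\<^bsub>A\<^esub> t j"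
      using cl[of i] cl[of j] by algebra
    also have "N \<dots> \<le> N (s i \<otimes>\<^bsub>A\<^esub> (t i \<ominus>\<^bsub>A\<^esub> t j)) + N ((s i \<ominus>\<^bsub>A\<^esub> s j) \<otimes>\<^bsub>A\<^esub> t j)"
      by (rule seminorm_add[OF seminorm]) simp_all
    also have "\<dots> \<le> N (s i) * N (t i \<ominus>\<^bsub>A\<^esub> t j) + N (s i \<ominus>\<^bsub>A\<^esub> s j) * N (t j)"
      by (intro add_mono seminorm_mult[OF seminorm]) simp_all
    also have "\<dots> \<le> K * N (t i \<ominus>\<^bsub>A\<^esub> t j) + N (s i \<ominus>\<^bsub>A\<^esub> s j) * L"
      using K L pos by (intro add_mono mult_mono) auto
    also have "\<dots> < K * (e / (2 * K)) + e / (2 * L) * L"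
      using K L M1[of i j] M2[of i j] that
      by (intro add_strict_mono mult_strict_left_mono mult_strict_right_mono) auto
    also have "\<dots> = e" using K L by simp
    finally show ?thesis .
  qed
  then show "\<exists>M. \<forall>i\<ge>M. \<forall>j\<ge>M. N (s i \<otimes>\<^bsub>A\<^esub> t i \<ominus>\<^bsub>A\<^esub> s j \<otimes>\<^bsub>A\<^esub> t j) < e" by blast
qed

lemma smult_minus:
  assumes "x \<in> carrier A" "y \<in> carrier A"
  shows "c \<odot>\<^bsub>A\<^esub> x \<ominus>\<^bsub>A\<^esub> c \<odot>\<^bsub>A\<^esub> y = c \<odot>\<^bsub>A\<^esub> (x \<ominus>\<^bsub>A\<^esub> y)"
  using assms A.smult_r_distr[of c x "\<ominus>\<^bsub>A\<^esub> y"] A.smult_r_minus[of c y] by (simp add: a_minus_def)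

lemma C_smult:
  assumes s: "s \<in> carrier C"
  shows "(\<lambda>n. c \<odot>\<^bsub>A\<^esub> s n) \<in> carrier C"
  unfolding C_iff
proof (intro conjI allI impI)
  note cl [simp] = C_closed[OF s]
  show "c \<odot>\<^bsub>A\<^esub> s n \<in> carrier A" for n by simp
  fix e :: real assume "e > 0"
  \<comment> \<open>Adding 1 to \<open>cmod c\<close> keeps the denominator positive when
    \<open>c = 0\<close>.\<close>
  then have e: "e / (cmod c + 1) > 0" by (simp add: add_nonneg_pos)
  from s e obtain M where M: "\<And>i j. i \<ge> M \<Longrightarrow> j \<ge> M \<Longrightarrow> N (s i \<ominus>\<^bsub>A\<^esub> s j) < e / (cmod c + 1)" by (rule C_cauchy) blast
  have "N (c \<odot>\<^bsub>A\<^esub> s i \<ominus>\<^bsub>A\<^esub> c \<odot>\<^bsub>A\<^esub> s j) < e" if "i \<ge> M" "j \<ge> M" for i j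
  proof -
    have "N (c \<odot>\<^bsub>A\<^esub> s i \<ominus>\<^bsub>A\<^esub> c \<odot>\<^bsub>A\<^esub> s j) \<le> cmod c * N (s i \<ominus>\<^bsub>A\<^esub> s j)"
      unfolding smult_minus[OF cl cl] by (rule seminorm_smult[OF seminorm]) simp
    also have "\<dots> \<le> (cmod c + 1) * N (s i \<ominus>\<^bsub>A\<^esub> s j)"
      by (intro mult_right_mono seminorm_nonneg[OF seminorm]) simp_all
    also have "\<dots> < (cmod c + 1) * (e / (cmod c + 1))"
      by (intro mult_strict_left_mono M that) (simp add: add_nonneg_pos)
    also have "\<dots> = e" by (simp add: add_nonneg_eq_0_iff)
    finally show ?thesis .
  qed
  then show "\<exists>M. \<forall>i\<ge>M. \<forall>j\<ge>M. N (c \<odot>\<^bsub>A\<^esub> s i \<ominus>\<^bsub>A\<^esub> c \<odot>\<^bsub>A\<^esub> s j) < e" by blast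
qed

lemma C_neg: "s \<in> carrier C \<Longrightarrow> (\<lambda>n. \<ominus>\<^bsub>A\<^esub> s n) \<in> carrier C"
  using C_smult[of s "- 1"] module_minus_eq_smult[OF module C_closed] by simp

lemma ring_C: "ring C"
proof (rule ringI)
  show "abelian_group C"
  proof (rule abelian_groupI)
    fix s assume s: "s \<in> carrier C"
    then show "\<exists>t\<in>carrier C. t \<oplus>\<^bsub>C\<^esub> s = \<zero>\<^bsub>C\<^esub>"
      by (intro bexI[OF _ C_neg[OF s]]) (simp add: C_closed A.l_neg)
  qed (simp_all add: C_add C_const C_closed A.a_ac)
  show "monoid C"
    by (rule monoidI) (simp_all add: C_mult C_const C_closed A.m_assoc)
qed (simp_all add: C_closed A.l_distr A.r_distr)

lemma module_C: "Module.module (class_ring :: complex ring) C"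
proof (rule moduleI[OF complex_cring ring.is_abelian_group[OF ring_C]])
  fix c d :: complex and s t assume s: "s \<in> carrier C"
  show "c \<odot>\<^bsub>C\<^esub> s \<in> carrier C" using s by (simp add: C_smult)
  show "(c \<oplus>\<^bsub>class_ring\<^esub> d) \<odot>\<^bsub>C\<^esub> s = c \<odot>\<^bsub>C\<^esub> s \<oplus>\<^bsub>C\<^esub> d \<odot>\<^bsub>C\<^esub> s"
    "(c \<otimes>\<^bsub>class_ring\<^esub> d) \<odot>\<^bsub>C\<^esub> s = c \<odot>\<^bsub>C\<^esub> (d \<odot>\<^bsub>C\<^esub> s)"
    "\<one>\<^bsub>class_ring\<^esub> \<odot>\<^bsub>C\<^esub> s = s"
    using C_closed[OF s] A.smult_l_distr[of c d] A.smult_assoc1[of c d] A.smult_one by simp_all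
  assume t: "t \<in> carrier C"
  show "c \<odot>\<^bsub>C\<^esub> (s \<oplus>\<^bsub>C\<^esub> t) = c \<odot>\<^bsub>C\<^esub> s \<oplus>\<^bsub>C\<^esub> c \<odot>\<^bsub>C\<^esub> t"
    using C_closed[OF s] C_closed[OF t] A.smult_r_distr[of c] by simp
qed

lemma C_minus:
  assumes s: "s \<in> carrier C" and t: "t \<in> carrier C"
  shows "s \<ominus>\<^bsub>C\<^esub> t = (\<lambda>n. s n \<ominus>\<^bsub>A\<^esub> t n)"
proof -
  have "\<ominus>\<^bsub>C\<^esub> t = (\<lambda>n. \<ominus>\<^bsub>A\<^esub> t n)"
    using module_minus_eq_smult[OF module_C t] module_minus_eq_smult[OF module C_closed[OF t]] by simp
  then show ?thesis by (simp add: a_minus_def)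
qed

text \<open>For \<open>p = N\<close> these are the null sequences; for the operator norm of a
  representation they represent the kernel of its extension to the completion.\<close>

definition seq_kernel :: "('a \<Rightarrow> real) \<Rightarrow> (nat \<Rightarrow> 'a) set" where
  "seq_kernel p = {s \<in> carrier C. (\<lambda>n. p (s n)) \<longlonglongrightarrow> 0}"

lemma null_sequences_eq: "null_sequences A = seq_kernel N"
  by (simp add: null_sequences_def seq_kernel_def)

text \<open>Sequences in \<open>C\<close> are bounded for \<open>N\<close>, hence for the smaller
  \<open>p\<close>, and a bounded factor preserves convergence to 0.\<close>

lemma
  assumes p: "algebra_seminorm A p" and pN: "\<And>x. x \<in> carrier A \<Longrightarrow> p x \<le> N x"
  shows ideal_seq_kernel: "ideal (seq_kernel p) C"
    and seq_kernel_smult: "s \<in> seq_kernel p \<Longrightarrow> c \<odot>\<^bsub>C\<^esub> s \<in> seq_kernel p"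
proof -
  have sub: "seq_kernel p \<subseteq> carrier C" by (auto simp: seq_kernel_def)
  have pos: "0 \<le> p (s n)" if "s \<in> carrier C" for s n
    using seminorm_nonneg[OF p] C_closed that by blast
  have smult: "c \<odot>\<^bsub>C\<^esub> s \<in> seq_kernel p" if s: "s \<in> seq_kernel p" for c s
  proof -
    have sC: "s \<in> carrier C" and lim: "(\<lambda>n. p (s n)) \<longlonglongrightarrow> 0" using s by (auto simp: seq_kernel_def)
    have "(\<lambda>n. p (c \<odot>\<^bsub>A\<^esub> s n)) \<longlonglongrightarrow> 0"
    proof (rule tendsto_sandwich[of "\<lambda>_. 0"])
      show "(\<lambda>n. cmod c * p (s n)) \<longlonglongrightarrow> 0" using tendsto_mult_left[OF lim] by simp
    qed (use C_closed[OF sC] seminorm_smult[OF p] pos[OF C_smult[OF sC]] in auto)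
    then show ?thesis using C_smult[OF sC] by (simp add: seq_kernel_def)
  qed
  then show "s \<in> seq_kernel p \<Longrightarrow> c \<odot>\<^bsub>C\<^esub> s \<in> seq_kernel p" .
  show "ideal (seq_kernel p) C"
  proof (rule ideal_of_subspace[OF ring_C module_C sub _ _ smult])
    show "\<zero>\<^bsub>C\<^esub> \<in> seq_kernel p" using C_const seminorm_zero[OF p] by (simp add: seq_kernel_def)
  next
    fix s t assume st: "s \<in> seq_kernel p" "t \<in> seq_kernel p"
    then have cl: "s \<in> carrier C" "t \<in> carrier C" using sub by auto
    have "(\<lambda>n. p (s n \<oplus>\<^bsub>A\<^esub> t n)) \<longlonglongrightarrow> 0"
    proof (rule tendsto_sandwich[of "\<lambda>_. 0"])
      show "(\<lambda>n. p (s n) + p (t n)) \<longlonglongrightarrow> 0"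
        using st tendsto_add[of "\<lambda>n. p (s n)" 0 sequentially "\<lambda>n. p (t n)" 0] by (simp add: seq_kernel_def)
    qed (use C_closed cl seminorm_add[OF p] pos[OF C_add[OF cl]] in auto)
    then show "s \<oplus>\<^bsub>C\<^esub> t \<in> seq_kernel p" using C_add[OF cl] by (simp add: seq_kernel_def)
  next
    fix s t assume s: "s \<in> carrier C" and t: "t \<in> seq_kernel p"
    then have tC: "t \<in> carrier C" and lim: "(\<lambda>n. p (t n)) \<longlonglongrightarrow> 0" by (auto simp: seq_kernel_def)
    obtain K where K: "K > 0" "\<And>n. N (s n) \<le> K" using C_bounded[OF s] by blast
    have pK: "p (s n) \<le> K" for n using pN[OF C_closed[OF s], of n] K(2)[of n] by linarith
    have limK: "(\<lambda>n. K * p (t n)) \<longlonglongrightarrow> 0" using tendsto_mult_left[OF lim] by simp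
    have "(\<lambda>n. p (s n \<otimes>\<^bsub>A\<^esub> t n)) \<longlonglongrightarrow> 0"
    proof (rule tendsto_sandwich[OF _ _ tendsto_const limK])
      have "p (s n \<otimes>\<^bsub>A\<^esub> t n) \<le> K * p (t n)" for n
        using seminorm_mult[OF p C_closed[OF s] C_closed[OF tC], of n n]
          mult_right_mono[OF pK[of n] pos[OF tC, of n]] by linarith
      then show "\<forall>\<^sub>F n in sequentially. p (s n \<otimes>\<^bsub>A\<^esub> t n) \<le> K * p (t n)" by simp
    qed (use pos[OF C_mult[OF s tC]] in simp)
    moreover have "(\<lambda>n. p (t n \<otimes>\<^bsub>A\<^esub> s n)) \<longlonglongrightarrow> 0"
    proof (rule tendsto_sandwich[OF _ _ tendsto_const limK])
      have "p (t n \<otimes>\<^bsub>A\<^esub> s n) \<le> K * p (t n)" for n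
        using seminorm_mult[OF p C_closed[OF tC] C_closed[OF s], of n n]
          mult_right_mono[OF pK[of n] pos[OF tC, of n]] by (simp add: mult.commute)
      then show "\<forall>\<^sub>F n in sequentially. p (t n \<otimes>\<^bsub>A\<^esub> s n) \<le> K * p (t n)" by simp
    qed (use pos[OF C_mult[OF tC s]] in simp)
    ultimately show "s \<otimes>\<^bsub>C\<^esub> t \<in> seq_kernel p \<and> t \<otimes>\<^bsub>C\<^esub> s \<in> seq_kernel p"
      using C_mult[OF s tC] C_mult[OF tC s] by (simp add: seq_kernel_def)
  qed
qed

lemmas ideal_null = ideal_seq_kernel[OF seminorm order_refl, folded null_sequences_eq]
  and null_smult = seq_kernel_smult[OF seminorm order_refl, folded null_sequences_eq]

abbreviation cls :: "(nat \<Rightarrow> 'a) \<Rightarrow> (nat \<Rightarrow> 'a) set" where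
  "cls s \<equiv> null_sequences A +>\<^bsub>C\<^esub> s"

text \<open>\<open>completion A\<close> is the quotient of \<open>C\<close> with a norm field added,
  so every computation in it becomes one with representing Cauchy sequences.\<close>

lemma B_simps:
  "carrier B = cls ` carrier C" "\<zero>\<^bsub>B\<^esub> = cls \<zero>\<^bsub>C\<^esub>" "\<one>\<^bsub>B\<^esub> = cls \<one>\<^bsub>C\<^esub>"
  "s \<in> carrier C \<Longrightarrow> t \<in> carrier C \<Longrightarrow> cls s \<oplus>\<^bsub>B\<^esub> cls t = cls (s \<oplus>\<^bsub>C\<^esub> t)"
  "s \<in> carrier C \<Longrightarrow> t \<in> carrier C \<Longrightarrow> cls s \<otimes>\<^bsub>B\<^esub> cls t = cls (s \<otimes>\<^bsub>C\<^esub> t)"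
  "s \<in> carrier C \<Longrightarrow> c \<odot>\<^bsub>B\<^esub> cls s = cls (c \<odot>\<^bsub>C\<^esub> s)"
proof -
  let ?Q = "quotient_star_algebra C (null_sequences A)"
  note q = quotient_map[OF ideal_null]
  have B: "carrier B = carrier ?Q" "\<zero>\<^bsub>B\<^esub> = \<zero>\<^bsub>?Q\<^esub>" "\<one>\<^bsub>B\<^esub> = \<one>\<^bsub>?Q\<^esub>" "add B = add ?Q" "monoid.mult B = monoid.mult ?Q"
    "smult B = smult ?Q"
    by (simp_all add: completion_def star_algebra.defs normed_star_algebra.defs)
  show "carrier B = cls ` carrier C" "\<zero>\<^bsub>B\<^esub> = cls \<zero>\<^bsub>C\<^esub>" "\<one>\<^bsub>B\<^esub> = cls \<one>\<^bsub>C\<^esub>"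
    unfolding B using q(3,4) ring_hom_one[OF q(2)] by simp_all
  show "s \<in> carrier C \<Longrightarrow> t \<in> carrier C \<Longrightarrow> cls s \<oplus>\<^bsub>B\<^esub> cls t = cls (s \<oplus>\<^bsub>C\<^esub> t)"
    "s \<in> carrier C \<Longrightarrow> t \<in> carrier C \<Longrightarrow> cls s \<otimes>\<^bsub>B\<^esub> cls t = cls (s \<otimes>\<^bsub>C\<^esub> t)"
    unfolding B by (simp_all only: ring_hom_add[OF q(2)] ring_hom_mult[OF q(2)])
  show "s \<in> carrier C \<Longrightarrow> c \<odot>\<^bsub>B\<^esub> cls s = cls (c \<odot>\<^bsub>C\<^esub> s)"
    unfolding B by (rule quotient_smult[OF module_C ideal_null null_smult])
qed

lemma ring_B: "ring B"
  by (rule ring_surj_image[OF ring_C, of cls]) (auto simp: Ring.ring_hom_def B_simps simp del: C_simps)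

lemma module_B: "Module.module (class_ring :: complex ring) B"
  by (rule module_surj_image[OF module_C, of cls])
    (auto simp: LinearCombinations.module_hom_def B_simps simp del: C_simps)

end

lemma (in normed_algebra) cls_eq_iff:
  assumes s: "s \<in> carrier C" and t: "t \<in> carrier C"
  shows "cls s = cls t \<longleftrightarrow> (\<lambda>n. N (s n \<ominus>\<^bsub>A\<^esub> t n)) \<longlonglongrightarrow> 0"
proof -
  have "s \<ominus>\<^bsub>C\<^esub> t \<in> carrier C"
    by (rule abelian_group.minus_closed[OF ring.is_abelian_group[OF ring_C] s t])
  then show ?thesis
    using coset_eq_iff[OF ideal_null s t] by (simp add: null_sequences_eq seq_kernel_def C_minus[OF s t])
qed

text \<open>The norm of the completion is defined through a chosen representative. Any other differs
  from it by a null sequence, so by the reverse triangle inequality its norms have the same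
  limit.\<close>

lemma (in normed_algebra) norm_cls:
  assumes s: "s \<in> carrier C"
  shows "(\<lambda>n. N (s n)) \<longlonglongrightarrow> algebra_norm B (cls s)"
proof -
  interpret null: ideal "null_sequences A" C by (rule ideal_null)
  define t where "t = (SOME t. t \<in> cls s)"
  have "s \<in> cls s" using s by (rule null.a_rcos_self)
  then have t: "t \<in> cls s" unfolding t_def by (rule someI[of "\<lambda>t. t \<in> cls s"])
  then have tC: "t \<in> carrier C" using s null.a_subset null.a_r_coset_subset_G by blast
  have "cls s = cls t" by (rule null.a_repr_independence[OF t s null.a_subgroup])
  then have lim: "(\<lambda>n. N (s n \<ominus>\<^bsub>A\<^esub> t n)) \<longlonglongrightarrow> 0" using cls_eq_iff[OF s tC] by simp
  have "(\<lambda>n. N (s n) - N (t n)) \<longlonglongrightarrow> 0"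
    by (rule Lim_null_comparison[OF _ lim])
      (use seminorm_diff[OF seminorm C_closed[OF s] C_closed[OF tC]] in simp)
  moreover have "(\<lambda>n. N (t n)) \<longlonglongrightarrow> lim (\<lambda>n. N (t n))"
    using C_norm_convergent[OF tC] by (simp add: convergent_LIMSEQ_iff)
  ultimately have "(\<lambda>n. (N (s n) - N (t n)) + N (t n)) \<longlonglongrightarrow> 0 + lim (\<lambda>n. N (t n))"
    by (rule tendsto_add)
  then show ?thesis
    by (simp add: completion_def star_algebra.defs normed_star_algebra.defs t_def)
qed

section \<open>Closed ideals and functionals from a dominated seminorm\<close>

locale normed_algebra_seminorm = normed_algebra +
  fixes p
  assumes p: "algebra_seminorm A p" and p_le: "\<And>x. x \<in> carrier A \<Longrightarrow> p x \<le> N x"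
begin

text \<open>The zero set of the continuous extension of \<open>p\<close> to the completion, given by
  representatives instead of that extension.\<close>

definition kernel_ideal :: "(nat \<Rightarrow> 'a) set set" where
  "kernel_ideal = cls ` seq_kernel p"

text \<open>Changing the representative changes it by a null sequence for \<open>N\<close>, which is
  one for \<open>p\<close> as well; so any representative decides membership.\<close>

lemma cls_kernel_iff:
  assumes s: "s \<in> carrier C"
  shows "cls s \<in> kernel_ideal \<longleftrightarrow> (\<lambda>n. p (s n)) \<longlonglongrightarrow> 0"
proof
  assume "cls s \<in> kernel_ideal"
  then obtain t where t: "t \<in> carrier C" "(\<lambda>n. p (t n)) \<longlonglongrightarrow> 0" and "cls s = cls t"
    by (auto simp: kernel_ideal_def seq_kernel_def)
  then have lim: "(\<lambda>n. N (s n \<ominus>\<^bsub>A\<^esub> t n)) \<longlonglongrightarrow> 0" using cls_eq_iff[OF s t(1)] by simp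
  have sum: "(\<lambda>n. N (s n \<ominus>\<^bsub>A\<^esub> t n) + p (t n)) \<longlonglongrightarrow> 0" using tendsto_add[OF lim t(2)] by simp
  have "norm (p (s n)) \<le> N (s n \<ominus>\<^bsub>A\<^esub> t n) + p (t n)" for n
    using seminorm_diff[OF p C_closed[OF s] C_closed[OF t(1)], of n n] seminorm_nonneg[OF p C_closed[OF s], of n]
      p_le[of "s n \<ominus>\<^bsub>A\<^esub> t n"] C_closed[OF s, of n] C_closed[OF t(1), of n] by simp
  then show "(\<lambda>n. p (s n)) \<longlonglongrightarrow> 0" using sum by (rule Lim_null_comparison[OF always_eventually, rule_format])
qed (use s in \<open>auto simp: kernel_ideal_def seq_kernel_def\<close>)

lemma kernel_ideal_cases:
  assumes "X \<in> kernel_ideal"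
  obtains s where "s \<in> carrier C" "X = cls s" "s \<in> seq_kernel p"
  using assms by (auto simp: kernel_ideal_def seq_kernel_def)

lemma ideal_kernel: "ideal kernel_ideal B"
  and kernel_smult: "X \<in> kernel_ideal \<Longrightarrow> c \<odot>\<^bsub>B\<^esub> X \<in> kernel_ideal"
proof -
  interpret J: ideal "seq_kernel p" C by (rule ideal_seq_kernel[OF p p_le])
  have smult: "c \<odot>\<^bsub>B\<^esub> X \<in> kernel_ideal" if "X \<in> kernel_ideal" for c X
    using that
  proof (rule kernel_ideal_cases)
    fix s assume "s \<in> carrier C" "X = cls s" "s \<in> seq_kernel p"
    then show "c \<odot>\<^bsub>B\<^esub> X \<in> kernel_ideal"
      using seq_kernel_smult[OF p p_le, of s c] unfolding kernel_ideal_def by (simp add: B_simps del: C_simps)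
  qed
  then show "X \<in> kernel_ideal \<Longrightarrow> c \<odot>\<^bsub>B\<^esub> X \<in> kernel_ideal" .
  show "ideal kernel_ideal B"
  proof (rule ideal_of_subspace[OF ring_B module_B _ _ _ smult])
    show "kernel_ideal \<subseteq> carrier B" using J.a_subset by (auto simp: kernel_ideal_def B_simps simp del: C_simps)
    show "\<zero>\<^bsub>B\<^esub> \<in> kernel_ideal" using J.zero_closed by (simp add: kernel_ideal_def B_simps del: C_simps)
  next
    fix X Y assume X: "X \<in> kernel_ideal" and Y: "Y \<in> kernel_ideal"
    obtain s where s: "s \<in> carrier C" "X = cls s" "s \<in> seq_kernel p" using X by (rule kernel_ideal_cases)
    obtain t where t: "t \<in> carrier C" "Y = cls t" "t \<in> seq_kernel p" using Y by (rule kernel_ideal_cases)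
    show "X \<oplus>\<^bsub>B\<^esub> Y \<in> kernel_ideal"
      using additive_subgroup.a_closed[OF J.additive_subgroup_axioms s(3) t(3)] s t by (simp add: kernel_ideal_def B_simps del: C_simps)
  next
    fix X Y assume X: "X \<in> carrier B" and Y: "Y \<in> kernel_ideal"
    obtain s where s: "s \<in> carrier C" "X = cls s" using X by (auto simp: B_simps)
    obtain t where t: "t \<in> carrier C" "Y = cls t" "t \<in> seq_kernel p" using Y by (rule kernel_ideal_cases)
    show "X \<otimes>\<^bsub>B\<^esub> Y \<in> kernel_ideal \<and> Y \<otimes>\<^bsub>B\<^esub> X \<in> kernel_ideal"
      using J.I_l_closed[OF t(3) s(1)] J.I_r_closed[OF t(3) s(1)] s t
      by (simp add: kernel_ideal_def B_simps del: C_simps)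
  qed
qed

lemma B_minus:
  assumes s: "s \<in> carrier C" and t: "t \<in> carrier C"
  shows "cls s \<ominus>\<^bsub>B\<^esub> cls t = cls (\<lambda>n. s n \<ominus>\<^bsub>A\<^esub> t n)"
proof -
  have "cls t \<in> carrier B" using t by (simp add: B_simps)
  then have "\<ominus>\<^bsub>B\<^esub> cls t = cls (\<lambda>n. \<ominus>\<^bsub>A\<^esub> t n)"
    using module_minus_eq_smult[OF module_B] B_simps(6)[OF t, of "- 1"]
      module_minus_eq_smult[OF module C_closed[OF t]] by simp
  then show ?thesis using B_simps(4)[OF s C_neg[OF t]] by (simp add: a_minus_def)
qed

text \<open>If a representative s of a member of the ideal comes close to t in the completion, then
  p(t_n) \<le> p(s_n) + N(s_n - t_n), where the first term tends to 0 and the second is eventually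
  below e / 2. Hence p(t_n) tends to 0.\<close>

lemma closed_kernel_ideal: "closed_ideal B kernel_ideal"
  unfolding closed_ideal_def
proof (intro conjI allI ballI impI)
  show "ideal kernel_ideal B" by (rule ideal_kernel)
  show "\<And>c X. X \<in> kernel_ideal \<Longrightarrow> c \<odot>\<^bsub>B\<^esub> X \<in> kernel_ideal" by (rule kernel_smult)
  fix S X assume X: "X \<in> carrier B"
    and S: "(\<forall>n. S n \<in> kernel_ideal) \<and> (\<lambda>n. algebra_norm B (S n \<ominus>\<^bsub>B\<^esub> X)) \<longlonglongrightarrow> 0"
  obtain t where t: "t \<in> carrier C" "X = cls t" using X by (auto simp: B_simps)
  have "(\<lambda>n. p (t n)) \<longlonglongrightarrow> 0"
  proof (rule LIMSEQ_I)
    fix e :: real assume e: "e > 0"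
    have "\<forall>\<^sub>F k in sequentially. algebra_norm B (S k \<ominus>\<^bsub>B\<^esub> X) < e / 2"
      using S e by (intro order_tendstoD(2)) auto
    then obtain k where k: "algebra_norm B (S k \<ominus>\<^bsub>B\<^esub> X) < e / 2"
      by (auto simp: eventually_sequentially)
    have "S k \<in> kernel_ideal" using S by simp
    then obtain s where s: "s \<in> carrier C" "S k = cls s" "s \<in> seq_kernel p" by (rule kernel_ideal_cases)
    have "s \<ominus>\<^bsub>C\<^esub> t \<in> carrier C"
      by (rule abelian_group.minus_closed[OF ring.is_abelian_group[OF ring_C] s(1) t(1)])
    then have "(\<lambda>n. N (s n \<ominus>\<^bsub>A\<^esub> t n)) \<longlonglongrightarrow> algebra_norm B (cls (\<lambda>n. s n \<ominus>\<^bsub>A\<^esub> t n))"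
      unfolding C_minus[OF s(1) t(1)] by (rule norm_cls)
    then have "\<forall>\<^sub>F n in sequentially. N (s n \<ominus>\<^bsub>A\<^esub> t n) < e / 2"
      using k by (intro order_tendstoD(2)) (auto simp: s(2) t(2) B_minus[OF s(1) t(1)])
    moreover have "\<forall>\<^sub>F n in sequentially. p (s n) < e / 2"
      using s(3) e by (intro order_tendstoD(2)) (auto simp: seq_kernel_def)
    ultimately have "\<forall>\<^sub>F n in sequentially. norm (p (t n) - 0) < e"
    proof eventually_elim
      case (elim n)
      then show ?case
        using seminorm_diff[OF p C_closed[OF s(1)] C_closed[OF t(1)], of n n] seminorm_nonneg[OF p C_closed[OF t(1)], of n]
          p_le[of "s n \<ominus>\<^bsub>A\<^esub> t n"] C_closed[OF s(1), of n] C_closed[OF t(1), of n] by simp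
    qed
    then show "\<exists>M. \<forall>n\<ge>M. norm (p (t n) - 0) < e" by (simp add: eventually_sequentially)
  qed
  then show "X \<in> kernel_ideal" using cls_kernel_iff[OF t(1)] t(2) by simp
qed

text \<open>A functional bounded by \<open>p\<close> maps Cauchy sequences to Cauchy sequences, so
  it extends to \<open>C\<close> by limits. The extension vanishes on \<open>seq_kernel p\<close>,
  which contains the null sequences, and therefore descends first to the completion and then to the
  quotient.\<close>

lemma quotient_kernel_functional:
  assumes l: "linear_functional A l" and bound: "\<And>x. x \<in> carrier A \<Longrightarrow> cmod (l x) \<le> K * p x"
  shows "\<exists>l'. linear_functional (quotient_star_algebra B kernel_ideal) l' \<and>
    (\<forall>x\<in>carrier A. l' (kernel_ideal +>\<^bsub>B\<^esub> cls (\<lambda>n. x)) = l x)"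
proof -
  have conv: "convergent (\<lambda>n. l (s n))" if s: "s \<in> carrier C" for s
  proof -
    have "Cauchy (\<lambda>n. l (s n))"
    proof (rule metric_CauchyI)
      fix e :: real assume e: "e > 0"
      \<comment> \<open>\<open>K\<close> is any real number here, so its absolute value plus 1
        serves as a positive bound.\<close>
      have "e / (\<bar>K\<bar> + 1) > 0" using e by (simp add: add_nonneg_pos)
      with s obtain M where M: "\<And>i j. i \<ge> M \<Longrightarrow> j \<ge> M \<Longrightarrow> N (s i \<ominus>\<^bsub>A\<^esub> s j) < e / (\<bar>K\<bar> + 1)"
        by (rule C_cauchy) blast
      have "dist (l (s i)) (l (s j)) < e" if "i \<ge> M" "j \<ge> M" for i j
      proof -
        let ?d = "s i \<ominus>\<^bsub>A\<^esub> s j"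
        have d: "?d \<in> carrier A" using C_closed[OF s] by simp
        have "dist (l (s i)) (l (s j)) = cmod (l ?d)"
          using linear_functional_minus[OF module l C_closed[OF s] C_closed[OF s]] by (simp add: dist_norm)
        also have "\<dots> \<le> K * p ?d" by (rule bound[OF d])
        also have "\<dots> \<le> (\<bar>K\<bar> + 1) * N ?d"
          using seminorm_nonneg[OF p d] p_le[OF d] by (intro mult_mono) auto
        also have "\<dots> < (\<bar>K\<bar> + 1) * (e / (\<bar>K\<bar> + 1))"
          by (intro mult_strict_left_mono M that) (simp add: add_nonneg_pos)
        also have "\<dots> = e" by (simp add: add_nonneg_eq_0_iff)
        finally show ?thesis .
      qed
      then show "\<exists>M. \<forall>i\<ge>M. \<forall>j\<ge>M. dist (l (s i)) (l (s j)) < e" by blast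
    qed
    then show ?thesis by (simp add: Cauchy_convergent)
  qed
  define L where "L s = lim (\<lambda>n. l (s n))" for s
  have L: "(\<lambda>n. l (s n)) \<longlonglongrightarrow> L s" if "s \<in> carrier C" for s
    using conv[OF that] by (simp add: L_def convergent_LIMSEQ_iff)
  have lin: "linear_functional C L"
    unfolding linear_functional_def
  proof (intro conjI ballI allI)
    fix s t assume s: "s \<in> carrier C" and t: "t \<in> carrier C"
    have "(\<lambda>n. l ((s \<oplus>\<^bsub>C\<^esub> t) n)) \<longlonglongrightarrow> L s + L t"
      using tendsto_add[OF L[OF s] L[OF t]] l C_closed[OF s] C_closed[OF t]
      by (simp add: linear_functional_def)
    then show "L (s \<oplus>\<^bsub>C\<^esub> t) = L s + L t"
      using L[of "s \<oplus>\<^bsub>C\<^esub> t"] C_add[OF s t] LIMSEQ_unique by auto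
  next
    fix c s assume s: "s \<in> carrier C"
    have "(\<lambda>n. l ((c \<odot>\<^bsub>C\<^esub> s) n)) \<longlonglongrightarrow> c * L s"
      using tendsto_mult_left[OF L[OF s], of c] l C_closed[OF s] by (simp add: linear_functional_def)
    then show "L (c \<odot>\<^bsub>C\<^esub> s) = c * L s"
      using L[of "c \<odot>\<^bsub>C\<^esub> s"] C_smult[OF s] LIMSEQ_unique by auto
  qed
  have L0: "L s = 0" if s: "s \<in> seq_kernel p" for s
  proof -
    have sC: "s \<in> carrier C" and lim: "(\<lambda>n. p (s n)) \<longlonglongrightarrow> 0" using s by (auto simp: seq_kernel_def)
    have "(\<lambda>n. K * p (s n)) \<longlonglongrightarrow> 0" using tendsto_mult_left[OF lim] by simp
    then have "(\<lambda>n. l (s n)) \<longlonglongrightarrow> 0"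
      by (rule Lim_null_comparison[rotated]) (use bound C_closed[OF sC] in simp)
    then show ?thesis using L[OF sC] LIMSEQ_unique by blast
  qed
  have null_le: "null_sequences A \<subseteq> seq_kernel p"
  proof
    fix s assume "s \<in> null_sequences A"
    then have sC: "s \<in> carrier C" and lim: "(\<lambda>n. N (s n)) \<longlonglongrightarrow> 0" by (auto simp: null_sequences_def)
    have "(\<lambda>n. p (s n)) \<longlonglongrightarrow> 0"
      by (rule Lim_null_comparison[OF _ lim])
        (use seminorm_nonneg[OF p C_closed[OF sC]] p_le[OF C_closed[OF sC]] in simp)
    then show "s \<in> seq_kernel p" using sC by (simp add: seq_kernel_def)
  qed
  obtain L1 where L1: "linear_functional (quotient_star_algebra C (null_sequences A)) L1"
    "\<And>s. s \<in> carrier C \<Longrightarrow> L1 (cls s) = L s"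
    using quotient_functional[OF module_C ideal_null null_smult lin L0] null_le by blast
  \<comment> \<open>The completion and the quotient of \<open>C\<close> have the same carrier,
    addition and scalar multiplication, and \<open>linear_functional\<close> refers to nothing
    else.\<close>
  have L1B: "linear_functional B L1"
    using L1(1) unfolding linear_functional_def
    by (simp add: completion_def star_algebra.defs normed_star_algebra.defs)
  have "L1 X = 0" if X: "X \<in> kernel_ideal" for X
    using X by (rule kernel_ideal_cases) (simp add: L1(2) L0)
  then obtain L2 where L2: "linear_functional (quotient_star_algebra B kernel_ideal) L2"
    "\<And>X. X \<in> carrier B \<Longrightarrow> L2 (kernel_ideal +>\<^bsub>B\<^esub> X) = L1 X"
    using quotient_functional[OF module_B ideal_kernel kernel_smult L1B] by blast
  have "L2 (kernel_ideal +>\<^bsub>B\<^esub> cls (\<lambda>n. x)) = l x" if x: "x \<in> carrier A" for x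
    using L2(2)[of "cls (\<lambda>n. x)"] L1(2)[OF C_const[OF x]] C_const[OF x] L[OF C_const[OF x]]
      LIMSEQ_unique[OF _ tendsto_const] by (auto simp: B_simps)
  with L2(1) show ?thesis by blast
qed

text \<open>The constant sequence \<open>z\<close> puts a non-zero class into
  \<open>kernel_ideal\<close>. The dual systems survive in the quotient: the classes of the constant
  sequences \<open>b i\<close> stay dual to the descended functionals.\<close>

lemma not_just_infinite_completion:
  assumes z: "z \<in> carrier A" "p z = 0" "N z \<noteq> 0"
    and sys: "\<And>n. \<exists>(I :: 'i set) b l K. finite I \<and> card I \<ge> n \<and> (\<forall>i\<in>I. b i \<in> carrier A) \<and>
       (\<forall>i\<in>I. linear_functional A (l i) \<and> (\<forall>x\<in>carrier A. cmod (l i x) \<le> K * p x) \<and>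
         (\<forall>j\<in>I. l i (b j) = (if i = j then 1 else 0)))"
  shows "\<not> just_infinite B"
proof -
  let ?Q = "quotient_star_algebra B kernel_ideal"
  have "cls (\<lambda>n. z) \<in> kernel_ideal" using cls_kernel_iff[OF C_const[OF z(1)]] z(2) by simp
  moreover have "cls (\<lambda>n. z) \<noteq> \<zero>\<^bsub>B\<^esub>"
  proof
    assume "cls (\<lambda>n. z) = \<zero>\<^bsub>B\<^esub>"
    then have "(\<lambda>n. N (z \<ominus>\<^bsub>A\<^esub> \<zero>\<^bsub>A\<^esub>)) \<longlonglongrightarrow> 0"
      using cls_eq_iff[OF C_const[OF z(1)] C_const[OF ring.ring_simprules(2)[OF ring]]] by (simp add: B_simps)
    then have "N z = 0" using z(1) by (simp add: a_minus_def LIMSEQ_const_iff)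
    then show False using z(3) by simp
  qed
  ultimately have ne: "kernel_ideal \<noteq> {\<zero>\<^bsub>B\<^esub>}" by auto
  have "\<not> finite_dimensional ?Q"
  proof (rule not_finite_dimensional[where 'i = 'i])
    show "Module.module (class_ring :: complex ring) ?Q"
      by (rule module_quotient[OF module_B ideal_kernel kernel_smult])
    fix n
    obtain I :: "'i set" and b l K where I: "finite I \<and> card I \<ge> n \<and> (\<forall>i\<in>I. b i \<in> carrier A) \<and>
       (\<forall>i\<in>I. linear_functional A (l i) \<and> (\<forall>x\<in>carrier A. cmod (l i x) \<le> K * p x) \<and>
         (\<forall>j\<in>I. l i (b j) = (if i = j then 1 else 0)))"
      using sys[of n] by (elim exE)
    then have b: "\<And>i. i \<in> I \<Longrightarrow> b i \<in> carrier A"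
      and l: "\<And>i. i \<in> I \<Longrightarrow> linear_functional A (l i)"
        "\<And>i x. i \<in> I \<Longrightarrow> x \<in> carrier A \<Longrightarrow> cmod (l i x) \<le> K * p x"
        "\<And>i j. i \<in> I \<Longrightarrow> j \<in> I \<Longrightarrow> l i (b j) = (if i = j then 1 else 0)"
      by simp_all
    have "\<forall>i\<in>I. \<exists>l'. linear_functional ?Q l' \<and> (\<forall>x\<in>carrier A. l' (kernel_ideal +>\<^bsub>B\<^esub> cls (\<lambda>n. x)) = l i x)"
      using quotient_kernel_functional[OF l(1,2)] by blast
    then obtain l' where l': "\<And>i. i \<in> I \<Longrightarrow> linear_functional ?Q (l' i)"
      "\<And>i x. i \<in> I \<Longrightarrow> x \<in> carrier A \<Longrightarrow> l' i (kernel_ideal +>\<^bsub>B\<^esub> cls (\<lambda>n. x)) = l i x"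
      by metis
    have "kernel_ideal +>\<^bsub>B\<^esub> cls (\<lambda>n. b i) \<in> carrier ?Q" if "i \<in> I" for i
      using b[OF that] C_const unfolding quotient_map(3)[OF ideal_kernel, symmetric] B_simps by blast
    then show "\<exists>(I :: 'i set) b l. finite I \<and> n \<le> card I \<and> (\<forall>i\<in>I. b i \<in> carrier ?Q) \<and>
        (\<forall>i\<in>I. linear_functional ?Q (l i) \<and> (\<forall>j\<in>I. l i (b j) = (if i = j then 1 else 0)))"
      using I b l' l(3)
      by (intro exI[of _ I] exI[of _ "\<lambda>i. kernel_ideal +>\<^bsub>B\<^esub> cls (\<lambda>n. b i)"] exI[of _ l']) simp
  qed
  then show ?thesis using closed_kernel_ideal ne unfolding just_infinite_def by blast
qed

end

section \<open>The maximal C*-norm\<close>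

context group
begin

text \<open>Group elements are unitary. The C*-identity at the unit gives
  \<open>N ?e = (N ?e)\<^sup>2\<close>, hence \<open>N ?e \<le> 1\<close>, and at the group element
  it gives \<open>(N ?d)\<^sup>2 = N ?e\<close>.\<close>

lemma cstar_norm_single_le:
  assumes N: "cstar_norm (group_algebra G) N" and g: "g \<in> carrier G"
  shows "N (\<lambda>x. if x = g then 1 else 0) \<le> 1"
proof -
  let ?d = "\<lambda>x. if x = g then 1 else 0 :: complex" and ?e = "\<lambda>x. if x = \<one> then 1 else 0 :: complex"
  have cl: "?d \<in> carrier (group_algebra G)" "?e \<in> carrier (group_algebra G)" using g by simp_all
  have supp: "{y. (if y = inv g then 1 else 0 :: complex) \<noteq> 0} = {inv g}" "{y. ?e y \<noteq> 0} = {\<one>}" by auto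
  have star: "star (group_algebra G) ?d = (\<lambda>x. if x = inv g then 1 else 0)"
    "star (group_algebra G) ?e = ?e"
    using g by (auto simp: group_algebra_star fun_eq_iff)
  have "star (group_algebra G) ?d \<otimes>\<^bsub>group_algebra G\<^esub> ?d = ?e"
    unfolding star group_algebra_mult supp using g by (auto simp: fun_eq_iff)
  moreover have "star (group_algebra G) ?e \<otimes>\<^bsub>group_algebra G\<^esub> ?e = ?e"
    unfolding star group_algebra_mult supp by (auto simp: fun_eq_iff)
  ultimately have *: "N ?e = (N ?d)\<^sup>2" "N ?e = (N ?e)\<^sup>2" "0 \<le> N ?d" "0 \<le> N ?e"
    using N cl unfolding cstar_norm_def by metis+
  have "a \<le> 1" if "a = a\<^sup>2" for a :: real
    using that by (auto simp: power2_eq_square)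
  then have "N ?e \<le> 1" using *(2) .
  with *(1) have "(N ?d)\<^sup>2 \<le> 1\<^sup>2" by simp
  then show ?thesis by (rule power2_le_imp_le) simp
qed

text \<open>The bound is uniform in \<open>N\<close>, which is what makes the real supremum in
  \<open>max_cstar_norm\<close> an upper bound of all C*-norms.\<close>

lemma cstar_norm_le_l1:
  assumes N: "cstar_norm (group_algebra G) N" and f: "f \<in> carrier (group_algebra G)"
  shows "N f \<le> (\<Sum>y | f y \<noteq> 0. cmod (f y))"
proof -
  \<comment> \<open>The induction is over a finite set containing the support, for all
    \<open>f\<close> at once, because splitting off the value at one point changes
    \<open>f\<close>.\<close>
  have "N f \<le> (\<Sum>y\<in>S. cmod (f y))"
    if "finite S" "S \<subseteq> carrier G" "f \<in> carrier (group_algebra G)" "{y. f y \<noteq> 0} \<subseteq> S" for S f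
    using that
  proof (induction S arbitrary: f rule: finite_induct)
    case empty
    then have "f = (\<lambda>x. 0)" by auto
    moreover have "N (\<lambda>x. 0) = 0"
      using N group_algebra_closed(1)[of G] unfolding cstar_norm_def group_algebra_simps by blast
    ultimately show ?case by simp
  next
    case (insert g S)
    let ?d = "\<lambda>x. if x = g then 1 else 0 :: complex"
    let ?h = "\<lambda>x. if x = g then 0 else f x"
    have g: "g \<in> carrier G" using insert by simp
    have d: "?d \<in> carrier (group_algebra G)" using g by simp
    have "{x. ?h x \<noteq> 0} \<subseteq> {x. f x \<noteq> 0}" by auto
    then have h: "?h \<in> carrier (group_algebra G)" "{y. ?h y \<noteq> 0} \<subseteq> S"
      using insert.prems unfolding group_algebra_carrier by (auto intro: finite_subset)
    have "f = ?h \<oplus>\<^bsub>group_algebra G\<^esub> (f g \<odot>\<^bsub>group_algebra G\<^esub> ?d)" by auto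
    then have "N f = N (?h \<oplus>\<^bsub>group_algebra G\<^esub> (f g \<odot>\<^bsub>group_algebra G\<^esub> ?d))" by simp
    also have "\<dots> \<le> N ?h + N (f g \<odot>\<^bsub>group_algebra G\<^esub> ?d)"
    proof -
      have "f g \<odot>\<^bsub>group_algebra G\<^esub> ?d \<in> carrier (group_algebra G)"
        unfolding group_algebra_simps by (rule group_algebra_closed(3)[OF d])
      then show ?thesis using N h(1) unfolding cstar_norm_def by blast
    qed
    also have "N (f g \<odot>\<^bsub>group_algebra G\<^esub> ?d) = cmod (f g) * N ?d"
      using N d unfolding cstar_norm_def by blast
    also have "\<dots> \<le> cmod (f g) * 1"
      by (rule mult_left_mono[OF cstar_norm_single_le[OF N g]]) simp
    also have "N ?h \<le> (\<Sum>y\<in>S. cmod (?h y))" using insert h by blast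
    also have "(\<Sum>y\<in>S. cmod (?h y)) = (\<Sum>y\<in>S. cmod (f y))"
      using insert.hyps by (intro sum.cong) auto
    finally show ?case using insert.hyps by simp
  qed
  from this[OF _ _ f order_refl] f show ?thesis by (simp add: group_algebra_carrier)
qed

definition reduced_norm :: "('a \<Rightarrow> complex) \<Rightarrow> real" where
  "reduced_norm = (\<lambda>f. onorm (permutation_action.rep G left_mult f))"

lemma cstar_seminorm_reduced_norm: "cstar_seminorm (group_algebra G) reduced_norm"
  unfolding reduced_norm_def
  by (rule permutation_action.cstar_seminorm_opnorm[OF permutation_action_left_mult])

text \<open>Only definite norms enter the supremum in \<open>max_cstar_norm\<close>. The faithful
  reduced norm supplies definiteness, so any C*-seminorm lies below a member of that family.\<close>

lemma cstar_norm_max_reduced: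
  assumes p: "cstar_seminorm (group_algebra G) p"
  shows "cstar_norm (group_algebra G) (\<lambda>f. max (p f) (reduced_norm f))"
proof -
  note r = cstar_seminorm_reduced_norm
  have m: "cstar_seminorm (group_algebra G) (\<lambda>f. max (p f) (reduced_norm f))"
    by (rule cstar_seminorm_max[OF p r])
  have "max (p f) (reduced_norm f) = 0 \<longleftrightarrow> f = (\<lambda>x. 0)" if f: "f \<in> carrier (group_algebra G)" for f
  proof
    assume 0: "max (p f) (reduced_norm f) = 0"
    have "0 \<le> reduced_norm f" using r f by (simp add: cstar_seminorm_def)
    with 0 have "reduced_norm f = 0" by linarith
    then show "f = (\<lambda>x. 0)" unfolding reduced_norm_def by (rule left_mult_opnorm_eq_0[OF f])
  next
    assume "f = (\<lambda>x. 0)"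
    then have "f = 0 \<odot>\<^bsub>group_algebra G\<^esub> f" by simp
    then show "max (p f) (reduced_norm f) = 0"
      using m f unfolding cstar_seminorm_def by (metis mult_zero_left norm_zero)
  qed
  then show ?thesis using m unfolding cstar_norm_def cstar_seminorm_def by simp
qed

lemma cstar_norm_le_max_cstar_norm:
  assumes N: "cstar_norm (group_algebra G) N" and f: "f \<in> carrier (group_algebra G)"
  shows "N f \<le> max_cstar_norm (group_algebra G) f"
  unfolding max_cstar_norm_def
  using N cstar_norm_le_l1[OF _ f] by (intro cSUP_upper bdd_aboveI2) auto

lemma max_cstar_norm_le:
  assumes "\<And>N. cstar_norm (group_algebra G) N \<Longrightarrow> N f \<le> K"
  shows "max_cstar_norm (group_algebra G) f \<le> K"
proof -
  \<comment> \<open>A member of the family of norms: a supremum of reals is a least upper bound only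
    over a nonempty set.\<close>
  have "cstar_norm (group_algebra G) (\<lambda>f. max (reduced_norm f) (reduced_norm f))"
    by (rule cstar_norm_max_reduced[OF cstar_seminorm_reduced_norm])
  then show ?thesis unfolding max_cstar_norm_def using assms by (intro cSUP_least) auto
qed

lemma cstar_seminorm_le_max_cstar_norm:
  assumes p: "cstar_seminorm (group_algebra G) p" and f: "f \<in> carrier (group_algebra G)"
  shows "p f \<le> max_cstar_norm (group_algebra G) f"
  using cstar_norm_le_max_cstar_norm[OF cstar_norm_max_reduced[OF p] f] by simp

lemma max_cstar_norm_pos:
  assumes f: "f \<in> carrier (group_algebra G)" "f \<noteq> (\<lambda>x. 0)"
  shows "max_cstar_norm (group_algebra G) f > 0"
proof -
  note r = cstar_seminorm_reduced_norm
  have "reduced_norm f \<noteq> 0" using left_mult_opnorm_eq_0[OF f(1)] f(2) by (auto simp: reduced_norm_def)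
  moreover have "0 \<le> reduced_norm f" using r f by (simp add: cstar_seminorm_def)
  ultimately show ?thesis using cstar_seminorm_le_max_cstar_norm[OF r f(1)] by linarith
qed

lemma algebra_seminorm_max_cstar_norm:
  "algebra_seminorm (group_algebra G) (max_cstar_norm (group_algebra G))"
  unfolding algebra_seminorm_def
proof (intro conjI ballI allI)
  let ?M = "max_cstar_norm (group_algebra G)"
  fix f assume f: "f \<in> carrier (group_algebra G)"
  show pos: "0 \<le> ?M f" if f: "f \<in> carrier (group_algebra G)" for f
  proof -
    note r = cstar_seminorm_reduced_norm
    have "0 \<le> reduced_norm f" using r f by (simp add: cstar_seminorm_def)
    then show ?thesis using cstar_seminorm_le_max_cstar_norm[OF r f] by linarith
  qed
  show "?M (c \<odot>\<^bsub>group_algebra G\<^esub> f) \<le> cmod c * ?M f" for c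
  proof (rule max_cstar_norm_le)
    fix N assume N: "cstar_norm (group_algebra G) N"
    then have "N (c \<odot>\<^bsub>group_algebra G\<^esub> f) = cmod c * N f" using f unfolding cstar_norm_def by blast
    also have "\<dots> \<le> cmod c * ?M f"
      by (intro mult_left_mono cstar_norm_le_max_cstar_norm[OF N f]) simp
    finally show "N (c \<odot>\<^bsub>group_algebra G\<^esub> f) \<le> cmod c * ?M f" .
  qed
  fix h assume h: "h \<in> carrier (group_algebra G)"
  show "?M (f \<oplus>\<^bsub>group_algebra G\<^esub> h) \<le> ?M f + ?M h"
  proof (rule max_cstar_norm_le)
    fix N assume N: "cstar_norm (group_algebra G) N"
    then have "N (f \<oplus>\<^bsub>group_algebra G\<^esub> h) \<le> N f + N h" using f h unfolding cstar_norm_def by blast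
    also have "\<dots> \<le> ?M f + ?M h"
      by (intro add_mono cstar_norm_le_max_cstar_norm[OF N] f h)
    finally show "N (f \<oplus>\<^bsub>group_algebra G\<^esub> h) \<le> ?M f + ?M h" .
  qed
  show "?M (f \<otimes>\<^bsub>group_algebra G\<^esub> h) \<le> ?M f * ?M h"
  proof (rule max_cstar_norm_le)
    fix N assume N: "cstar_norm (group_algebra G) N"
    then have "N (f \<otimes>\<^bsub>group_algebra G\<^esub> h) \<le> N f * N h" "0 \<le> N h" using f h unfolding cstar_norm_def by blast+
    note this(1)
    also have "N f * N h \<le> ?M f * ?M h"
      by (intro mult_mono cstar_norm_le_max_cstar_norm[OF N] f h pos \<open>0 \<le> N h\<close>)
    finally show "N (f \<otimes>\<^bsub>group_algebra G\<^esub> h) \<le> ?M f * ?M h" .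
  qed
qed

end

text \<open>
  The definition of \<open>star_just_infinite\<close> prescribes the type of the Hilbert spaces, so the space
  of square summable functions is transported along an injection \<open>E\<close> into that type. The ring
  operations of the record are irrelevant.
\<close>

definition ell2_hilbert :: "('x ell2 \<Rightarrow> 'h) \<Rightarrow> 'h hilbert" where
  "ell2_hilbert E =
    \<lparr>carrier = range E, mult = undefined, one = undefined, zero = E 0,
     add = (\<lambda>x y. E (inv_into UNIV E x + inv_into UNIV E y)),
     smult = (\<lambda>c x. E (scaleC c (inv_into UNIV E x))),
     inner_prod = (\<lambda>x y. cinner (inv_into UNIV E x) (inv_into UNIV E y))\<rparr>"

locale ell2_embedding =
  fixes E :: "'x ell2 \<Rightarrow> 'h"
  assumes inj: "inj E"
begin

abbreviation "H \<equiv> ell2_hilbert E"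

lemma H_simps [simp]:
  "carrier H = range E" "\<zero>\<^bsub>H\<^esub> = E 0" "E v \<oplus>\<^bsub>H\<^esub> E w = E (v + w)"
  "c \<odot>\<^bsub>H\<^esub> E v = E (scaleC c v)" "inner_prod H (E v) (E w) = cinner v w"
  using inj by (simp_all add: ell2_hilbert_def)

lemma E_eq_iff [simp]: "E v = E w \<longleftrightarrow> v = w"
  using inj by (simp add: inj_eq)

lemma module_H: "Module.module (class_ring :: complex ring) H"
proof (rule moduleI[OF complex_cring])
  show "abelian_group H"
  proof (rule abelian_groupI)
    fix x assume "x \<in> carrier H"
    then obtain v where "x = E v" by auto
    then show "\<exists>y\<in>carrier H. y \<oplus>\<^bsub>H\<^esub> x = \<zero>\<^bsub>H\<^esub>" by (intro bexI[of _ "E (- v)"]) auto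
  qed (auto simp: add_ac)
qed auto

lemma H_minus [simp]: "E v \<ominus>\<^bsub>H\<^esub> E w = E (v - w)"
proof -
  have "\<ominus>\<^bsub>H\<^esub> E w = E (scaleC (- 1) w)"
    using module_minus_eq_smult[OF module_H, of "E w"] by simp
  then have "E v \<ominus>\<^bsub>H\<^esub> E w = E (v + scaleC (- 1) w)" by (simp add: a_minus_def)
  also have "v + scaleC (- 1) w = v - w" by (rule ell2_eqI) simp
  finally show ?thesis .
qed

lemma hilbert_norm_E [simp]: "hilbert_norm H (E v) = norm v"
  by (simp add: hilbert_norm_def cinner_self_norm)

lemma hilbert_space_H: "hilbert_space H"
  unfolding hilbert_space_def
proof (intro conjI allI ballI impI)
  show "vectorspace class_ring H" using module_H class_field by (simp add: vectorspace_def)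
next
  fix s assume s: "(\<forall>n. s n \<in> carrier H) \<and>
    (\<forall>e>0. \<exists>M::nat. \<forall>i\<ge>M. \<forall>j\<ge>M. hilbert_norm H (s i \<ominus>\<^bsub>H\<^esub> s j) < e)"
  then have "\<forall>n. \<exists>v. s n = E v" by auto
  then obtain v where v: "\<And>n. s n = E (v n)" by metis
  have "Cauchy v" using s by (auto simp: v Cauchy_def dist_norm)
  then obtain w where "v \<longlonglongrightarrow> w" using Cauchy_convergent convergent_def by blast
  then have "(\<lambda>n. norm (v n - w)) \<longlonglongrightarrow> 0" by (simp add: LIM_zero tendsto_norm_zero)
  then show "\<exists>x\<in>carrier H. (\<lambda>n. hilbert_norm H (s n \<ominus>\<^bsub>H\<^esub> x)) \<longlonglongrightarrow> 0"
    by (intro bexI[of _ "E w"]) (auto simp: v)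
qed (auto simp: cinner_add cinner_scaleC cinner_self_norm intro: cinner_commute)

text \<open>\<open>T\<close> carried over by \<open>E\<close>, and cut off outside
  \<open>range E\<close> because \<open>bounded_operators\<close> consists of extensional
  functions.\<close>

definition op :: "('x ell2 \<Rightarrow> 'x ell2) \<Rightarrow> 'h \<Rightarrow> 'h" where
  "op T = (\<lambda>x\<in>range E. E (T (inv_into UNIV E x)))"

lemma op_E [simp]: "op T (E v) = E (T v)"
  using inj by (simp add: op_def)

lemma op_cong: "(\<And>v. T v = S v) \<Longrightarrow> op T = op S"
  by (simp add: op_def)

lemma operator_eqI:
  assumes "S \<in> extensional (range E)" "T \<in> extensional (range E)" "\<And>v. S (E v) = T (E v)"
  shows "S = T"
  using assms by (auto intro: extensionalityI)

lemma op_extensional [simp]: "op T \<in> extensional (range E)"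
  by (simp add: op_def)

lemma bounded_operators_op:
  assumes "\<And>v w. T (v + w) = T v + T w" "\<And>c v. T (scaleC c v) = scaleC c (T v)"
    "\<And>v. norm (T v) \<le> K * norm v"
  shows "op T \<in> bounded_operators H"
  using assms by (auto simp: bounded_operators_def LinearCombinations.module_hom_def)

lemma operator_algebra_simps:
  "carrier (operator_algebra H) = bounded_operators H"
  "op S \<otimes>\<^bsub>operator_algebra H\<^esub> op T = op (\<lambda>v. S (T v))"
  "op S \<oplus>\<^bsub>operator_algebra H\<^esub> op T = op (\<lambda>v. S v + T v)"
  "c \<odot>\<^bsub>operator_algebra H\<^esub> op T = op (\<lambda>v. scaleC c (T v))"
  "\<one>\<^bsub>operator_algebra H\<^esub> = op (\<lambda>v. v)" "\<zero>\<^bsub>operator_algebra H\<^esub> = op (\<lambda>v. 0)"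
  by (auto simp: operator_algebra_def compose_def restrict_def fun_eq_iff op_def inv_f_f[OF inj])

text \<open>The involution of \<open>operator_algebra\<close> is a definite description, so
  uniqueness is needed too: another candidate \<open>R\<close> makes the vector
  \<open>u - S w\<close> orthogonal to every vector, in particular to itself.\<close>

lemma star_op:
  assumes S: "op S \<in> bounded_operators H" and adj: "\<And>v w. cinner (T v) w = cinner v (S w)"
  shows "star (operator_algebra H) (op T) = op S"
proof -
  have "(THE S. S \<in> bounded_operators H \<and>
      (\<forall>x\<in>carrier H. \<forall>y\<in>carrier H. inner_prod H (op T x) y = inner_prod H x (S y))) = op S"
  proof (rule the_equality)
    show "op S \<in> bounded_operators H \<and>
        (\<forall>x\<in>carrier H. \<forall>y\<in>carrier H. inner_prod H (op T x) y = inner_prod H x (op S y))"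
      using S adj by auto
  next
    fix R assume R: "R \<in> bounded_operators H \<and>
      (\<forall>x\<in>carrier H. \<forall>y\<in>carrier H. inner_prod H (op T x) y = inner_prod H x (R y))"
    show "R = op S"
    proof (rule operator_eqI)
      fix w
      have "R (E w) \<in> range E" using R by (auto simp: bounded_operators_def LinearCombinations.module_hom_def)
      then obtain u where u: "R (E w) = E u" by auto
      have "cinner v u = cinner v (S w)" for v
        using R adj[of v w] u by (auto dest!: conjunct2 bspec[of _ _ "E v"] bspec[of _ _ "E w"])
      then have "cinner (u - S w) (u - S w) = 0"
        using cinner_add[of "u - S w"]
        by (metis add_diff_cancel_left' cinner_add cinner_commute diff_add_cancel eq_iff_diff_eq_0)
      then have "u = S w" by (simp add: cinner_self_norm)
      then show "R (E w) = op S (E w)" using u by simp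
    qed (use R in \<open>auto simp: bounded_operators_def\<close>)
  qed
  then show ?thesis by (simp add: operator_algebra_def)
qed

end

section \<open>Two criteria from a kernel element and large orbits\<close>

context permutation_action
begin

lemma star_representation_op:
  fixes E :: "'x ell2 \<Rightarrow> 'h"
  assumes "ell2_embedding E"
  shows "star_representation (group_algebra G) (ell2_hilbert E) (\<lambda>f. ell2_embedding.op E (rep f))"
proof -
  interpret ell2_embedding E by fact
  have bdd: "op (rep f) \<in> bounded_operators H" if "f \<in> carrier (group_algebra G)" for f
    using rep_linear[OF that] norm_rep_le[OF that] by (rule bounded_operators_op)
  have "(\<lambda>f. op (rep f)) \<in> Ring.ring_hom (group_algebra G) (operator_algebra H)"
    using bdd by (auto simp: Ring.ring_hom_def operator_algebra_simps rep_one rep_add rep_mult intro!: op_cong)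
  moreover have "(\<lambda>f. op (rep f)) \<in> LinearCombinations.module_hom class_ring (group_algebra G) (operator_algebra H)"
    using bdd by (auto simp: LinearCombinations.module_hom_def operator_algebra_simps rep_add rep_cmult intro!: op_cong)
  moreover have "op (rep (star (group_algebra G) f)) = star (operator_algebra H) (op (rep f))"
    if f: "f \<in> carrier (group_algebra G)" for f
    by (rule star_op[symmetric]) (use bdd group_algebra_star_closed(1)[OF f] rep_adjoint[OF f] in auto)
  ultimately show ?thesis using hilbert_space_H by (auto simp: star_representation_def star_hom_def)
qed

text \<open>The point \<open>x\<close> may depend on \<open>n\<close>: levels of the tree are
  finite, so no single vertex has an infinite orbit.\<close>

definition unbounded_orbits :: bool where
  "unbounded_orbits \<longleftrightarrow> (\<forall>n. \<exists>x S. finite S \<and> card S \<ge> n \<and> S \<subseteq> carrier G \<and> inj_on (\<lambda>g. act g x) S)"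

lemma coord_rep_single:
  assumes "g \<in> carrier G"
  shows "coord (rep (\<lambda>y. if y = g then 1 else 0) (basis_vector x)) z = (if z = act g x then 1 else 0)"
proof -
  have "act (inv g) z = x \<longleftrightarrow> z = act g x" using assms act_inv by metis
  then show ?thesis using assms by (simp add: coord_rep conv_single)
qed

theorem not_star_just_infinite:
  fixes E :: "'x ell2 \<Rightarrow> nat \<Rightarrow> 'g \<Rightarrow> complex"
  assumes E: "ell2_embedding E" and orb: unbounded_orbits
    and z: "z \<in> carrier (group_algebra G)" "z \<noteq> (\<lambda>x. 0)" "\<And>v. rep z v = 0"
  shows "\<not> star_just_infinite (group_algebra G)"
proof -
  interpret ell2_embedding E by (rule E)
  let ?pi = "\<lambda>f. op (rep f)"
  let ?V = "(operator_algebra H)\<lparr>carrier := ?pi ` carrier (group_algebra G)\<rparr>"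
  have zero: "rep (\<lambda>x. 0) v = 0" for v by (simp add: rep_def)
  have "?pi z = ?pi (\<lambda>x. 0)" using z(3) zero by (intro op_cong) simp
  then have "\<not> inj_on ?pi (carrier (group_algebra G))"
    using z by (auto dest: inj_onD[of _ _ z "\<lambda>x. 0"])
  moreover have "\<not> finite_dimensional ?V"
  proof (rule not_finite_dimensional[where 'i = 'g])
    show "Module.module (class_ring :: complex ring) ?V"
    proof (rule module_surj_image[OF module_group_algebra, of ?pi])
      show "?pi \<in> LinearCombinations.module_hom class_ring (group_algebra G) ?V"
        by (auto simp: LinearCombinations.module_hom_def operator_algebra_simps rep_add rep_cmult intro!: op_cong)
      show "?pi \<zero>\<^bsub>group_algebra G\<^esub> = \<zero>\<^bsub>?V\<^esub>" by (auto simp: operator_algebra_simps zero intro!: op_cong)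
    qed simp
    fix n
    obtain x S where S: "finite S" "card S \<ge> n" "S \<subseteq> carrier G" "inj_on (\<lambda>g. act g x) S"
      using orb unfolding unbounded_orbits_def by blast
    let ?b = "\<lambda>g. ?pi (\<lambda>y. if y = g then 1 else 0)"
    \<comment> \<open>The matrix coefficient of \<open>T\<close> at the basis vectors of
      \<open>x\<close> and \<open>act g x\<close>. The elements of \<open>S\<close> move
      \<open>x\<close> to distinct points, which makes these coefficients dual to the operators
      \<open>?b\<close>.\<close>
    let ?l = "\<lambda>g T. coord (inv_into UNIV E (T (E (basis_vector x)))) (act g x)"
    have inv_E: "inv_into UNIV E (E v) = v" for v using inj by simp
    have "linear_functional ?V (?l g)" for g
      by (auto simp: linear_functional_def operator_algebra_simps inv_E)
    moreover have "?l g (?b h) = (if g = h then 1 else 0)" if "g \<in> S" "h \<in> S" for g h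
      using that S by (auto simp: inv_E coord_rep_single subset_iff dest: inj_onD[OF S(4)])
    moreover have "?b g \<in> carrier ?V" if "g \<in> S" for g using that S by auto
    ultimately show "\<exists>(I :: 'g set) b l. finite I \<and> n \<le> card I \<and> (\<forall>i\<in>I. b i \<in> carrier ?V) \<and>
        (\<forall>i\<in>I. linear_functional ?V (l i) \<and> (\<forall>j\<in>I. l i (b j) = (if i = j then 1 else 0)))"
      using S by (intro exI[of _ S] exI[of _ ?b] exI[of _ ?l]) blast
  qed
  ultimately show ?thesis
    using star_representation_op[OF E] unfolding star_just_infinite_def by blast
qed

text \<open>Here the matrix coefficients are functionals on the group algebra itself, bounded by the
  operator norm, which is the dominated seminorm in
  \<open>not_just_infinite_completion\<close>.\<close>

theorem not_just_infinite_full_group_cstar_algebra: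
  assumes orb: unbounded_orbits
    and z: "z \<in> carrier (group_algebra G)" "z \<noteq> (\<lambda>x. 0)" "\<And>v. rep z v = 0"
  shows "\<not> just_infinite (full_group_cstar_algebra G)"
proof -
  let ?M = "max_cstar_norm (group_algebra G)"
  let ?A = "star_algebra.extend (group_algebra G) (normed_star_algebra.fields ?M)"
  have A: "carrier ?A = carrier (group_algebra G)" "monoid.mult ?A = monoid.mult (group_algebra G)"
    "one ?A = one (group_algebra G)" "zero ?A = zero (group_algebra G)" "add ?A = add (group_algebra G)"
    "smult ?A = smult (group_algebra G)" "algebra_norm ?A = ?M"
    by (simp_all add: star_algebra.defs normed_star_algebra.defs)
  \<comment> \<open>\<open>?A\<close> only adds a norm field to the group algebra, so the identity
    map carries the ring and module axioms over.\<close>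
  have ring: "ring ?A"
    by (rule ring_surj_image[OF ring_group_algebra, of id]) (auto simp: Ring.ring_hom_def A simp del: group_algebra_simps)
  have module: "Module.module (class_ring :: complex ring) ?A"
    by (rule module_surj_image[OF module_group_algebra, of id])
      (auto simp: LinearCombinations.module_hom_def A simp del: group_algebra_simps)
  have sn: "algebra_seminorm ?A p" if "algebra_seminorm (group_algebra G) p" for p
    using that unfolding algebra_seminorm_def A .
  interpret A: normed_algebra_seminorm ?A opnorm
  proof (intro normed_algebra_seminorm.intro normed_algebra.intro normed_algebra_seminorm_axioms.intro)
    show "ring ?A" "Module.module class_ring ?A" by (rule ring, rule module)
    show "algebra_seminorm ?A (algebra_norm ?A)"
      unfolding A by (rule sn[OF algebra_seminorm_max_cstar_norm])
    show "algebra_seminorm ?A opnorm"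
      by (rule sn[OF cstar_imp_algebra_seminorm[OF cstar_seminorm_opnorm]])
    show "opnorm f \<le> algebra_norm ?A f" if "f \<in> carrier ?A" for f
      using that cstar_seminorm_le_max_cstar_norm[OF cstar_seminorm_opnorm] unfolding A by blast
  qed
  show ?thesis
    unfolding full_group_cstar_algebra_def
  proof (rule A.not_just_infinite_completion[where 'i = 'g])
    show "z \<in> carrier ?A" using z A by simp
    show "opnorm z = 0" using z(3) onorm_zero by (simp add: onorm_def)
    show "algebra_norm ?A z \<noteq> 0" using max_cstar_norm_pos[OF z(1,2)] A by simp
    fix n
    obtain x S where S: "finite S" "card S \<ge> n" "S \<subseteq> carrier G" "inj_on (\<lambda>g. act g x) S"
      using orb unfolding unbounded_orbits_def by blast
    let ?b = "\<lambda>g y. if y = g then 1 else 0 :: complex"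
    let ?l = "\<lambda>g f. coord (rep f (basis_vector x)) (act g x)"
    have "linear_functional ?A (?l g)" for g
      unfolding linear_functional_def A by (auto simp: rep_add rep_cmult)
    \<comment> \<open>A coordinate is at most the norm of the vector, and that is at most the
      operator norm times the norm of the basis vector; the latter is the constant
      \<open>K\<close>.\<close>
    moreover have "cmod (?l g f) \<le> norm (basis_vector x) * opnorm f" if "f \<in> carrier ?A" for g f
      using norm_coord_le[of "rep f (basis_vector x)" "act g x"] onorm[OF bounded_linear_rep, of f "basis_vector x"] that
      unfolding A by (simp add: mult.commute)
    moreover have "?l g (?b h) = (if g = h then 1 else 0)" if "g \<in> S" "h \<in> S" for g h
      using that S by (auto simp: coord_rep_single subset_iff dest: inj_onD[OF S(4)])
    moreover have "?b g \<in> carrier ?A" if "g \<in> S" for g using that S A by auto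
    ultimately show "\<exists>(I :: 'g set) b l K. finite I \<and> n \<le> card I \<and> (\<forall>i\<in>I. b i \<in> carrier ?A) \<and>
        (\<forall>i\<in>I. linear_functional ?A (l i) \<and> (\<forall>x\<in>carrier ?A. cmod (l i x) \<le> K * opnorm x) \<and>
          (\<forall>j\<in>I. l i (b j) = (if i = j then 1 else 0)))"
      using S by (intro exI[of _ S] exI[of _ ?b] exI[of _ ?l] exI[of _ "norm (basis_vector x)"]) blast
  qed
qed

end

section \<open>Branch groups\<close>

context permutation_action
begin

lemma act_inv_fixed: "g \<in> carrier G \<Longrightarrow> act (inv g) x = x \<longleftrightarrow> act g x = x"
  by (metis act_inv)

text \<open>The element \<open>(1 - g)(1 - h)\<close> of the group algebra.\<close>

definition difference_product :: "'g \<Rightarrow> 'g \<Rightarrow> 'g \<Rightarrow> complex" where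
  "difference_product g h = (\<lambda>x. (((if x = \<one> then 1 else 0) + (- 1) * (if x = g then 1 else 0))
      + (- 1) * (if x = h then 1 else 0)) + (if x = g \<otimes> h then 1 else 0))"

text \<open>The coefficient at \<open>\<one>\<close> is 1, or 2 if
  \<open>g \<otimes> h = \<one>\<close>, hence not 0. In the representation the four terms cancel in
  pairs at each point, according to which of \<open>g\<close> and \<open>h\<close> fixes it.\<close>

lemma
  assumes g: "g \<in> carrier G" and h: "h \<in> carrier G"
  shows difference_product_closed: "difference_product g h \<in> carrier (group_algebra G)"
    and difference_product_nonzero: "g \<noteq> \<one> \<Longrightarrow> h \<noteq> \<one> \<Longrightarrow> difference_product g h \<noteq> (\<lambda>x. 0)"
    and rep_difference_product: "(\<And>x. act g x = x \<or> act h x = x) \<Longrightarrow> rep (difference_product g h) v = 0"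
proof -
  show closed: "difference_product g h \<in> carrier (group_algebra G)"
    unfolding difference_product_def by (intro group_algebra_closed g h one_closed m_closed)
  show "difference_product g h \<noteq> (\<lambda>x. 0)" if "g \<noteq> \<one>" "h \<noteq> \<one>"
  proof
    assume "difference_product g h = (\<lambda>x. 0)"
    then have "difference_product g h \<one> = 0" by simp
    then show False using that by (auto simp: difference_product_def split: if_splits)
  qed
  assume disj: "\<And>x. act g x = x \<or> act h x = x"
  show "rep (difference_product g h) v = 0"
  proof (rule ell2_eqI)
    fix x
    let ?u = "coord v"
    have "coord (rep (difference_product g h) v) x
        = ?u (act (inv \<one>) x) + (- 1) * ?u (act (inv g) x) + (- 1) * ?u (act (inv h) x) + ?u (act (inv (g \<otimes> h)) x)"
      unfolding coord_rep[OF closed] unfolding difference_product_def using g h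
      by (simp only: conv_add_left conv_cmult_left conv_single group_algebra_closed one_closed m_closed mult_1)
    also have "act (inv (g \<otimes> h)) x = act (inv h) (act (inv g) x)"
      using g h by (simp add: inv_mult_group act_mult)
    also have "?u (act (inv \<one>) x) = ?u x" by (simp add: act_one)
    also have "?u x + (- 1) * ?u (act (inv g) x) + (- 1) * ?u (act (inv h) x) + ?u (act (inv h) (act (inv g) x)) = 0"
    proof (cases "act g x = x")
      case True
      then have "act (inv g) x = x" using g by (simp add: act_inv_fixed)
      then show ?thesis by simp
    next
      case False
      then have hx: "act (inv h) x = x" using disj[of x] h by (simp add: act_inv_fixed)
      \<comment> \<open>The point \<open>act (inv g) x\<close> is moved by \<open>g\<close> along
        with \<open>x\<close>, so \<open>h\<close> fixes both, and the terms cancel in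
        pairs.\<close>
      have "act g (act (inv g) x) \<noteq> act (inv g) x" using False g by (metis act_inv(2))
      then have "act (inv h) (act (inv g) x) = act (inv g) x"
        using disj[of "act (inv g) x"] h by (simp add: act_inv_fixed)
      then show ?thesis using hx by simp
    qed
    finally show "coord (rep (difference_product g h) v) x = coord 0 x" by simp
  qed
qed

lemma infinite_if_unbounded_orbits:
  assumes unbounded_orbits
  shows "infinite (carrier G)"
proof
  assume fin: "finite (carrier G)"
  obtain S where "card S \<ge> Suc (card (carrier G))" "S \<subseteq> carrier G"
    using assms unfolding unbounded_orbits_def by blast
  then show False using card_mono[OF fin, of S] by simp
qed

end

text \<open>The maps of a \<open>group_action\<close> are extensional, hence
  \<open>undefined\<close> off the set; replacing this value by the identity gives an action on the
  whole type.\<close>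

lemma permutation_action_extend:
  fixes G (structure)
  assumes "group_action G E \<phi>"
  shows "permutation_action G (\<lambda>g x. if x \<in> E then \<phi> g x else x)"
proof -
  interpret group_action G E \<phi> by fact
  interpret group G using group_hom group_hom.axioms(1) by blast
  show ?thesis
  proof
    fix x
    show "(if x \<in> E then \<phi> \<one> x else x) = x" by (simp add: id_eq_one[symmetric])
    fix g h assume gh: "g \<in> carrier G" "h \<in> carrier G"
    show "(if x \<in> E then \<phi> (g \<otimes> h) x else x)
      = (if (if x \<in> E then \<phi> h x else x) \<in> E then \<phi> g (if x \<in> E then \<phi> h x else x) else (if x \<in> E then \<phi> h x else x))"
      using composition_rule[OF _ gh, of x] element_image[OF gh(2) _ refl, of x] by simp
  qed
qed

section \<open>Vertices and automorphisms of the tree\<close>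

lemma tree_verts_iff: "u \<in> tree_verts m \<longleftrightarrow> (\<forall>i<length u. u ! i < m i)"
  by (auto simp: tree_verts_def tree_level_def)

lemma tree_verts_snoc: "u @ [i] \<in> tree_verts m \<Longrightarrow> u \<in> tree_verts m"
  unfolding tree_verts_iff by (metis butlast_snoc length_append_singleton less_SucI nth_butlast length_butlast)

text \<open>Walk down from \<open>v\<close> to \<open>u\<close>. Each step of the image path goes to
  a child, which stays below \<open>f v\<close>, or to a parent. The only way out of the subtree is
  the step from \<open>f v\<close> to the root, and injectivity forbids it because the root is
  already \<open>f []\<close>.\<close>

lemma tree_automorphism_prefix:
  assumes f: "f \<in> tree_automorphisms m" and v: "v \<in> tree_verts m" "v \<noteq> []" "length (f v) = 1"
  shows "u \<in> tree_verts m \<Longrightarrow> prefix v u \<Longrightarrow> prefix (f v) (f u)"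
proof (induction u rule: rev_induct)
  case Nil
  then show ?case using v by simp
next
  case (snoc i u)
  have inj: "inj_on f (tree_verts m)" and f0: "f [] = []"
    using f by (auto simp: tree_automorphisms_def Bij_def bij_betw_def)
  show ?case
  proof (cases "v = u @ [i]")
    case False
    then have "prefix v u" using snoc.prems by (simp add: prefix_snoc)
    have u: "u \<in> tree_verts m" using snoc.prems tree_verts_snoc by blast
    then have pre: "prefix (f v) (f u)" using snoc.IH \<open>prefix v u\<close> by blast
    have "tree_adjacent u (u @ [i])" by (simp add: tree_adjacent_def)
    then have "tree_adjacent (f u) (f (u @ [i]))"
      using f u snoc.prems(1) by (auto simp: tree_automorphisms_def)
    then consider j where "f (u @ [i]) = f u @ [j]" | j where "f u = f (u @ [i]) @ [j]"
      by (auto simp: tree_adjacent_def)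
    then show ?thesis
    proof cases
      case 1
      then show ?thesis using pre by (simp add: prefix_snoc)
    next
      case 2
      \<comment> \<open>A step to the parent leaves the subtree only if it starts at
        \<open>f v\<close> itself; as \<open>f v\<close> has length 1, it would then end at the
        root.\<close>
      then consider "f v = f (u @ [i]) @ [j]" | "prefix (f v) (f (u @ [i]))"
        using pre by (auto simp: prefix_snoc)
      then show ?thesis
      proof cases
        case 1
        then have "f (u @ [i]) = f []" using v(3) f0 by simp
        moreover have "[] \<in> tree_verts m" by (auto simp: tree_verts_def tree_level_def)
        ultimately show ?thesis using inj snoc.prems(1) by (auto dest: inj_onD)
      qed
    qed
  qed simp
qed

theorem theorem7p10:
  fixes G :: "('g, 'm) monoid_scheme"
  assumes "branch_group G"
  shows "\<not> star_just_infinite (group_algebra G) \<and>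
         \<not> just_infinite (full_group_cstar_algebra G)"
proof -
  obtain m \<phi> where "group G" and m: "\<And>n. m n \<ge> 2" and "faithful_action G (tree_verts m) \<phi>"
    and aut: "\<And>g. g \<in> carrier G \<Longrightarrow> \<phi> g \<in> tree_automorphisms m"
    and index: "\<And>n. finite (rcosets\<^bsub>G\<^esub> (rist_level G m \<phi> n))"
    and trans: "\<And>n v w. v \<in> tree_level m n \<Longrightarrow> w \<in> tree_level m n \<Longrightarrow> \<exists>g\<in>carrier G. \<phi> g v = w"
    using assms unfolding branch_group_def by blast
  let ?V = "tree_verts m"
  define act where "act g w = (if w \<in> ?V then \<phi> g w else w)" for g w
  have "group_action G ?V \<phi>" using \<open>faithful_action G ?V \<phi>\<close> by (simp add: faithful_action_def)
  then interpret permutation_action G act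
    unfolding act_def by (rule permutation_action_extend)
  have level: "w \<in> ?V" if "w \<in> tree_level m n" for w n using that by (auto simp: tree_verts_def)
  have orb: unbounded_orbits
    unfolding unbounded_orbits_def
  proof
    fix n
    \<comment> \<open>For \<open>i < n\<close> these are distinct vertices of level
      \<open>n\<close>, words with a single letter 1; letters 0 and 1 are allowed since
      \<open>m i \<ge> 2\<close>. By transitivity the zero word reaches all of them, so its orbit
      has at least \<open>n\<close> points.\<close>
    let ?w = "\<lambda>i. (replicate n 0)[i := 1 :: nat]"
    have "0 < m i" "1 < m i" for i using m[of i] by simp_all
    then have w: "replicate n 0 \<in> tree_level m n" "?w i \<in> tree_level m n" for i
    proof -
      have "?w i ! j < m j" if "j < n" for j
        using that \<open>0 < m j\<close> \<open>1 < m j\<close> by (cases "i = j") simp_all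
      then show "replicate n 0 \<in> tree_level m n" "?w i \<in> tree_level m n"
        using \<open>\<And>i. 0 < m i\<close> by (simp_all add: tree_level_def)
    qed
    have "inj_on ?w {..<n}"
    proof (rule inj_onI)
      fix i j assume ij: "i \<in> {..<n}" "j \<in> {..<n}" and "?w i = ?w j"
      then have "?w i ! i = ?w j ! i" by simp
      then show "i = j" using ij by (simp add: nth_list_update split: if_splits)
    qed
    have "\<forall>i. \<exists>g. g \<in> carrier G \<and> act g (replicate n 0) = ?w i"
      using trans[OF w] level[OF w(1)] by (auto simp: act_def)
    then obtain \<gamma> where \<gamma>: "\<And>i. \<gamma> i \<in> carrier G" "\<And>i. act (\<gamma> i) (replicate n 0) = ?w i" by metis
    have "inj_on \<gamma> {..<n}" "inj_on (\<lambda>g. act g (replicate n 0)) (\<gamma> ` {..<n})"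
      using \<open>inj_on ?w {..<n}\<close> \<gamma>(2) unfolding inj_on_def by (metis, auto simp: \<gamma>(2))
    then show "\<exists>x S. finite S \<and> card S \<ge> n \<and> S \<subseteq> carrier G \<and> inj_on (\<lambda>g. act g x) S"
      using \<gamma>(1) by (intro exI[of _ "replicate n 0"] exI[of _ "\<gamma> ` {..<n}"]) (auto simp: card_image)
  qed
  have rist: "rist_vertex G m \<phi> v \<subseteq> carrier G" for v by (auto simp: rist_vertex_def)
  have "\<exists>v\<in>tree_level m 1. \<exists>g\<in>rist_vertex G m \<phi> v. g \<noteq> \<one>\<^bsub>G\<^esub>"
  proof (rule ccontr)
    let ?U = "\<Union>v\<in>tree_level m 1. rist_vertex G m \<phi> v"
    let ?H = "rist_level G m \<phi> 1"
    assume "\<not> ?thesis"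
    then have "?H \<subseteq> generate G {\<one>\<^bsub>G\<^esub>}"
      unfolding rist_level_def by (intro mono_generate) auto
    then have fin: "finite ?H" using finite_subset by (auto simp: generate_one)
    have "subgroup ?H G" unfolding rist_level_def using rist by (intro generate_is_subgroup) auto
    then have "carrier G = \<Union> (rcosets\<^bsub>G\<^esub> ?H)" by (simp add: rcosets_part_G)
    moreover have "finite X" if "X \<in> rcosets\<^bsub>G\<^esub> ?H" for X
      using that fin by (auto simp: RCOSETS_def r_coset_def)
    ultimately have "finite (carrier G)" using index[of 1] by (metis finite_Union)
    then show False using infinite_if_unbounded_orbits[OF orb] by simp
  qed
  then obtain v g where v: "v \<in> tree_level m 1" and g: "g \<in> rist_vertex G m \<phi> v" "g \<noteq> \<one>\<^bsub>G\<^esub>" by blast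
  have "\<exists>w\<in>tree_level m 1. w \<noteq> v"
  proof -
    \<comment> \<open>Exchange the only letter of \<open>v\<close>: 1 for 0, and 0 for anything
      else. Both are allowed since \<open>m 0 \<ge> 2\<close>.\<close>
    have "[if hd v = 0 then 1 else 0] \<in> tree_level m 1" using m[of 0] by (auto simp: tree_level_def)
    then show ?thesis by (intro bexI[of _ "[if hd v = 0 then 1 else 0]"]) auto
  qed
  then obtain w where w: "w \<in> tree_level m 1" "w \<noteq> v" by blast
  obtain k where k: "k \<in> carrier G" "\<phi> k v = w" using trans[OF v w(1)] by blast
  have gG: "g \<in> carrier G" using g rist by blast
  define h where "h = k \<otimes>\<^bsub>G\<^esub> g \<otimes>\<^bsub>G\<^esub> inv\<^bsub>G\<^esub> k"
  have hG: "h \<in> carrier G" using k gG by (simp add: h_def)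
  have "h \<noteq> \<one>\<^bsub>G\<^esub>"
  proof
    assume "h = \<one>\<^bsub>G\<^esub>"
    then have "inv\<^bsub>G\<^esub> k \<otimes>\<^bsub>G\<^esub> (k \<otimes>\<^bsub>G\<^esub> g \<otimes>\<^bsub>G\<^esub> inv\<^bsub>G\<^esub> k) \<otimes>\<^bsub>G\<^esub> k = inv\<^bsub>G\<^esub> k \<otimes>\<^bsub>G\<^esub> \<one>\<^bsub>G\<^esub> \<otimes>\<^bsub>G\<^esub> k" by (simp add: h_def)
    then show False using k gG g(2) by (simp add: m_assoc) (simp add: m_assoc[symmetric])
  qed
  have moved: "x \<in> ?V \<and> prefix v x" if "act g x \<noteq> x" for x
    using that g(1) by (auto simp: act_def rist_vertex_def subtree_def split: if_splits)
  have disj: "act g x = x \<or> act h x = x" for x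
  proof (rule ccontr)
    assume "\<not> ?thesis"
    then have gx: "act g x \<noteq> x" and hx: "act h x \<noteq> x" by auto
    \<comment> \<open>\<open>h\<close> moves \<open>x\<close> exactly when \<open>g\<close> moves
      \<open>?y\<close>. So \<open>?y\<close> lies below \<open>v\<close>, and \<open>k\<close>
      carries it back to \<open>x\<close>, which must lie below
      \<open>\<phi> k v = w\<close>.\<close>
    let ?y = "act (inv\<^bsub>G\<^esub> k) x"
    have "act h x = act k (act g ?y)" using k gG by (simp add: h_def act_mult)
    then have "act g ?y \<noteq> ?y" using hx k by auto
    then have y: "?y \<in> ?V" "prefix v ?y" using moved by blast+
    have "prefix (\<phi> k v) (\<phi> k ?y)"
      using v w k by (intro tree_automorphism_prefix[OF aut[OF k(1)] level[OF v] _ _ y])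
        (auto simp: tree_level_def)
    then have "prefix w x" using k y(1) act_inv(2)[OF k(1), of x] by (simp add: act_def)
    moreover have "prefix v x" using moved[OF gx] by simp
    \<comment> \<open>Prefixes of one word that have equal length coincide, and \<open>v\<close> and
      \<open>w\<close> both have length 1.\<close>
    ultimately show False using v w by (auto simp: tree_level_def prefix_def append_eq_append_conv)
  qed
  let ?z = "difference_product g h"
  have z: "?z \<in> carrier (group_algebra G)" "?z \<noteq> (\<lambda>x. 0)" "\<And>v. rep ?z v = 0"
    using difference_product_closed[OF gG hG] difference_product_nonzero[OF gG hG g(2) \<open>h \<noteq> \<one>\<^bsub>G\<^esub>\<close>]
      rep_difference_product[OF gG hG disj] by auto
  \<comment> \<open>The target is the type that \<open>star_just_infinite\<close> prescribes for a
    group algebra. Vertices are words over \<open>nat\<close>, hence countable, so a vector is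
    determined by its coordinates along an enumeration; the value is constant in the group argument
    \<open>x\<close>.\<close>
  define E :: "nat list ell2 \<Rightarrow> nat \<Rightarrow> 'g \<Rightarrow> complex" where "E v n x = coord v (from_nat n)" for v n x
  have "ell2_embedding E"
  proof
    show "inj E"
    proof (rule injI)
      fix v w assume "E v = E w"
      then have "E v (to_nat x) undefined = E w (to_nat x) undefined" for x :: "nat list" by simp
      then show "v = w" by (intro ell2_eqI) (simp add: E_def)
    qed
  qed
  then show ?thesis
    using not_star_just_infinite[OF _ orb z] not_just_infinite_full_group_cstar_algebra[OF orb z] by blast
qed

end
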